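(* Let $G$ be a directed unweighted graph with $n$ vertices, a source $s$, a sink $t$, and an $(s,t)$-min-cut of size $\lambda$. There exists a data structure (dual fault-tolerant min-cut oracle) of size $O(\lambda n)$ that, given any set $F$ of two edges of $G$, reports the size of an $(s,t)$-min-cut in $G-F$ in $O(1)$ time. Furthermore, the oracle reports an $(s,t)$-min-cut partition of $G-F$ in $O(n)$ time.
   Context: Graphs are directed multigraphs with unit edge capacities. An $(s,t)$-cut is a set $C$ of edges such that $G-C$ has no $s$-to-$t$ path; an $(s,t)$-min-cut is one of minimum cardinality, equivalently represented by the partition $(A,B)$ of $V$ with $s\in A$, $t\in B$. $G-F$ is $G$ with the edges of $F$ deleted. *)

theory Defs
  imports "Graph_Theory.Digraph" "HOL-Library.Log_Nat"
begin

section \<open>Cuts\<close>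

definition del_arcs :: "('v, 'e) pre_digraph \<Rightarrow> 'e set \<Rightarrow> ('v, 'e) pre_digraph" where
  "del_arcs G F = G\<lparr>arcs := arcs G - F\<rparr>"

definition is_cut :: "('v, 'e) pre_digraph \<Rightarrow> 'v \<Rightarrow> 'v \<Rightarrow> 'e set \<Rightarrow> bool" where
  "is_cut G s t C \<longleftrightarrow> C \<subseteq> arcs G \<and> \<not> s \<rightarrow>\<^sup>*\<^bsub>del_arcs G C\<^esub> t"

definition is_min_cut :: "('v, 'e) pre_digraph \<Rightarrow> 'v \<Rightarrow> 'v \<Rightarrow> 'e set \<Rightarrow> bool" where
  "is_min_cut G s t C \<longleftrightarrow> is_cut G s t C \<and> (\<forall>C'. is_cut G s t C' \<longrightarrow> card C \<le> card C')"

definition min_cut_size :: "('v, 'e) pre_digraph \<Rightarrow> 'v \<Rightarrow> 'v \<Rightarrow> nat" where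
  "min_cut_size G s t = (LEAST k. \<exists>C. is_cut G s t C \<and> card C = k)"

definition is_min_cut_partition ::
  "('v, 'e) pre_digraph \<Rightarrow> 'v \<Rightarrow> 'v \<Rightarrow> 'v set \<Rightarrow> 'v set \<Rightarrow> bool" where
  "is_min_cut_partition G s t A B \<longleftrightarrow>
     A \<union> B = verts G \<and> A \<inter> B = {} \<and> s \<in> A \<and> t \<in> B \<and>
     is_min_cut G s t {e \<in> arcs G. tail G e \<in> A \<and> head G e \<in> B}"


section \<open>Word RAM\<close>

text \<open>
  A word is a natural number below \<open>2 ^ w\<close>, where \<open>w\<close> is the word length. Results of
  arithmetic are truncated to \<open>w\<close> bits; without truncation a single cell could
  encode an entire data structure. A program mentions only finitely many registers.
\<close>

datatype binop = Add | Sub | Mul | Div | Mod | And | Or | Xor | Shl | Shr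

fun eval_binop :: "nat \<Rightarrow> binop \<Rightarrow> nat \<Rightarrow> nat \<Rightarrow> nat" where
  "eval_binop w Add a b = take_bit w (a + b)"
| "eval_binop w Sub a b = take_bit w (2 ^ w + a - b)"
| "eval_binop w Mul a b = take_bit w (a * b)"
| "eval_binop w Div a b = take_bit w (a div b)"
| "eval_binop w Mod a b = take_bit w (a mod b)"
| "eval_binop w And a b = take_bit w (Bit_Operations.and a b)"
| "eval_binop w Or  a b = take_bit w (Bit_Operations.or a b)"
| "eval_binop w Xor a b = take_bit w (Bit_Operations.xor a b)"
| "eval_binop w Shl a b = take_bit w (push_bit b a)"
| "eval_binop w Shr a b = take_bit w (drop_bit b a)"

text \<open>
  In \<open>Load i j\<close> and \<open>Store i j\<close> the address is in register \<open>j\<close> and \<open>i\<close>,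
  respectively. \<open>Emit\<close> appends a register to the output.
\<close>

datatype instr =
    Const nat nat
  | Binop binop nat nat nat
  | Load nat nat
  | Store nat nat
  | Jump_eq nat nat nat
  | Jump_less nat nat nat
  | Emit nat
  | Halt

type_synonym program = "instr list"

record config =
  pc :: nat
  regs :: "nat \<Rightarrow> nat"
  mem :: "nat \<Rightarrow> nat"
  out :: "nat list"

fun exec :: "nat \<Rightarrow> instr \<Rightarrow> config \<Rightarrow> config" where
  "exec w (Const i a) c = c\<lparr>pc := pc c + 1, regs := (regs c)(i := take_bit w a)\<rparr>"
| "exec w (Binop f i j k) c =
     c\<lparr>pc := pc c + 1, regs := (regs c)(i := eval_binop w f (regs c j) (regs c k))\<rparr>"
| "exec w (Load i j) c = c\<lparr>pc := pc c + 1, regs := (regs c)(i := mem c (regs c j))\<rparr>"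
| "exec w (Store i j) c = c\<lparr>pc := pc c + 1, mem := (mem c)(regs c i := regs c j)\<rparr>"
| "exec w (Jump_eq i j l) c = c\<lparr>pc := (if regs c i = regs c j then l else pc c + 1)\<rparr>"
| "exec w (Jump_less i j l) c = c\<lparr>pc := (if regs c i < regs c j then l else pc c + 1)\<rparr>"
| "exec w (Emit i) c = c\<lparr>pc := pc c + 1, out := out c @ [regs c i]\<rparr>"
| "exec w Halt c = c"

definition halted :: "program \<Rightarrow> config \<Rightarrow> bool" where
  "halted P c \<longleftrightarrow> pc c \<ge> length P \<or> P ! pc c = Halt"

definition step :: "nat \<Rightarrow> program \<Rightarrow> config \<Rightarrow> config" where
  "step w P c = (if halted P c then c else exec w (P ! pc c) c)"

definition init_config :: "nat list \<Rightarrow> (nat \<Rightarrow> nat) \<Rightarrow> config" where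
  "init_config args M =
     \<lparr>pc = 0, regs = (\<lambda>i. if i < length args then args ! i else 0), mem = M, out = []\<rparr>"

definition stored :: "nat list \<Rightarrow> (nat \<Rightarrow> nat) \<Rightarrow> bool" where
  "stored D M \<longleftrightarrow> (\<forall>i < length D. M i = D ! i)"

text \<open>
  \<open>query w P D args T Q\<close>: on input \<open>args\<close>, with the data structure \<open>D\<close> in the first
  \<open>length D\<close> memory cells, \<open>P\<close> halts within \<open>T\<close> steps with an output satisfying \<open>Q\<close>.
  The other cells serve as scratch space with arbitrary initial contents, and \<open>D\<close> is
  intact afterwards, so that queries can be asked repeatedly.
\<close>

definition query ::
  "nat \<Rightarrow> program \<Rightarrow> nat list \<Rightarrow> nat list \<Rightarrow> nat \<Rightarrow> (nat list \<Rightarrow> bool) \<Rightarrow> bool" where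
  "query w P D args T Q \<longleftrightarrow>
     (\<forall>M. (\<forall>i. M i < 2 ^ w) \<and> stored D M \<longrightarrow>
       (let c = (step w P ^^ T) (init_config args M)
        in halted P c \<and> Q (out c) \<and> stored D (mem c)))"


section \<open>Dual fault-tolerant min-cut oracles\<close>

text \<open>Vertices and edges are numbered from 0, so each fits into one word as soon as \<open>k \<ge> 1\<close>.\<close>

definition word_length :: "nat \<Rightarrow> (nat, nat) pre_digraph \<Rightarrow> nat" where
  "word_length k G = k * ceillog2 (card (verts G) + card (arcs G))"

text \<open>
  A partition \<open>(A, B)\<close> of the vertices \<open>0, \<dots>, n - 1\<close> is output as the list of \<open>n\<close>
  bits that is 1 exactly at the members of \<open>A\<close>. The two failing edges are
  given by their numbers, in either order.
\<close>

definition is_dual_ft_min_cut_oracle ::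
  "nat \<Rightarrow> program \<Rightarrow> nat \<Rightarrow> program \<Rightarrow> nat \<Rightarrow>
   (nat, nat) pre_digraph \<Rightarrow> nat \<Rightarrow> nat \<Rightarrow> nat list \<Rightarrow> bool" where
  "is_dual_ft_min_cut_oracle w P_size T_size P_cut T_cut G s t D \<longleftrightarrow>
     (\<forall>x \<in> set D. x < 2 ^ w) \<and>
     (\<forall>e\<^sub>1 \<in> arcs G. \<forall>e\<^sub>2 \<in> arcs G. e\<^sub>1 \<noteq> e\<^sub>2 \<longrightarrow>
        query w P_size D [e\<^sub>1, e\<^sub>2] T_size
          (\<lambda>xs. xs = [min_cut_size (del_arcs G {e\<^sub>1, e\<^sub>2}) s t]) \<and>
        query w P_cut D [e\<^sub>1, e\<^sub>2] T_cut
          (\<lambda>xs. \<exists>A B. is_min_cut_partition (del_arcs G {e\<^sub>1, e\<^sub>2}) s t A B \<and>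
                 xs = map (\<lambda>v. if v \<in> A then 1 else 0) [0..<card (verts G)]))"

end

theory Submission
  imports Defs
begin

text \<open>
  Fix \<open>\<lambda>\<close> edge-disjoint \<open>s\<close>-\<open>t\<close> paths. A cut \<open>A\<close> has \<open>\<lambda>\<close> edges plus one for every residual arc that
  leaves \<open>A\<close>, so only cuts with at most one residual arc matter. Those without residual arcs are
  described by reachability in the residual graph, and since a path can be walked backwards there,
  a table with one entry for every vertex and path suffices. An edge \<open>(a, b)\<close> that lies on no minimum
  cut lies on a cut with the single residual arc \<open>z\<close> iff \<open>z\<close> separates \<open>a\<close> from \<open>b\<close>. Choose a root \<open>r\<close> in
  every strongly connected component and let \<open>dom z\<close> be the set of vertices that \<open>r\<close> cannot reach
  without \<open>z\<close>. For cuts containing the root, \<open>b\<close> lies in \<open>dom z\<close>; the other cuts are those of the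
  reversed network. The sets \<open>dom z\<close> are laminar, and if \<open>z\<close> separates \<open>a\<close> from \<open>b\<close>, then so does every
  \<open>z'\<close> with \<open>b \<in> dom z' \<subseteq> dom z\<close>. Hence the separators of an edge are described by the largest
  \<open>dom z\<close>. Reachability from \<open>a\<close> inside \<open>dom z\<close> does not depend on the choice of the separator \<open>z\<close>, which
  makes it possible to tabulate it with one entry for every vertex and path. Numbering the
  vertices in preorder turns the sets \<open>dom z\<close> into intervals. Edge numbers are looked up by
  two-level hashing.
\<close>


section \<open>Separating arcs\<close>

text \<open>Two failures remove at most two edges of a cut, so a cut with two or more residual arcs
  keeps at least \<open>lam\<close> edges; that is why one residual arc is the hard case. Space is
  the obstacle. There may be far more than \<open>lam * n\<close> edges, so not every edge can own a
  record, and even the flow edges cannot each own a row with one entry per path. The first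
  difficulty is met by the observation that an edge outside the flow is its own residual arc: only
  the edge itself can separate its ends, and such bridges have distinct heads, so at most
  \<open>n\<close> of them per direction need a record. All other edges outside the flow share one
  default record. The second is met by indexing rows by vertices, through the outermost separator of
  an edge and the innermost bridge set around a vertex. The sets \<open>dom z\<close> are the
  vertices dominated by the arc \<open>z\<close> in the flow graph of a component, and their
  laminarity is the dominator tree. One root function serves both directions: it lies either on the
  source side of a cut or on the source side of the complementary cut in the reversed
  network.\<close>

locale arc_relation =
  fixes E :: "'e set" and src dst :: "'e \<Rightarrow> 'v" and Q :: "('v \<times> 'v) set"
begin

definition rel :: "'e set \<Rightarrow> ('v \<times> 'v) set" where
  "rel X = Q \<union> {(src e, dst e) | e. e \<in> E - X}"

definition reach :: "'e set \<Rightarrow> 'v \<Rightarrow> 'v \<Rightarrow> bool" where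
  "reach X u v \<longleftrightarrow> (u, v) \<in> (rel X)\<^sup>*"

lemma reach_refl [simp, intro]: "reach X u u"
  by (simp add: reach_def)

lemma reach_trans [trans]: "reach X u v \<Longrightarrow> reach X v w \<Longrightarrow> reach X u w"
  by (simp add: reach_def)

lemma reach_mono: "reach X u v \<Longrightarrow> Y \<subseteq> X \<Longrightarrow> reach Y u v"
  unfolding reach_def by (rule subsetD[OF rtrancl_mono]) (auto simp: rel_def)

lemma reach_empty: "reach X u v \<Longrightarrow> reach {} u v"
  by (rule reach_mono) auto

lemma reach_arc: "e \<in> E \<Longrightarrow> e \<notin> X \<Longrightarrow> reach X (src e) (dst e)"
  unfolding reach_def rel_def by blast

lemma reach_Q: "(u, v) \<in> Q \<Longrightarrow> reach X u v"
  unfolding reach_def rel_def by blast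

lemma reach_closed:
  assumes "reach X u v" "u \<in> A"
    and "\<And>p q. (p, q) \<in> Q \<Longrightarrow> p \<in> A \<Longrightarrow> q \<in> A"
    and "\<And>e. e \<in> E \<Longrightarrow> e \<notin> X \<Longrightarrow> src e \<in> A \<Longrightarrow> dst e \<in> A"
  shows "v \<in> A"
  using assms(1) unfolding reach_def
proof (induction rule: rtrancl_induct)
  case base
  then show ?case using assms(2) .
next
  case (step y z)
  then show ?case using assms(3,4) by (auto simp: rel_def)
qed

text \<open>Cut a walk from \<open>u\<close> to \<open>v\<close> at its first traversal of
  \<open>e\<close> for the second claim and at its last one for the third. Later arguments use this
  to continue along an arc that has turned out to be unavoidable.\<close>

lemma reach_through:
  assumes "reach X u v" and "\<not> reach (insert e X) u v"
  shows "e \<in> E" "reach (insert e X) u (src e)" "reach (insert e X) (dst e) v"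
proof -
  have "e \<in> E \<and> reach (insert e X) u (src e)"
    using assms unfolding reach_def
  proof (induction rule: rtrancl_induct)
    case (step y z)
    show ?case
    proof (cases "(u, y) \<in> (rel (insert e X))\<^sup>*")
      case True
      then have "(y, z) \<notin> rel (insert e X)"
        using step.prems by (meson rtrancl.rtrancl_into_rtrancl)
      then have "y = src e \<and> e \<in> E" using step.hyps(2) by (auto simp: rel_def)
      then show ?thesis using True by simp
    qed (use step in blast)
  qed auto
  then show "e \<in> E" "reach (insert e X) u (src e)" by auto
  show "reach (insert e X) (dst e) v"
    using assms unfolding reach_def
  proof (induction rule: converse_rtrancl_induct)
    case (step y z)
    show ?case
    proof (cases "(z, v) \<in> (rel (insert e X))\<^sup>*")
      case True
      then have "(y, z) \<notin> rel (insert e X)"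
        using step.prems by (meson converse_rtrancl_into_rtrancl)
      then have "z = dst e" using step.hyps(1) by (auto simp: rel_def)
      then show ?thesis using True by simp
    qed (use step in blast)
  qed auto
qed

text \<open>A walk that starts at the head of \<open>e\<close> can be cut after its last use of
  \<open>e\<close>. Formally, if the deletion of \<open>e\<close> destroyed reachability,
  \<open>reach_through\<close> would supply the very walk that is denied.\<close>

lemma reach_from_dst: "reach X (dst e) v \<Longrightarrow> reach (insert e X) (dst e) v"
  using reach_through(3) by blast

section \<open>Mutual reachability\<close>

definition conn :: "'v \<Rightarrow> 'v \<Rightarrow> bool" where
  "conn u v \<longleftrightarrow> reach {} u v \<and> reach {} v u"

lemma conn_sym: "conn u v \<Longrightarrow> conn v u"
  by (auto simp: conn_def)

lemma conn_trans [trans]: "conn u v \<Longrightarrow> conn v w \<Longrightarrow> conn u w"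
  by (auto simp: conn_def intro: reach_trans)

lemma conn_between: "conn u w \<Longrightarrow> reach X u v \<Longrightarrow> reach Y v w \<Longrightarrow> conn v w"
  by (auto simp: conn_def dest: reach_empty intro: reach_trans)

end

section \<open>Arc domination in rooted components\<close>

locale rooted_arc_relation = arc_relation E src dst Q
  for E :: "'e set" and src dst :: "'e \<Rightarrow> 'v" and Q :: "('v \<times> 'v) set" +
  fixes r :: "'v \<Rightarrow> 'v"
  assumes conn_root: "conn v (r v)"
    and root_eq: "conn u v \<Longrightarrow> r u = r v"
begin

text \<open>Arc domination: every walk from the root to \<open>v\<close> uses \<open>e\<close>. Each
  vertex is measured from the root of its own component, so that one family of sets covers all
  components at once.\<close>

definition dom :: "'e \<Rightarrow> 'v set" where
  "dom e = {v. \<not> reach {e} (r v) v}"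

lemma dom_through:
  assumes "v \<in> dom e"
  shows "e \<in> E" "reach {e} (r v) (src e)" "reach {e} (dst e) v"
    "conn v (src e)" "conn v (dst e)"
proof -
  have 1: "reach {} (r v) v" using conn_root conn_def by blast
  have 2: "\<not> reach {e} (r v) v" using assms by (simp add: dom_def)
  note t = reach_through[OF 1, of e, OF 2]
  show 3: "e \<in> E" "reach {e} (r v) (src e)" "reach {e} (dst e) v" using t by auto
  have a: "reach {} (src e) (dst e)" using reach_arc 3 by blast
  have b: "reach {} v (r v)" "reach {} (r v) (src e)" "reach {} (dst e) v"
    using 3(2,3) conn_root[of v] reach_empty by (auto simp: conn_def)
  show "conn v (src e)"
    unfolding conn_def using b(1) b(2) a b(3) by (blast intro: reach_trans[OF _ reach_trans])
  show "conn v (dst e)"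
    unfolding conn_def using reach_trans[OF reach_trans[OF b(1,2)] a] b(3) by blast
qed

text \<open>Otherwise the walk from the common root to \<open>u\<close> continues to
  \<open>v\<close> without \<open>e\<close>. In other words, within a component only
  \<open>e\<close> itself enters \<open>dom e\<close>.\<close>

lemma dom_backward:
  assumes "reach {e} u v" "v \<in> dom e" "conn u v"
  shows "u \<in> dom e"
  using assms(1,2) root_eq[OF assms(3)] by (auto simp: dom_def dest: reach_trans)

lemma dst_in_dom: "v \<in> dom e \<Longrightarrow> dst e \<in> dom e"
  using dom_backward[OF dom_through(3) _ conn_sym[OF dom_through(5)]] by blast

lemma src_notin_dom: "src e \<notin> dom e"
proof
  assume "src e \<in> dom e"
  then show False using dom_through(2)[of "src e" e] by (simp add: dom_def)
qed

lemma dom_conn: "u \<in> dom e \<Longrightarrow> v \<in> dom e \<Longrightarrow> conn u v"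
  using conn_trans[OF dom_through(4) conn_sym[OF dom_through(4)]] by blast

text \<open>A walk from the root that avoids \<open>e'\<close> still has to use \<open>e\<close> on
  its way to a vertex of \<open>dom e\<close>, and thereby reaches \<open>dst e\<close> without
  \<open>e'\<close>.\<close>

lemma dom_subset:
  assumes "dst e \<in> dom e'"
  shows "dom e \<subseteq> dom e'"
proof (cases "e = e'")
  case False
  show ?thesis
  proof
    fix w assume w: "w \<in> dom e"
    show "w \<in> dom e'"
    proof (rule ccontr)
      assume "w \<notin> dom e'"
      then have 1: "reach {e'} (r w) w" by (simp add: dom_def)
      moreover have "\<not> reach {e', e} (r w) w"
        using w reach_mono[of "{e', e}" _ _ "{e}"] by (auto simp: dom_def)
      ultimately have "reach {e'} (r w) (src e)" "e \<in> E"
        using reach_through(1,2)[of "{e'}" "r w" w e] reach_mono[of "{e, e'}" _ _ "{e'}"]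
        by (auto simp: insert_commute)
      then have "reach {e'} (r w) (dst e)"
        using False reach_arc reach_trans by blast
      moreover have "r w = r (dst e)" using w dom_through(5) root_eq by blast
      ultimately show False using assms by (simp add: dom_def)
    qed
  qed
qed auto

text \<open>Suppose the root reaches \<open>dst e'\<close> without \<open>e\<close>. Then
  \<open>e'\<close> cannot be unavoidable between \<open>dst e\<close> and \<open>v\<close>, for
  this would give a walk from \<open>dst e'\<close>, and so from the root, to \<open>v\<close>
  without \<open>e\<close>. Hence \<open>dst e\<close> reaches \<open>v\<close> without
  \<open>e'\<close> and lies in \<open>dom e'\<close> by \<open>dom_backward\<close>.\<close>

lemma dom_laminar:
  assumes "v \<in> dom e" "v \<in> dom e'"
  shows "dst e \<in> dom e' \<or> dst e' \<in> dom e"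
proof (cases "dst e' \<in> dom e")
  case False
  have c: "conn v (dst e')" "conn v (dst e)" using assms dom_through by auto
  have 1: "reach {e} (r v) (dst e')" using False root_eq[OF c(1)] by (simp add: dom_def)
  have "reach {e, e'} (dst e) v"
  proof (rule ccontr)
    assume "\<not> reach {e, e'} (dst e) v"
    then have "\<not> reach {e', e} (dst e) v" by (simp add: insert_commute)
    then have "reach {e', e} (dst e') v"
      by (rule reach_through(3)[OF dom_through(3)[OF assms(1)]])
    then have "reach {e} (dst e') v" by (rule reach_mono) auto
    then show False using reach_trans[OF 1] assms(1) by (simp add: dom_def)
  qed
  then have "reach {e'} (dst e) v" by (rule reach_mono) auto
  then show ?thesis using dom_backward[OF _ assms(2) conn_sym[OF c(2)]] by blast
qed auto

lemma dom_nested: "v \<in> dom e \<Longrightarrow> v \<in> dom e' \<Longrightarrow> dom e \<subseteq> dom e' \<or> dom e' \<subseteq> dom e"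
  using dom_laminar dom_subset by blast

text \<open>The tail of \<open>e\<close> lies outside the common set, so the root reaches it without
  \<open>e'\<close>. If the arcs differed, one more step along \<open>e\<close> would enter
  \<open>dom e'\<close> without \<open>e'\<close>.\<close>

lemma dom_inj:
  assumes "v \<in> dom e" "dom e = dom e'"
  shows "e = e'"
proof (rule ccontr)
  assume ne: "e \<noteq> e'"
  have y: "dst e \<in> dom e'" using dst_in_dom assms by blast
  then have c: "conn (dst e) (src e)" using dom_through(4)[OF dst_in_dom[OF assms(1)]] by blast
  have "src e \<notin> dom e'" using src_notin_dom assms(2) by blast
  then have "reach {e'} (r (dst e)) (src e)" using root_eq[OF c] by (simp add: dom_def)
  moreover have "reach {e'} (src e) (dst e)" using reach_arc ne dom_through(1) assms(1) by blast
  ultimately have "reach {e'} (r (dst e)) (dst e)" by (rule reach_trans)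
  then show False using y by (simp add: dom_def)
qed

text \<open>Heads can therefore serve as names of the nonempty sets \<open>dom z\<close>, and there
  are at most as many bridges as vertices.\<close>

lemma dom_same_dst:
  assumes "v \<in> dom e" "v' \<in> dom e'" "dst e = dst e'"
  shows "e = e'"
proof -
  have "dst e \<in> dom e" "dst e' \<in> dom e'" using assms dst_in_dom by blast+
  then have "dom e = dom e'" using dom_subset[of e e'] dom_subset[of e' e] assms(3) by auto
  then show ?thesis using dom_inj assms(1) by blast
qed

text \<open>Followed backwards, a walk that avoids \<open>z\<close> and ends in \<open>dom z\<close>
  never leaves \<open>dom z\<close>, by \<open>dom_backward\<close>. The tail of \<open>e\<close>
  lies outside \<open>dom e\<close> and hence outside \<open>dom z\<close>, so the walk cannot use
  \<open>e\<close>.\<close>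

lemma reach_inside:
  assumes "reach {z} u v" "v \<in> dom z" "conn u v" "dom z \<subseteq> dom e"
  shows "reach {e, z} u v"
proof (cases "z = e")
  case False
  show ?thesis
  proof (rule ccontr)
    assume n: "\<not> reach {e, z} u v"
    note t = reach_through[OF assms(1) n]
    have "reach {z} (src e) (dst e)" using reach_arc[OF t(1)] False by simp
    moreover have "reach {z} (dst e) v" using t(3) by (rule reach_mono) auto
    ultimately have 1: "reach {z} (src e) v" by (rule reach_trans)
    moreover have "conn (src e) v"
      using conn_between[OF assms(3) t(2) 1] .
    ultimately have "src e \<in> dom z" using dom_backward[OF 1 assms(2)] by simp
    then show False using src_notin_dom assms(4) by blast
  qed
qed (use assms(1) in simp)

lemma reach_inside':
  assumes "reach {z} u v" "v \<in> dom z" "conn u v" "dom z \<subseteq> dom e"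
  shows "reach {e} u v"
  by (rule reach_mono[OF reach_inside[OF assms]]) simp

end

section \<open>Preorder numberings of forests\<close>

text \<open>Here \<open>le\<close> is the ancestor relation. A minimal element is the root of a
  tree; its descendants are numbered first, beginning with the root, and the remaining forest is
  shifted behind them.\<close>

lemma forest_preorder_numbering:
  fixes V :: "'v set" and le :: "'v \<Rightarrow> 'v \<Rightarrow> bool"
  assumes "finite V"
    and refl: "\<And>u. u \<in> V \<Longrightarrow> le u u"
    and antisym: "\<And>u v. u \<in> V \<Longrightarrow> v \<in> V \<Longrightarrow> le u v \<Longrightarrow> le v u \<Longrightarrow> u = v"
    and trans: "\<And>u v w. u \<in> V \<Longrightarrow> v \<in> V \<Longrightarrow> w \<in> V \<Longrightarrow> le u v \<Longrightarrow> le v w \<Longrightarrow> le u w"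
    and chain: "\<And>u u' v. u \<in> V \<Longrightarrow> u' \<in> V \<Longrightarrow> v \<in> V \<Longrightarrow> le u v \<Longrightarrow> le u' v \<Longrightarrow> le u u' \<or> le u' u"
  shows "\<exists>pre. bij_betw pre V {..<card V} \<and>
    (\<forall>u\<in>V. pre ` {v \<in> V. le u v} = {pre u ..< pre u + card {v \<in> V. le u v}})"
proof -
  have "\<exists>pre. bij_betw pre W {..<card W} \<and>
      (\<forall>u\<in>W. pre ` {v \<in> W. le u v} = {pre u ..< pre u + card {v \<in> W. le u v}})"
    if "W \<subseteq> V" for W
    using finite_subset[OF that assms(1)] that
  proof (induction W rule: finite_psubset_induct)
    case (psubset W)
    show ?case
    proof (cases "W = {}")
      case False
      have "\<exists>u\<in>W. \<forall>w\<in>W. le w u \<longrightarrow> w = u"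
      proof -
        define R where "R = {(w, u). w \<in> W \<and> u \<in> W \<and> le w u \<and> w \<noteq> u}"
        have "R \<subseteq> W \<times> W" by (auto simp: R_def)
        then have fin: "finite R" using psubset.hyps finite_subset by blast
        have "trans R" 
        proof (rule transI)
          fix x y z assume "(x, y) \<in> R" "(y, z) \<in> R"
          then have 1: "x \<in> W" "y \<in> W" "z \<in> W" "le x y" "le y z" "x \<noteq> y" by (auto simp: R_def)
          then have "x \<in> V" "y \<in> V" "z \<in> V" using psubset.prems by auto
          then have "le x z" "x \<noteq> z" using trans[of x y z] antisym[of x y] 1 by auto
          then show "(x, z) \<in> R" using 1 by (simp add: R_def)
        qed
        then have "acyclic R" unfolding acyclic_irrefl by (simp add: irrefl_def R_def)
        then have "wf R" using fin finite_acyclic_wf by blast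
        then obtain u where "u \<in> W" "\<And>w. (w, u) \<in> R \<Longrightarrow> w \<notin> W"
          using False wfE_min[of R] by (metis all_not_in_conv)
        then show ?thesis unfolding R_def by blast
      qed
      then obtain u where u: "u \<in> W" and umin: "\<And>w. w \<in> W \<Longrightarrow> le w u \<Longrightarrow> w = u" by blast
      define D where "D = {v \<in> W. le u v}"
      define A where "A = D - {u}"
      define B where "B = W - D"
      have uD: "u \<in> D" using u refl psubset.prems by (auto simp: D_def)
      have DW: "D \<subseteq> W" by (auto simp: D_def)
      have fD: "finite D" using DW psubset.hyps finite_subset by blast
      have "A \<subset> W" "B \<subset> W" using uD DW by (auto simp: A_def B_def)
      then have AB: "A \<subset> W" "A \<subseteq> V" "B \<subset> W" "B \<subseteq> V" using psubset.prems by auto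
      obtain pA where pA: "bij_betw pA A {..<card A}"
          "\<And>u. u \<in> A \<Longrightarrow> pA ` {v \<in> A. le u v} = {pA u ..< pA u + card {v \<in> A. le u v}}"
        using psubset.IH[OF AB(1,2)] by blast
      obtain pB where pB: "bij_betw pB B {..<card B}"
          "\<And>u. u \<in> B \<Longrightarrow> pB ` {v \<in> B. le u v} = {pB u ..< pB u + card {v \<in> B. le u v}}"
        using psubset.IH[OF AB(3,4)] by blast
      have cD: "card D = Suc (card A)"
        using uD fD by (simp add: A_def card_Suc_Diff1 del: card_Diff_insert)
      have cW: "card W = card D + card B"
        using DW fD psubset.hyps by (simp add: B_def card_Diff_subset card_mono)
      define pre where "pre v = (if v = u then 0 else if v \<in> A then Suc (pA v) else card D + pB v)" for v
      have preA: "pre v = Suc (pA v)" if "v \<in> A" for v using that by (auto simp: pre_def A_def)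
      have preB: "pre v = card D + pB v" if "v \<in> B" for v
        using that uD by (auto simp: pre_def A_def B_def)
      have imA: "pre ` S = Suc ` pA ` S" if "S \<subseteq> A" for S
        using that preA by (force simp: image_iff)
      have imB: "pre ` S = (+) (card D) ` pB ` S" if "S \<subseteq> B" for S
        using that preB by (force simp: image_iff)
      have imD: "pre ` D = {..<card D}"
      proof -
        have "D = insert u A" using uD by (auto simp: A_def)
        then have "pre ` D = insert (pre u) (pre ` A)" by (metis image_insert)
        then have "pre ` D = insert 0 (Suc ` pA ` A)" using imA[of A] pre_def[of u] by simp
        also have "pA ` A = {..<card A}" using pA(1) by (simp add: bij_betw_def)
        finally show ?thesis by (simp add: cD lessThan_Suc_eq_insert_0)
      qed
      have "pre ` W = {..<card W}"
      proof -
        have "W = D \<union> B" using DW by (auto simp: B_def)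
        then have "pre ` W = {..<card D} \<union> (+) (card D) ` pB ` B"
          using imD imB[of B] by (metis image_Un order_refl)
        also have "pB ` B = {..<card B}" using pB(1) by (simp add: bij_betw_def)
        also have "(+) (card D) ` {..<card B} = {card D..<card D + card B}"
          using image_add_atLeastLessThan[of "card D" 0 "card B"]
          by (simp add: lessThan_atLeast0 add.commute)
        finally show ?thesis using cW by auto
      qed
      then have bij: "bij_betw pre W {..<card W}"
        using psubset.hyps by (simp add: bij_betw_def eq_card_imp_inj_on)
      have "pre ` {v \<in> W. le w v} = {pre w ..< pre w + card {v \<in> W. le w v}}" if w: "w \<in> W" for w
      proof -
        consider "w = u" | "w \<in> A" | "w \<in> B" using w by (auto simp: A_def B_def D_def)
        then show ?thesis
        proof cases
          case 1
          have "pre w = 0" using 1 by (simp add: pre_def)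
          moreover have "{v \<in> W. le w v} = D" using 1 by (simp add: D_def)
          ultimately show ?thesis using imD by (simp add: lessThan_atLeast0)
        next
          case 2
          \<comment> \<open>Transitivity keeps the descendants of \<open>w\<close> below
            \<open>u\<close>, and antisymmetry keeps \<open>u\<close> itself out of them.\<close>
          have "{v \<in> W. le w v} = {v \<in> A. le w v}"
          proof -
            have w2: "w \<in> W" "w \<in> V" "u \<in> V" "le u w" "w \<noteq> u"
              using 2 u psubset.prems by (auto simp: A_def D_def)
            have "v \<in> A" if "v \<in> W" "le w v" for v
            proof -
              have "v \<in> V" using that psubset.prems by blast
              then have "le u v" "v \<noteq> u" using trans[of u w v] antisym[of u w] w2 that by auto
              then show ?thesis using that by (simp add: A_def D_def)
            qed
            then show ?thesis by (auto simp: A_def D_def)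
          qed
          moreover have "pre ` {v \<in> A. le w v} = Suc ` pA ` {v \<in> A. le w v}" by (rule imA) auto
          ultimately show ?thesis using pA(2)[OF 2] preA[OF 2] by simp
        next
          case 3
          \<comment> \<open>A common descendant of \<open>w\<close> and \<open>u\<close> would make
            the two comparable, but \<open>u\<close> is minimal and \<open>w\<close> is not below
            it.\<close>
          have "{v \<in> W. le w v} = {v \<in> B. le w v}"
          proof -
            have w2: "w \<in> W" "w \<in> V" "u \<in> V" "\<not> le u w"
              using 3 u psubset.prems by (auto simp: B_def D_def)
            have "v \<in> B" if "v \<in> W" "le w v" for v
            proof -
              have "v \<in> V" using that psubset.prems by blast
              then have "\<not> le u v"
                using chain[of u w v] umin[of w] w2 that refl[of u] by auto
              then show ?thesis using that by (simp add: B_def D_def)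
            qed
            then show ?thesis by (auto simp: B_def)
          qed
          moreover have "pre ` {v \<in> B. le w v} = (+) (card D) ` pB ` {v \<in> B. le w v}"
            by (rule imB) auto
          ultimately show ?thesis using pB(2)[OF 3] preB[OF 3] by (simp add: ac_simps)
        qed
      qed
      then show ?thesis using bij by blast
    qed (auto intro: exI[of _ id] simp: bij_betw_def)
  qed
  then show ?thesis by blast
qed

section \<open>Perfect hashing\<close>

text \<open>
  The hash functions are \<open>x \<mapsto> (a * x mod (M * L)) div L\<close> with a random multiplier \<open>a\<close>. On a collision,
  \<open>a\<close> times the difference of the keys is close to a multiple of \<open>M * L\<close>; counting such \<open>a\<close> requires
  no primality of the modulus.
\<close>

lemma card_small_multiples:
  fixes d L Q :: nat
  assumes "0 < d" "d \<le> L"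
  shows "card {a. a < Q \<and> a * d mod Q < L} \<le> 2 * L"
proof -
  let ?S = "{a. a < Q \<and> a * d mod Q < L}"
  let ?f = "\<lambda>a. (a * d div Q, (a * d mod Q) div d)"
  \<comment> \<open>Equal images put \<open>a * d\<close> and \<open>b * d\<close> into one window
    of length \<open>d\<close>, which forces \<open>a = b\<close>. There are at most
    \<open>d * ((L - 1) div d + 1)\<close> images, and this is at most \<open>2 * L\<close> because
    \<open>d \<le> L\<close>.\<close>
  have "inj_on ?f ?S"
  proof (rule inj_onI)
    fix a b assume "a \<in> ?S" "b \<in> ?S" and eq: "?f a = ?f b"
    define c where "c = a * d div Q"
    define q where "q = (a * d mod Q) div d"
    have 1: "a * d = Q * c + (d * q + a * d mod Q mod d)" "b * d = Q * c + (d * q + b * d mod Q mod d)"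
    proof -
      have c: "c = b * d div Q" "q = (b * d mod Q) div d" using eq by (simp_all add: c_def q_def)
      have "a * d = Q * c + a * d mod Q" "a * d mod Q = d * q + a * d mod Q mod d"
        unfolding c_def q_def by simp_all
      moreover have "b * d = Q * c + b * d mod Q" "b * d mod Q = d * q + b * d mod Q mod d"
        unfolding c by simp_all
      ultimately show "a * d = Q * c + (d * q + a * d mod Q mod d)"
        "b * d = Q * c + (d * q + b * d mod Q mod d)" by simp_all
    qed
    have "a * d < b * d + d" "b * d < a * d + d"
      using 1 mod_less_divisor[OF assms(1), of "a * d mod Q"] mod_less_divisor[OF assms(1), of "b * d mod Q"]
      by linarith+
    then have "a * d < (b + 1) * d" "b * d < (a + 1) * d" by (simp_all add: algebra_simps)
    then have "a < b + 1" "b < a + 1" using mult_less_cancel2 by blast+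
    then show "a = b" by simp
  qed
  moreover have "?f ` ?S \<subseteq> {..<d} \<times> {..(L - 1) div d}"
  proof
    fix p assume "p \<in> ?f ` ?S"
    then obtain a where a: "a < Q" "a * d mod Q < L" "p = ?f a" by auto
    have "a * d div Q < d" using a(1) assms(1)
      by (metis div_less_iff_less_mult gr_zeroI less_nat_zero_code mult.commute mult_less_mono1)
    moreover have "(a * d mod Q) div d \<le> (L - 1) div d" using a(2) by (intro div_le_mono) simp
    ultimately show "p \<in> {..<d} \<times> {..(L - 1) div d}" using a(3) by simp
  qed
  ultimately have "card ?S \<le> card ({..<d} \<times> {..(L - 1) div d})"
    by (intro card_inj_on_le[where f = ?f]) auto
  also have "\<dots> = d * ((L - 1) div d) + d" by (simp add: card_cartesian_product)
  also have "\<dots> \<le> (L - 1) + d" by simp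
  finally show ?thesis using assms by linarith
qed

text \<open>Reflecting \<open>a\<close> to \<open>Q - a\<close> negates the residue and reduces the
  claim to small residues. As \<open>a = 0\<close> has residue 0, it is not counted, and the
  reflected values stay below \<open>Q\<close>.\<close>

lemma card_large_multiples:
  fixes d L Q :: nat
  assumes "0 < d" "d \<le> L" "L \<le> Q"
  shows "card {a. a < Q \<and> Q - L < a * d mod Q} \<le> 2 * L"
proof -
  let ?S = "{a. a < Q \<and> Q - L < a * d mod Q}"
  have "inj_on (\<lambda>a. Q - a) ?S" by (rule inj_onI) auto
  moreover have "(\<lambda>a. Q - a) ` ?S \<subseteq> {a. a < Q \<and> a * d mod Q < L}"
  proof
    fix b assume "b \<in> (\<lambda>a. Q - a) ` ?S"
    then obtain a where a: "a < Q" "Q - L < a * d mod Q" "b = Q - a" by auto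
    then have "0 < a" by (cases a) auto
    have "(Q - a) * d mod Q = (Q - a * d mod Q) mod Q"
    proof -
      have "int ((Q - a) * d mod Q) = (int Q * int d - int a * int d) mod int Q"
        using a(1) by (simp add: zmod_int of_nat_diff left_diff_distrib)
      also have "\<dots> = (- (int a * int d)) mod int Q" by (metis mod_mult_self2 mult.commute uminus_add_conv_diff add.commute)
      also have "\<dots> = (int Q - int (a * d mod Q)) mod int Q"
        by (simp add: zmod_int mod_minus_eq mod_diff_right_eq)
      also have "\<dots> = int ((Q - a * d mod Q) mod Q)"
        using a(1) by (simp add: zmod_int of_nat_diff less_imp_le)
      finally show ?thesis by linarith
    qed
    also have "\<dots> < L"
    proof -
      have "a * d mod Q < Q" using a(1) by (intro mod_less_divisor) linarith
      then have "Q - a * d mod Q < L" using a(2) assms(3) by linarith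
      then show ?thesis using mod_less_eq_dividend[of "Q - a * d mod Q" Q] by linarith
    qed
    finally show "b \<in> {a. a < Q \<and> a * d mod Q < L}" using a \<open>0 < a\<close> by simp
  qed
  ultimately have "card ?S \<le> card {a. a < Q \<and> a * d mod Q < L}"
    by (intro card_inj_on_le[where f = "\<lambda>a. Q - a"]) auto
  then show ?thesis using card_small_multiples[OF assms(1,2), of Q] by linarith
qed

definition hash :: "nat \<Rightarrow> nat \<Rightarrow> nat \<Rightarrow> nat \<Rightarrow> nat" where
  "hash L M a x = (a * x mod (M * L)) div L"

lemma hash_less: "0 < L \<Longrightarrow> 0 < M \<Longrightarrow> hash L M a x < M"
  by (simp add: hash_def div_less_iff_less_mult)

text \<open>Both residues fall into the same block of length \<open>L\<close>. Of the
  \<open>M * L\<close> multipliers at most a fraction \<open>4 / M\<close> makes two given keys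
  collide.\<close>

lemma card_hash_collision:
  assumes "x < L" "y < L" "x \<noteq> y" "0 < M"
  shows "card {a. a < M * L \<and> hash L M a x = hash L M a y} \<le> 4 * L"
  using assms
proof (induction x y rule: linorder_wlog)
  case (sym x y)
  then show ?case by (simp add: eq_commute)
next
  case (le x y)
  define Q where "Q = M * L"
  define d where "d = y - x"
  have LQ: "L \<le> Q" "0 < L" "0 < Q" using le by (simp_all add: Q_def)
  have d: "0 < d" "d \<le> L" using le by (auto simp: d_def)
  have "a * d mod Q < L \<or> Q - L < a * d mod Q" if "hash L M a x = hash L M a y" for a
  proof -
    define u where "u = int (a * x mod Q)"
    define v where "v = int (a * y mod Q)"
    have "u div int L = v div int L"
      using that by (simp add: hash_def u_def v_def Q_def flip: zdiv_int)
    then have "\<bar>v - u\<bar> < int L"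
      using LQ(2) by (smt (verit) div_mult_mod_eq of_nat_0_less_iff pos_mod_bound pos_mod_sign)
    have m: "int (a * d mod Q) = (v - u) mod int Q"
      using le(1) by (simp add: u_def v_def d_def zmod_int of_nat_diff mod_diff_eq right_diff_distrib)
    show ?thesis
    proof (cases "0 \<le> v - u")
      case True
      then have "(v - u) mod int Q = v - u" using \<open>\<bar>v - u\<bar> < int L\<close> LQ by simp
      then show ?thesis using m \<open>\<bar>v - u\<bar> < int L\<close> by linarith
    next
      case False
      then have "(v - u + int Q) mod int Q = v - u + int Q"
        using \<open>\<bar>v - u\<bar> < int L\<close> LQ by (intro mod_pos_pos_trivial) auto
      then have "(v - u) mod int Q = v - u + int Q" by simp
      then show ?thesis using m \<open>\<bar>v - u\<bar> < int L\<close> LQ by linarith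
    qed
  qed
  then have "{a. a < Q \<and> hash L M a x = hash L M a y} \<subseteq>
      {a. a < Q \<and> a * d mod Q < L} \<union> {a. a < Q \<and> Q - L < a * d mod Q}" by blast
  then have "card {a. a < Q \<and> hash L M a x = hash L M a y} \<le>
      card ({a. a < Q \<and> a * d mod Q < L} \<union> {a. a < Q \<and> Q - L < a * d mod Q})"
    by (intro card_mono) auto
  also have "\<dots> \<le> card {a. a < Q \<and> a * d mod Q < L} + card {a. a < Q \<and> Q - L < a * d mod Q}"
    by (rule card_Un_le)
  also have "\<dots> \<le> 4 * L"
    using card_small_multiples[OF d, of Q] card_large_multiples[OF d LQ(1)] by linarith
  finally show ?case by (simp add: Q_def)
qed

definition collisions :: "nat \<Rightarrow> nat \<Rightarrow> nat \<Rightarrow> nat set \<Rightarrow> (nat \<times> nat) set" where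
  "collisions L M a S = {(x, y). x \<in> S \<and> y \<in> S \<and> x \<noteq> y \<and> hash L M a x = hash L M a y}"

lemma finite_collisions: "finite S \<Longrightarrow> finite (collisions L M a S)"
  by (rule finite_subset[of _ "S \<times> S"]) (auto simp: collisions_def)

lemma sum_collisions:
  assumes "finite S" "S \<subseteq> {..<L}" "0 < M"
  shows "(\<Sum>a<M * L. card (collisions L M a S)) \<le> card S * card S * (4 * L)"
proof -
  let ?P = "{(x, y). x \<in> S \<and> y \<in> S \<and> x \<noteq> y}"
  let ?c = "\<lambda>a p. hash L M a (fst p) = hash L M a (snd p)"
  have fP: "finite ?P" by (rule finite_subset[of _ "S \<times> S"]) (use assms in auto)
  have "card (collisions L M a S) = (\<Sum>p\<in>?P. of_bool (?c a p))" for a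
  proof -
    have "collisions L M a S = ?P \<inter> {p. ?c a p}" by (auto simp: collisions_def)
    then show ?thesis using fP by simp
  qed
  then have "(\<Sum>a<M * L. card (collisions L M a S)) = (\<Sum>p\<in>?P. \<Sum>a<M * L. of_bool (?c a p))"
    by (simp add: sum.swap[of _ ?P])
  also have "\<dots> = (\<Sum>p\<in>?P. card {a. a < M * L \<and> ?c a p})"
  proof (rule sum.cong[OF refl])
    fix p
    have "{..<M * L} \<inter> {a. ?c a p} = {a. a < M * L \<and> ?c a p}" by auto
    then show "(\<Sum>a<M * L. of_bool (?c a p)) = card {a. a < M * L \<and> ?c a p}" by simp
  qed
  also have "\<dots> \<le> (\<Sum>p\<in>?P. 4 * L)"
  proof (rule sum_mono)
    fix p assume "p \<in> ?P"
    then show "card {a. a < M * L \<and> ?c a p} \<le> 4 * L"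
      using card_hash_collision[of "fst p" L "snd p" M] assms(2,3) by (auto simp: subset_iff)
  qed
  also have "\<dots> = card ?P * (4 * L)" by simp
  also have "\<dots> \<le> card (S \<times> S) * (4 * L)"
    by (intro mult_le_mono1 card_mono) (use assms in auto)
  finally show ?thesis by (simp add: card_cartesian_product)
qed

text \<open>Averaging: if every multiplier had more than \<open>b\<close> collisions, the total of
  \<open>sum_collisions\<close> would be exceeded.\<close>

lemma ex_few_collisions:
  assumes "finite S" "S \<subseteq> {..<L}" "0 < M" "0 < L" "card S * card S * 4 < M * Suc b"
  obtains a where "a < M * L" "card (collisions L M a S) \<le> b"
proof -
  have "\<exists>a<M * L. card (collisions L M a S) \<le> b"
  proof (rule ccontr)
    assume "\<not> ?thesis"
    then have "(\<Sum>a<M * L. Suc b) \<le> (\<Sum>a<M * L. card (collisions L M a S))"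
      by (intro sum_mono) (auto simp: not_le Suc_le_eq)
    also have "\<dots> \<le> card S * card S * (4 * L)" by (rule sum_collisions[OF assms(1-3)])
    finally have "(M * Suc b) * L \<le> (card S * card S * 4) * L" by (simp add: algebra_simps)
    then have "M * Suc b \<le> card S * card S * 4" using assms(4) by simp
    then show False using assms(5) by linarith
  qed
  then show ?thesis using that by blast
qed

text \<open>At most \<open>4 * N\<close> ordered pairs collide at the first level; together with the
  diagonal pairs, the squares of the bucket sizes sum to at most \<open>5 * N\<close>. A bucket gets
  a collision-free table of four times its squared size plus one, which makes
  \<open>4 * 5 * N + N = 21 * N\<close> cells in total. The bound on \<open>M i\<close> later keeps
  multipliers and moduli within a word.\<close>

lemma perfect_hash:
  assumes "S \<subseteq> {..<L}" "card S \<le> N" "0 < N" "0 < L"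
  shows "\<exists>a0 a M off. a0 < N * L \<and>
    (\<forall>i<N. a i < M i * L \<and> 0 < M i \<and> M i \<le> 4 * N * N + 1 \<and> off i + M i \<le> 21 * N) \<and>
    inj_on (\<lambda>x. off (hash L N a0 x) + hash L (M (hash L N a0 x)) (a (hash L N a0 x)) x) S"
proof -
  have fS: "finite S" using assms(1) finite_subset by blast
  have "card S * card S * 4 < N * Suc (4 * N)"
  proof -
    have "card S * card S \<le> N * N" using assms(2) by (rule mult_le_mono) (rule assms(2))
    then show ?thesis using assms(3) by (simp add: algebra_simps)
  qed
  then obtain a0 where a0: "a0 < N * L" "card (collisions L N a0 S) \<le> 4 * N"
    using ex_few_collisions[OF fS assms(1,3,4)] by blast
  define bucket where "bucket i = {x \<in> S. hash L N a0 x = i}" for i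
  \<comment> \<open>The additional cell makes the averaging inequality strict and keeps the modulus
    of an empty bucket positive.\<close>
  define M where "M i = 4 * (card (bucket i) * card (bucket i)) + 1" for i
  define off where "off i = (\<Sum>j<i. M j)" for i
  have fB: "finite (bucket i)" for i using fS by (simp add: bucket_def)
  have BS: "bucket i \<subseteq> S" for i by (auto simp: bucket_def)
  have "\<exists>b. b < M i * L \<and> card (collisions L (M i) b (bucket i)) \<le> 0" for i
  proof -
    have "card (bucket i) * card (bucket i) * 4 < M i * Suc 0" by (simp add: M_def)
    moreover have "bucket i \<subseteq> {..<L}" "0 < M i" using BS[of i] assms(1) by (auto simp: M_def)
    ultimately obtain b where "b < M i * L" "card (collisions L (M i) b (bucket i)) \<le> 0"
      using ex_few_collisions[OF fB _ _ assms(4)] by metis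
    then show ?thesis by blast
  qed
  then obtain a where a: "\<And>i. a i < M i * L" "\<And>i. card (collisions L (M i) (a i) (bucket i)) \<le> 0"
    by metis
  have inj: "x = y" if "x \<in> bucket i" "y \<in> bucket i" "hash L (M i) (a i) x = hash L (M i) (a i) y" for i x y
  proof -
    have "collisions L (M i) (a i) (bucket i) = {}"
      using a(2)[of i] finite_collisions[OF fB] by simp
    then show ?thesis using that by (auto simp: collisions_def)
  qed
  have total: "(\<Sum>j<N. M j) \<le> 21 * N"
  proof -
    have "(\<Sum>j<N. card (bucket j) * card (bucket j)) = card (\<Union>j<N. bucket j \<times> bucket j)"
      by (subst card_UN_disjoint) (use fB in \<open>auto simp: bucket_def card_cartesian_product\<close>)
    also have "(\<Union>j<N. bucket j \<times> bucket j) \<subseteq> collisions L N a0 S \<union> (\<lambda>x. (x, x)) ` S"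
      by (auto simp: bucket_def collisions_def)
    then have "card (\<Union>j<N. bucket j \<times> bucket j) \<le> card (collisions L N a0 S \<union> (\<lambda>x. (x, x)) ` S)"
      by (intro card_mono) (use finite_collisions[OF fS] fS in auto)
    also have "\<dots> \<le> card (collisions L N a0 S) + card ((\<lambda>x. (x, x)) ` S)" by (rule card_Un_le)
    also have "\<dots> \<le> 4 * N + N"
      using a0(2) card_image_le[OF fS, of "\<lambda>x. (x, x)"] assms(2) by linarith
    finally have "(\<Sum>j<N. card (bucket j) * card (bucket j)) \<le> 5 * N" by simp
    moreover have "(\<Sum>j<N. M j) = 4 * (\<Sum>j<N. card (bucket j) * card (bucket j)) + N"
      unfolding M_def sum.distrib sum_distrib_left by simp
    ultimately show ?thesis by linarith
  qed
  have off_mono: "off i + M i \<le> off j" if "i < j" for i j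
    unfolding off_def using that
    by (metis Suc_leI finite_lessThan lessThan_subset_iff sum.lessThan_Suc sum_mono2 zero_le)
  have offN: "off i + M i \<le> 21 * N" if "i < N" for i
    using off_mono[OF that] total by (simp add: off_def)
  have M4: "M i \<le> 4 * N * N + 1" for i
  proof -
    have "card (bucket i) \<le> N" using card_mono[OF fS BS[of i]] assms(2) by linarith
    then have "card (bucket i) * card (bucket i) \<le> N * N" by (intro mult_le_mono)
    then show ?thesis by (simp add: M_def)
  qed
  have pos: "0 < M i" for i by (simp add: M_def)
  have "inj_on (\<lambda>x. off (hash L N a0 x) + hash L (M (hash L N a0 x)) (a (hash L N a0 x)) x) S"
  proof (rule inj_onI)
    fix x y assume xy: "x \<in> S" "y \<in> S"
      and eq: "off (hash L N a0 x) + hash L (M (hash L N a0 x)) (a (hash L N a0 x)) x =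
        off (hash L N a0 y) + hash L (M (hash L N a0 y)) (a (hash L N a0 y)) y"
    define i where "i = hash L N a0 x"
    define j where "j = hash L N a0 y"
    have "hash L (M i) (a i) x < M i" "hash L (M j) (a j) y < M j"
      using hash_less pos assms(4) by auto
    then have "i = j" using eq off_mono[of i j] off_mono[of j i]
      unfolding i_def[symmetric] j_def[symmetric] by (cases i j rule: linorder_cases) auto
    then show "x = y" using eq xy inj[of x i y] by (auto simp: bucket_def i_def j_def)
  qed
  then show ?thesis using a0(1) a(1) pos M4 offN by (intro exI[of _ a0] exI[of _ a] exI[of _ M] exI[of _ off]) auto
qed

section \<open>Maximum flows and edge-disjoint paths\<close>

lemma distinct_concat_nth:
  "distinct (concat ps) \<Longrightarrow> i < j \<Longrightarrow> j < length ps \<Longrightarrow> set (ps ! i) \<inter> set (ps ! j) = {}"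
proof (induction ps arbitrary: i j)
  case (Cons p ps)
  obtain j' where j: "j = Suc j'" using Cons.prems(2) by (cases j) auto
  show ?case
  proof (cases i)
    case 0
    have "ps ! j' \<in> set ps" using Cons.prems(3) j by simp
    then show ?thesis using Cons.prems(1) 0 j by auto
  next
    case (Suc i')
    then show ?thesis using Cons.IH[of i' j'] Cons.prems j by simp
  qed
qed auto

locale network =
  fixes V :: "'v set" and E :: "'e set" and ta he :: "'e \<Rightarrow> 'v" and s t :: 'v
  assumes finite_V: "finite V" and finite_E: "finite E"
    and ta_V: "e \<in> E \<Longrightarrow> ta e \<in> V" and he_V: "e \<in> E \<Longrightarrow> he e \<in> V"
    and s_V: "s \<in> V" and t_V: "t \<in> V" and s_neq_t: "s \<noteq> t"
begin

definition excess :: "'e set \<Rightarrow> 'v \<Rightarrow> int" where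
  "excess F v = (\<Sum>e\<in>F. of_bool (ta e = v) - of_bool (he e = v))"

definition is_flow :: "'e set \<Rightarrow> nat \<Rightarrow> bool" where
  "is_flow F k \<longleftrightarrow> F \<subseteq> E \<and> (\<forall>v. excess F v = int k * (of_bool (v = s) - of_bool (v = t)))"

definition rsrc :: "'e set \<Rightarrow> 'e \<Rightarrow> 'v" where "rsrc F e = (if e \<in> F then he e else ta e)"
definition rdst :: "'e set \<Rightarrow> 'e \<Rightarrow> 'v" where "rdst F e = (if e \<in> F then ta e else he e)"

definition cross :: "'v set \<Rightarrow> 'e set" where
  "cross A = {e \<in> E. ta e \<in> A \<and> he e \<notin> A}"

definition rcross :: "'e set \<Rightarrow> 'v set \<Rightarrow> 'e set" where
  "rcross F A = {e \<in> E. rsrc F e \<in> A \<and> rdst F e \<notin> A}"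

lemma excess_sum:
  assumes "finite F" "finite A"
  shows "(\<Sum>v\<in>A. excess F v) =
    int (card {e \<in> F. ta e \<in> A \<and> he e \<notin> A}) - int (card {e \<in> F. he e \<in> A \<and> ta e \<notin> A})"
proof -
  have "(\<Sum>v\<in>A. excess F v) = (\<Sum>e\<in>F. \<Sum>v\<in>A. of_bool (ta e = v) - of_bool (he e = v))"
    unfolding excess_def by (rule sum.swap)
  also have "\<dots> = (\<Sum>e\<in>F. of_bool (ta e \<in> A) - of_bool (he e \<in> A))"
    using assms(2) by (intro sum.cong refl) (auto simp: sum_subtractf of_bool_def)
  also have "\<dots> = (\<Sum>e\<in>F. of_bool (ta e \<in> A \<and> he e \<notin> A) - of_bool (he e \<in> A \<and> ta e \<notin> A))"
    by (intro sum.cong refl) auto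
  also have "\<dots> = int (card (F \<inter> {e. ta e \<in> A \<and> he e \<notin> A})) - int (card (F \<inter> {e. he e \<in> A \<and> ta e \<notin> A}))"
    using assms(1) by (simp add: sum_subtractf)
  finally show ?thesis by (simp add: Int_def conj_commute)
qed

lemma flow_cut:
  assumes "is_flow F k" "A \<subseteq> V" "s \<in> A" "t \<notin> A"
  shows "card (cross A) = k + card (rcross F A)"
proof -
  have fA: "finite A" using assms(2) finite_V finite_subset by blast
  have FE: "F \<subseteq> E" "finite F" using assms(1) finite_E finite_subset by (auto simp: is_flow_def)
  have "(\<Sum>v\<in>A. excess F v) = (\<Sum>v\<in>A. int k * of_bool (v = s))"
    using assms(1,4) by (intro sum.cong refl) (auto simp: is_flow_def)
  also have "\<dots> = int k" using fA assms(3) by (simp add: of_bool_def flip: sum_distrib_left)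
  finally have 1: "int (card {e \<in> F. ta e \<in> A \<and> he e \<notin> A}) - int (card {e \<in> F. he e \<in> A \<and> ta e \<notin> A}) = int k"
    using excess_sum[OF FE(2) fA] by simp
  have "cross A = {e \<in> F. ta e \<in> A \<and> he e \<notin> A} \<union> {e \<in> E - F. ta e \<in> A \<and> he e \<notin> A}"
    using FE(1) by (auto simp: cross_def)
  then have 2: "card (cross A) = card {e \<in> F. ta e \<in> A \<and> he e \<notin> A} + card {e \<in> E - F. ta e \<in> A \<and> he e \<notin> A}"
    using FE(2) finite_E by (simp add: card_Un_disjoint disjoint_iff)
  have "rcross F A = {e \<in> F. he e \<in> A \<and> ta e \<notin> A} \<union> {e \<in> E - F. ta e \<in> A \<and> he e \<notin> A}"
    using FE(1) by (auto simp: rcross_def rsrc_def rdst_def split: if_splits)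
  then have 3: "card (rcross F A) = card {e \<in> F. he e \<in> A \<and> ta e \<notin> A} + card {e \<in> E - F. ta e \<in> A \<and> he e \<notin> A}"
    using FE(2) finite_E by (simp add: card_Un_disjoint disjoint_iff)
  show ?thesis using 1 2 3 by linarith
qed

lemma excess_insert: "finite F \<Longrightarrow> e \<notin> F \<Longrightarrow>
    excess (insert e F) v = excess F v + of_bool (ta e = v) - of_bool (he e = v)"
  by (simp add: excess_def)

lemma excess_remove: "finite F \<Longrightarrow> e \<in> F \<Longrightarrow>
    excess (F - {e}) v = excess F v - of_bool (ta e = v) + of_bool (he e = v)"
  by (simp add: excess_def sum_diff1)

text \<open>Every arc of the walk toggles its edge. By \<open>reach_from_dst\<close> the rest of the
  walk can avoid the arc just used, so no edge is toggled twice. The set \<open>X\<close> collects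
  the used arcs, and \<open>F'\<close> agrees with \<open>F\<close> on it, so that each toggle
  changes the excess as intended.\<close>

lemma augment:
  fixes F :: "'e set"
  assumes "arc_relation.reach E (rsrc F) (rdst F) {} X u t" "F \<subseteq> E"
  shows "\<exists>F'\<subseteq>E. (\<forall>e\<in>X. e \<in> F' \<longleftrightarrow> e \<in> F) \<and>
    (\<forall>v. excess F' v = excess F v + of_bool (v = u) - of_bool (v = t))"
  using assms(1)
proof (induction "card (E - X)" arbitrary: X u rule: less_induct)
  case less
  interpret arc_relation E "rsrc F" "rdst F" "{}" .
  show ?case
  proof (cases "u = t")
    case True
    then show ?thesis using assms(2) by (intro exI[of _ F]) auto
  next
    case False
    obtain w where w: "(u, w) \<in> rel X" "reach X w t"
      using less.prems False unfolding reach_def by (metis converse_rtranclE)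
    then obtain e where e: "e \<in> E" "e \<notin> X" "u = rsrc F e" "w = rdst F e"
      by (auto simp: rel_def)
    have "reach (insert e X) w t" using reach_from_dst w(2) e(4) by blast
    moreover have "card (E - insert e X) < card (E - X)"
      using e(1,2) finite_E by (intro psubset_card_mono) auto
    ultimately obtain F' where F': "F' \<subseteq> E" "\<And>x. x \<in> insert e X \<Longrightarrow> x \<in> F' \<longleftrightarrow> x \<in> F"
      "\<And>v. excess F' v = excess F v + of_bool (v = w) - of_bool (v = t)"
      using less.hyps by metis
    have fF': "finite F'" using F'(1) finite_E finite_subset by blast
    show ?thesis
    proof (cases "e \<in> F")
      case True
      then have "excess (F' - {e}) v = excess F v + of_bool (v = u) - of_bool (v = t)" for v
        using F' e(3,4) by (subst excess_remove[OF fF']) (auto simp: rsrc_def rdst_def)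
      then show ?thesis using F' e(2) by (intro exI[of _ "F' - {e}"]) auto
    next
      case eF: False
      then have "excess (insert e F') v = excess F v + of_bool (v = u) - of_bool (v = t)" for v
        using F' e(3,4) by (subst excess_insert[OF fF']) (auto simp: rsrc_def rdst_def)
      then show ?thesis using F' e(1,2) by (intro exI[of _ "insert e F'"]) auto
    qed
  qed
qed

lemma flow_value_le: "is_flow F k \<Longrightarrow> k \<le> card E"
proof -
  assume "is_flow F k"
  then have "k \<le> card (cross {s})" using flow_cut[of F k "{s}"] s_V s_neq_t by simp
  also have "\<dots> \<le> card E" using finite_E by (intro card_mono) (auto simp: cross_def)
  finally show ?thesis .
qed

section \<open>Decomposition of flows into edge-disjoint simple paths\<close>

fun walk :: "'v \<Rightarrow> 'e list \<Rightarrow> 'v \<Rightarrow> bool" where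
  "walk u [] v \<longleftrightarrow> u = v"
| "walk u (e # p) v \<longleftrightarrow> ta e = u \<and> walk (he e) p v"

definition simple_path :: "'v \<Rightarrow> 'e list \<Rightarrow> 'v \<Rightarrow> bool" where
  "simple_path u p v \<longleftrightarrow> walk u p v \<and> distinct (u # map he p)"

lemma simple_path_suffix:
  "simple_path w p v \<Longrightarrow> u \<in> set (w # map he p) \<Longrightarrow> \<exists>q. set q \<subseteq> set p \<and> simple_path u q v"
proof (induction p arbitrary: w)
  case (Cons e p)
  show ?case
  proof (cases "u = w")
    case False
    have "simple_path (he e) p v" using Cons.prems(1) by (auto simp: simple_path_def)
    then obtain q where "set q \<subseteq> set p" "simple_path u q v"
      using Cons.IH[of "he e"] Cons.prems(2) False by auto
    then show ?thesis by auto
  qed (use Cons.prems in blast)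
qed (auto simp: simple_path_def)

lemma ex_simple_path:
  assumes "arc_relation.reach F ta he {} {} u v"
  shows "\<exists>p. set p \<subseteq> F \<and> simple_path u p v"
  using assms unfolding arc_relation.reach_def
proof (induction rule: converse_rtrancl_induct)
  case base
  then show ?case by (intro exI[of _ "[]"]) (simp add: simple_path_def)
next
  case (step u w)
  obtain e where e: "e \<in> F" "ta e = u" "he e = w"
    using step.hyps(1) by (auto simp: arc_relation.rel_def)
  obtain p where p: "set p \<subseteq> F" "simple_path w p v" using step.IH by blast
  show ?case
  proof (cases "u \<in> set (w # map he p)")
    case True
    then show ?thesis using simple_path_suffix[OF p(2)] p(1) by (meson subset_trans)
  next
    case False
    then show ?thesis using p e by (intro exI[of _ "e # p"]) (auto simp: simple_path_def)
  qed
qed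

lemma excess_walk:
  "walk u p v \<Longrightarrow> distinct p \<Longrightarrow> excess (set p) x = of_bool (x = u) - of_bool (x = v)"
proof (induction p arbitrary: u)
  case (Cons e p)
  then show ?case by (auto simp: excess_insert)
qed (simp add: excess_def)

lemma simple_path_distinct: "simple_path u p v \<Longrightarrow> distinct p"
  by (auto simp: simple_path_def distinct_map)

lemma excess_disjoint_union:
  "finite A \<Longrightarrow> finite B \<Longrightarrow> A \<inter> B = {} \<Longrightarrow> excess (A \<union> B) v = excess A v + excess B v"
  by (simp add: excess_def sum.union_disjoint)

text \<open>If the flow edges did not lead from \<open>s\<close> to \<open>t\<close>, the set they
  reach from \<open>s\<close> would have positive total excess but no leaving flow edge.\<close>

lemma flow_path:
  assumes "is_flow F (Suc k)"
  shows "\<exists>p. set p \<subseteq> F \<and> simple_path s p t \<and> is_flow (F - set p) k"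
proof -
  interpret arc_relation F ta he "{}" .
  have FE: "F \<subseteq> E" "finite F" using assms finite_E finite_subset by (auto simp: is_flow_def)
  have "reach {} s t"
  proof (rule ccontr)
    assume n: "\<not> reach {} s t"
    define A where "A = {v \<in> V. reach {} s v}"
    have e0: "{e \<in> F. ta e \<in> A \<and> he e \<notin> A} = {}"
      using reach_arc[of _ "{}"] reach_trans he_V FE(1) by (auto simp: A_def)
    moreover have "(\<Sum>v\<in>A. excess F v) = int (Suc k)"
    proof -
      have "(\<Sum>v\<in>A. excess F v) = (\<Sum>v\<in>A. int (Suc k) * of_bool (v = s))"
        using assms n by (intro sum.cong refl) (auto simp: is_flow_def A_def)
      then show ?thesis using s_V finite_V by (simp add: A_def of_bool_def flip: sum_distrib_left)
    qed
    moreover have "finite A" using finite_V by (simp add: A_def)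
    ultimately show False using excess_sum[OF FE(2), of A] unfolding e0 by simp
  qed
  then obtain p where p: "set p \<subseteq> F" "simple_path s p t" using ex_simple_path by blast
  have "excess (F - set p) v = int k * (of_bool (v = s) - of_bool (v = t))" for v
  proof -
    have "excess F v = excess (F - set p) v + excess (set p) v"
      using excess_disjoint_union[of "F - set p" "set p" v] FE(2) p(1) by (auto simp: Un_absorb2)
    moreover have "excess (set p) v = of_bool (v = s) - of_bool (v = t)"
      using excess_walk simple_path_distinct p(2) by (auto simp: simple_path_def)
    moreover have "excess F v = int (Suc k) * (of_bool (v = s) - of_bool (v = t))"
      using assms by (simp add: is_flow_def)
    ultimately show ?thesis by (simp add: distrib_right)
  qed
  then show ?thesis using p FE(1) by (intro exI[of _ p]) (auto simp: is_flow_def)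
qed

text \<open>The union of the paths replaces the given flow. Cycles are thereby dropped, and every
  remaining flow edge has a position on a simple path.\<close>

lemma flow_decomposition:
  "is_flow F k \<Longrightarrow> \<exists>ps. length ps = k \<and> distinct (concat ps) \<and> set (concat ps) \<subseteq> F \<and>
    (\<forall>p\<in>set ps. simple_path s p t) \<and> is_flow (set (concat ps)) k"
proof (induction k arbitrary: F)
  case 0
  then show ?case by (auto simp: is_flow_def excess_def)
next
  case (Suc k)
  obtain p where p: "set p \<subseteq> F" "simple_path s p t" "is_flow (F - set p) k"
    using flow_path[OF Suc.prems] by blast
  obtain ps where ps: "length ps = k" "distinct (concat ps)" "set (concat ps) \<subseteq> F - set p"
    "\<forall>p\<in>set ps. simple_path s p t" "is_flow (set (concat ps)) k"
    using Suc.IH[OF p(3)] by blast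
  have dj: "set p \<inter> set (concat ps) = {}" using ps(3) by blast
  have "excess (set p \<union> set (concat ps)) v = int (Suc k) * (of_bool (v = s) - of_bool (v = t))" for v
    using excess_disjoint_union[OF _ _ dj, of v] ps(5) excess_walk[of s p t v]
      simple_path_distinct[OF p(2)] p(2) by (simp add: is_flow_def simple_path_def algebra_simps)
  then have "is_flow (set (concat (p # ps))) (Suc k)"
    using p(1) ps(3) Suc.prems unfolding is_flow_def by auto
  then show ?case using p ps dj simple_path_distinct[OF p(2)] by (intro exI[of _ "p # ps"]) auto
qed

lemma walk_nth:
  assumes "walk u p v" "x < length p"
  shows "he (p ! x) = (if Suc x < length p then ta (p ! Suc x) else v)"
  using assms
proof (induction p arbitrary: u x)
  case (Cons e p)
  then show ?case by (cases x; cases p) auto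
qed auto

end

text \<open>
  Path \<open>i\<close> visits \<open>P i 0, \<dots>, P i (len i)\<close> along the edges \<open>pe i 0, \<dots>, pe i (len i - 1)\<close>.
\<close>

locale path_system = network V E ta he s t
  for V :: "'v set" and E :: "'e set" and ta he :: "'e \<Rightarrow> 'v" and s t :: 'v +
  fixes F :: "'e set" and lam :: nat and P :: "nat \<Rightarrow> nat \<Rightarrow> 'v" and pe :: "nat \<Rightarrow> nat \<Rightarrow> 'e"
    and len :: "nat \<Rightarrow> nat"
  assumes F_E: "F \<subseteq> E"
    and pe_F: "i < lam \<Longrightarrow> x < len i \<Longrightarrow> pe i x \<in> F"
    and ta_pe: "i < lam \<Longrightarrow> x < len i \<Longrightarrow> ta (pe i x) = P i x"
    and he_pe: "i < lam \<Longrightarrow> x < len i \<Longrightarrow> he (pe i x) = P i (Suc x)"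
    and P_V: "i < lam \<Longrightarrow> x \<le> len i \<Longrightarrow> P i x \<in> V"
    and F_pe: "e \<in> F \<Longrightarrow> \<exists>i<lam. \<exists>x<len i. e = pe i x"
    and pe_inj: "i < lam \<Longrightarrow> i' < lam \<Longrightarrow> x < len i \<Longrightarrow> x' < len i' \<Longrightarrow> pe i x = pe i' x' \<Longrightarrow>
      i = i' \<and> x = x'"
    and len_less: "i < lam \<Longrightarrow> len i < card V"
    and no_augment: "\<not> arc_relation.reach E (rsrc F) (rdst F) {} {} s t"

lemma (in network) ex_path_system:
  "\<exists>F lam P pe len. path_system V E ta he s t F lam P pe len \<and> is_flow F lam"
proof -
  have "\<exists>F. is_flow F 0" by (rule exI[of _ "{}"]) (simp add: is_flow_def excess_def)
  then have "\<exists>k. (\<exists>F. is_flow F k) \<and> (\<forall>k'. (\<exists>F. is_flow F k') \<longrightarrow> k' \<le> k)"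
    using Nat.ex_has_greatest_nat[of "\<lambda>k. \<exists>F. is_flow F k" 0 "card E"] flow_value_le by blast
  then obtain k F0 where k: "is_flow F0 k" "\<And>k' F. is_flow F k' \<Longrightarrow> k' \<le> k" by blast
  obtain ps where ps: "length ps = k" "distinct (concat ps)" "\<forall>p\<in>set ps. simple_path s p t"
    "is_flow (set (concat ps)) k" using flow_decomposition[OF k(1)] by blast
  define F where "F = set (concat ps)"
  have flow: "is_flow F k" using ps(4) by (simp add: F_def)
  have FE: "F \<subseteq> E" using flow by (simp add: is_flow_def)
  define P where "P i x = (if x < length (ps ! i) then ta (ps ! i ! x) else t)" for i x
  have sp: "simple_path s (ps ! i) t" if "i < k" for i using ps(1,3) that by auto
  have peF: "ps ! i ! x \<in> F" if "i < k" "x < length (ps ! i)" for i x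
    unfolding F_def set_concat using that ps(1) by (metis UN_I nth_mem)
  have dist: "i = i' \<and> x = x'" if "i < k" "i' < k" "x < length (ps ! i)" "x' < length (ps ! i')"
    "ps ! i ! x = ps ! i' ! x'" for i i' x x'
  proof -
    have "i = i'"
    proof (rule ccontr)
      assume "i \<noteq> i'"
      then have "set (ps ! i) \<inter> set (ps ! i') = {}"
        using distinct_concat_nth[OF ps(2), of i i'] distinct_concat_nth[OF ps(2), of i' i] ps(1) that(1,2)
        by (cases i i' rule: linorder_cases) auto
      then show False using that by (metis disjoint_iff nth_mem)
    qed
    then show ?thesis using simple_path_distinct[OF sp[OF that(1)]] that by (simp add: nth_eq_iff_index_eq)
  qed
  have naug: "\<not> arc_relation.reach E (rsrc F) (rdst F) {} {} s t"
  proof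
    assume a: "arc_relation.reach E (rsrc F) (rdst F) {} {} s t"
    obtain F' where F': "F' \<subseteq> E"
      "\<forall>v. excess F' v = excess F v + of_bool (v = s) - of_bool (v = t)"
      using augment[OF a FE] by auto
    have "excess F' v = int (Suc k) * (of_bool (v = s) - of_bool (v = t))" for v
    proof -
      have "excess F v = int k * (of_bool (v = s) - of_bool (v = t))" using flow by (simp add: is_flow_def)
      then show ?thesis using F'(2) by (simp add: distrib_right)
    qed
    then have "is_flow F' (Suc k)" using F'(1) by (simp add: is_flow_def)
    then show False using k(2)[of F' "Suc k"] by simp
  qed
  have he_p: "he (ps ! i ! x) = P i (Suc x)" if "i < k" "x < length (ps ! i)" for i x
    using walk_nth[of s "ps ! i" t x] sp[OF that(1)] that by (auto simp: simple_path_def P_def)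
  have len_p: "length (ps ! i) < card V" if "i < k" for i
  proof -
    have "set (s # map he (ps ! i)) \<subseteq> V"
    proof -
      have "e \<in> E" if "e \<in> set (ps ! i)" for e
        using peF[OF \<open>i < k\<close>] FE that by (auto simp: in_set_conv_nth)
      then show ?thesis using s_V he_V by auto
    qed
    then have "card (set (s # map he (ps ! i))) \<le> card V" by (rule card_mono[OF finite_V])
    moreover have "card (set (s # map he (ps ! i))) = length (s # map he (ps ! i))"
      using sp[OF that] by (intro distinct_card) (simp add: simple_path_def)
    ultimately show ?thesis by simp
  qed
  have ex_p: "\<exists>i<k. \<exists>x<length (ps ! i). e = ps ! i ! x" if "e \<in> F" for e
  proof -
    obtain p where "p \<in> set ps" "e \<in> set p" using \<open>e \<in> F\<close> by (auto simp: F_def)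
    then obtain i x where "i < length ps" "p = ps ! i" "x < length p" "e = p ! x"
      by (metis in_set_conv_nth)
    then show ?thesis using ps(1) by blast
  qed
  have P_p: "P i x \<in> V" if "i < k" "x \<le> length (ps ! i)" for i x
    using peF[OF that(1), of x] FE t_V ta_V by (auto simp: P_def)
  have ta_p: "ta (ps ! i ! x) = P i x" if "i < k" "x < length (ps ! i)" for i x
    using that by (simp add: P_def)
  have "path_system V E ta he s t F k P (\<lambda>i x. ps ! i ! x) (\<lambda>i. length (ps ! i))"
    by (intro path_system.intro path_system_axioms.intro network_axioms)
      (fact FE peF ta_p he_p P_p ex_p dist len_p naug)+
  then show ?thesis using flow by blast
qed

section \<open>Cuts with one residual arc\<close>

text \<open>
  The unbreakable pairs from \<open>t\<close> and into \<open>s\<close> force every proper nonempty set that is closed under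
  reachability to separate \<open>s\<close> from \<open>t\<close>.
\<close>

locale residual = path_system V E ta he s t F lam P pe len +
  rooted_arc_relation E "network.rsrc ta he F" "network.rdst ta he F" "{t} \<times> V \<union> V \<times> {s}" r
  for V :: "'v set" and E :: "'e set" and ta he :: "'e \<Rightarrow> 'v" and s t :: 'v
    and F lam P pe len r
begin

abbreviation src :: "'e \<Rightarrow> 'v" where "src \<equiv> rsrc F"
abbreviation dst :: "'e \<Rightarrow> 'v" where "dst \<equiv> rdst F"

lemma src_V: "e \<in> E \<Longrightarrow> src e \<in> V" and dst_V: "e \<in> E \<Longrightarrow> dst e \<in> V"
  by (auto simp: rsrc_def rdst_def ta_V he_V)

lemma reach_V: "reach X u v \<Longrightarrow> u \<in> V \<Longrightarrow> v \<in> V"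
  by (erule reach_closed) (auto simp: dst_V s_V)

lemma reach_s: "u \<in> V \<Longrightarrow> reach X u s" and reach_t: "u \<in> V \<Longrightarrow> reach X t u"
  by (auto intro: reach_Q)

lemma dom_V: "dom z \<subseteq> V"
proof
  fix v assume "v \<in> dom z"
  then show "v \<in> V" using reach_V[OF dom_through(3)] dst_V dom_through(1) by blast
qed

lemma finite_dom: "finite (dom z)"
  using dom_V finite_V finite_subset by blast

text \<open>The first condition sets aside the edges on minimum cuts. The second restricts to cuts
  with the root on the source side: the root cannot reach the excluded vertex \<open>he e\<close>
  without \<open>z\<close>.\<close>

definition seps :: "'e \<Rightarrow> 'e set" where
  "seps e = {z. reach {} (ta e) (he e) \<and> he e \<in> dom z \<and> \<not> reach {z} (ta e) (he e)}"

lemma seps_E: "seps e \<subseteq> E"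
  by (auto simp: seps_def dest: dom_through(1))

text \<open>The reversed arc of a flow edge closes a cycle with the walk from \<open>ta e\<close> to
  \<open>he e\<close>. An edge outside the flow is itself the separator, and both ends of a bridge
  lie in the component that it dominates.\<close>

lemma seps_conn:
  assumes "e \<in> E" "z \<in> seps e"
  shows "conn (ta e) (he e)"
proof -
  have z: "reach {} (ta e) (he e)" "he e \<in> dom z" "\<not> reach {z} (ta e) (he e)"
    using assms(2) by (auto simp: seps_def)
  show ?thesis
  proof (cases "e \<in> F")
    case True
    then have "reach {} (he e) (ta e)" using reach_arc[OF assms(1), of "{}"] by (simp add: rsrc_def rdst_def)
    then show ?thesis using z by (simp add: conn_def)
  next
    case False
    then have "z = e" using reach_arc[OF assms(1), of "{z}"] z(3) by (auto simp: rsrc_def rdst_def)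
    then show ?thesis using dom_through(4)[OF z(2)] False conn_sym by (simp add: rsrc_def)
  qed
qed

lemma seps_nonflow: "e \<in> E \<Longrightarrow> e \<notin> F \<Longrightarrow> seps e \<subseteq> {e}"
  using reach_arc[of e] by (force simp: seps_def rsrc_def rdst_def)

text \<open>A walk from \<open>ta e\<close> to \<open>he e\<close> without \<open>z'\<close> must
  use \<open>z\<close>, and its part after \<open>z\<close> puts \<open>dst z\<close> into
  \<open>dom z'\<close>. Then the two sets coincide, and so do the arcs.\<close>

lemma seps_deeper:
  assumes "z \<in> seps e" "he e \<in> dom z'" "dom z' \<subseteq> dom z"
  shows "z' \<in> seps e"
proof (rule ccontr)
  assume n: "z' \<notin> seps e"
  have z: "reach {} (ta e) (he e)" "he e \<in> dom z" "\<not> reach {z} (ta e) (he e)"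
    using assms(1) by (auto simp: seps_def)
  have 1: "reach {z'} (ta e) (he e)" using n z assms(2) by (auto simp: seps_def)
  then have ne: "z \<noteq> z'" using z(3) by auto
  have 2: "\<not> reach {z, z'} (ta e) (he e)" using z(3) reach_mono[of "{z, z'}" _ _ "{z}"] by blast
  have "reach {z, z'} (dst z) (he e)" by (rule reach_through(3)[OF 1 2])
  then have 3: "reach {z'} (dst z) (he e)" by (rule reach_mono) auto
  have c: "conn (he e) (dst z)" using dom_through(5)[OF z(2)] .
  have "dst z \<in> dom z'" using dom_backward[OF 3 assms(2) conn_sym[OF c]] .
  then have "dom z = dom z'" using dom_subset assms(3) by blast
  then show False using dom_inj[OF z(2)] ne by blast
qed

text \<open>The sets of all separators contain \<open>he e\<close>, hence form a chain.\<close>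

lemma ex_top_sep:
  assumes "seps e \<noteq> {}"
  shows "\<exists>z\<in>seps e. \<forall>z'\<in>seps e. dom z' \<subseteq> dom z"
proof -
  have fin: "finite ((\<lambda>z. card (dom z)) ` seps e)" using seps_E finite_E finite_subset by blast
  then have "Max ((\<lambda>z. card (dom z)) ` seps e) \<in> (\<lambda>z. card (dom z)) ` seps e"
    using assms by (intro Max_in) auto
  then obtain z where z: "z \<in> seps e" "card (dom z) = Max ((\<lambda>z. card (dom z)) ` seps e)" by auto
  have "dom z' \<subseteq> dom z" if z': "z' \<in> seps e" for z'
  proof -
    have "card (dom z') \<le> card (dom z)" using z(2) fin z' by simp
    moreover have "dom z \<subseteq> dom z' \<or> dom z' \<subseteq> dom z"
      using dom_nested[of "he e"] z(1) z' by (auto simp: seps_def)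
    ultimately show ?thesis using card_seteq[OF finite_dom] by blast
  qed
  then show ?thesis using z(1) by blast
qed

definition top_sep :: "'e \<Rightarrow> 'e option" where
  "top_sep e = (if seps e = {} then None
     else Some (SOME z. z \<in> seps e \<and> (\<forall>z'\<in>seps e. dom z' \<subseteq> dom z)))"

lemma top_sepD:
  assumes "top_sep e = Some g"
  shows "g \<in> seps e" "\<And>z. z \<in> seps e \<Longrightarrow> dom z \<subseteq> dom g"
proof -
  have "g = (SOME z. z \<in> seps e \<and> (\<forall>z'\<in>seps e. dom z' \<subseteq> dom z))" "seps e \<noteq> {}"
    using assms by (auto simp: top_sep_def split: if_splits)
  then have "g \<in> seps e \<and> (\<forall>z'\<in>seps e. dom z' \<subseteq> dom g)"
    using someI_ex[of "\<lambda>z. z \<in> seps e \<and> (\<forall>z'\<in>seps e. dom z' \<subseteq> dom z)"] ex_top_sep[of e] by blast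
  then show "g \<in> seps e" "\<And>z. z \<in> seps e \<Longrightarrow> dom z \<subseteq> dom g" by auto
qed

lemma top_sep_exists: "z \<in> seps e \<Longrightarrow> \<exists>g. top_sep e = Some g \<and> dom z \<subseteq> dom g"
proof -
  assume z: "z \<in> seps e"
  then have "top_sep e \<noteq> None" by (auto simp: top_sep_def)
  then obtain g where g: "top_sep e = Some g" by blast
  then show ?thesis using top_sepD(2)[OF g z] by blast
qed

lemma top_sep_nonflow: "e \<in> E \<Longrightarrow> e \<notin> F \<Longrightarrow> top_sep e = Some g \<Longrightarrow> g = e"
  using seps_nonflow top_sepD(1) by blast

text \<open>
  The relation between two edges that is equivalent to their lying on a common cut with one
  residual arc whose source side contains the root of their component.
\<close>

definition paired :: "'e \<Rightarrow> 'e \<Rightarrow> bool" where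
  "paired e1 e2 \<longleftrightarrow> (\<exists>g1 g2. top_sep e1 = Some g1 \<and> top_sep e2 = Some g2 \<and>
     he e2 \<in> dom g1 \<and> he e1 \<in> dom g2 \<and>
     \<not> reach {g1} (ta e1) (he e2) \<and> \<not> reach {g2} (ta e2) (he e1))"

definition pair_sep :: "'e \<Rightarrow> 'e \<Rightarrow> 'e" where
  "pair_sep e1 e2 = (let g1 = the (top_sep e1); g2 = the (top_sep e2)
     in if dom g1 \<subseteq> dom g2 then g1 else g2)"

text \<open>Outside \<open>dom z\<close> the cut uses full reachability, for which the tables of
  minimum cuts can be consulted. It still has no leaving arc except \<open>z\<close>, because within
  the component only \<open>z\<close> enters \<open>dom z\<close>.\<close>

definition pair_cut :: "'e \<Rightarrow> 'v \<Rightarrow> 'v \<Rightarrow> 'v set" where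
  "pair_cut z a c = {v \<in> V. if v \<in> dom z then reach {z} a v \<or> reach {z} c v
     else reach {} a v \<or> reach {} c v}"

text \<open>A walk that stays in the inner set does not meet the outer arc. Contraposed, a test at
  the outermost separator of \<open>e2\<close> also settles the test at a deeper one.\<close>

lemma sep_reach_deeper:
  assumes "e2 \<in> E" "top_sep e2 = Some g2" "dom g1 \<subseteq> dom g2" "he e1 \<in> dom g1" "he e2 \<in> dom g1"
    "reach {g1} (ta e2) (he e1)"
  shows "reach {g2} (ta e2) (he e1)"
proof -
  have "conn (ta e2) (he e2)" using seps_conn top_sepD(1) assms(1,2) by blast
  then have "conn (ta e2) (he e1)" using dom_conn[OF assms(5,4)] conn_trans by blast
  then show ?thesis using reach_inside'[OF assms(6,4) _ assms(3)] by blast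
qed

text \<open>The inner one of the two outermost separators serves both edges by
  \<open>seps_deeper\<close>. The last equation lets a query obtain \<open>dom z\<close> as an
  intersection of two intervals.\<close>

lemma pair_sep:
  assumes "e1 \<in> E" "e2 \<in> E" "paired e1 e2"
  defines "z \<equiv> pair_sep e1 e2"
  shows "z \<in> seps e1" "z \<in> seps e2" "\<not> reach {z} (ta e1) (he e2)" "\<not> reach {z} (ta e2) (he e1)"
    "dom z = dom (the (top_sep e1)) \<inter> dom (the (top_sep e2))"
proof -
  obtain g1 g2 where g: "top_sep e1 = Some g1" "top_sep e2 = Some g2" "he e2 \<in> dom g1" "he e1 \<in> dom g2"
    "\<not> reach {g1} (ta e1) (he e2)" "\<not> reach {g2} (ta e2) (he e1)"
    using assms(3) by (auto simp: paired_def)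
  have s: "g1 \<in> seps e1" "g2 \<in> seps e2" using top_sepD(1) g by auto
  then have h: "he e1 \<in> dom g1" "he e2 \<in> dom g2" by (auto simp: seps_def)
  have z: "z = (if dom g1 \<subseteq> dom g2 then g1 else g2)" by (simp add: z_def pair_sep_def g)
  have nest: "dom g1 \<subseteq> dom g2 \<or> dom g2 \<subseteq> dom g1" using dom_nested[OF h(1) g(4)] .
  show "dom z = dom (the (top_sep e1)) \<inter> dom (the (top_sep e2))"
    using nest by (auto simp: z g)
  have "z \<in> seps e1 \<and> z \<in> seps e2 \<and> \<not> reach {z} (ta e1) (he e2) \<and> \<not> reach {z} (ta e2) (he e1)"
  proof (cases "dom g1 \<subseteq> dom g2")
    case True
    then show ?thesis
      using z s g(5,6) seps_deeper[OF s(2) g(3) True] sep_reach_deeper[OF assms(2) g(2) True h(1) g(3)] by auto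
  next
    case False
    then have "dom g2 \<subseteq> dom g1" using nest by blast
    then show ?thesis
      using z s g(5,6) False seps_deeper[OF s(1) g(4)] sep_reach_deeper[OF assms(1) g(1) _ h(2) g(4)] by auto
  qed
  then show "z \<in> seps e1" "z \<in> seps e2" "\<not> reach {z} (ta e1) (he e2)" "\<not> reach {z} (ta e2) (he e1)"
    by auto
qed

lemma pair_cut_correct:
  assumes "e1 \<in> E" "e2 \<in> E" "paired e1 e2"
  defines "z \<equiv> pair_sep e1 e2"
  defines "A \<equiv> pair_cut z (ta e1) (ta e2)"
  shows "A \<subseteq> V" "s \<in> A" "t \<notin> A" "rcross F A \<subseteq> {z}" "e1 \<in> cross A" "e2 \<in> cross A"
proof -
  note p = pair_sep[OF assms(1-3), folded z_def]
  have h: "he e1 \<in> dom z" "he e2 \<in> dom z" "\<not> reach {z} (ta e1) (he e1)" "\<not> reach {z} (ta e2) (he e2)"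
    using p(1,2) by (auto simp: seps_def)
  have hV: "ta e1 \<in> V" "ta e2 \<in> V" "he e1 \<in> V" "he e2 \<in> V" using ta_V he_V assms(1,2) by auto
  have c1: "conn (ta e1) (he e1)" "conn (ta e2) (he e2)" using seps_conn assms(1,2) p(1,2) by auto
  have c2: "conn (ta e1) (ta e2)"
    using c1 dom_conn[OF h(1,2)] conn_sym conn_trans by blast
  have A: "v \<in> A \<longleftrightarrow> v \<in> V \<and> (if v \<in> dom z then reach {z} (ta e1) v \<or> reach {z} (ta e2) v
      else reach {} (ta e1) v)" for v
    unfolding A_def pair_cut_def using c2 by (auto simp: conn_def intro: reach_trans)
  show "A \<subseteq> V" using A by blast
  have reach_A: "reach {} (ta e1) v" if "v \<in> A" for v
    using that A[of v] c2 by (auto simp: conn_def split: if_splits dest: reach_empty intro: reach_trans)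
  \<comment> \<open>A walk without \<open>z\<close> that ends in \<open>dom z\<close> has its start
    there too, so it never passes from the region of full reachability to the restricted
    one.\<close>
  have closed: "w \<in> A" if u: "u \<in> A" and uw: "reach {z} u w" "w \<in> V" for u w
  proof (cases "w \<in> dom z")
    case False
    have "reach {} (ta e1) w" using reach_trans[OF reach_A[OF u] reach_empty[OF uw(1)]] .
    then show ?thesis using A False uw(2) by simp
  next
    case True
    have "conn (ta e1) w" using c1(1) dom_conn[OF h(1) True] conn_trans by blast
    then have "conn u w" using conn_between[OF _ reach_A[OF u] uw(1)] by blast
    then have "u \<in> dom z" using dom_backward[OF uw(1) True] by blast
    then have "reach {z} (ta e1) u \<or> reach {z} (ta e2) u" using u A by simp
    then show ?thesis using A True uw reach_trans by meson
  qed
  have tA: "ta e1 \<in> A" "ta e2 \<in> A" using A hV c2 by (auto simp: conn_def)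
  show "s \<in> A" using closed[OF tA(1)] reach_s hV s_V by blast
  have hA: "he e1 \<notin> A" "he e2 \<notin> A" using A h p(3,4) by auto
  show "t \<notin> A" using closed[of t "he e1"] reach_t hV hA by blast
  show "rcross F A \<subseteq> {z}"
  proof
    fix e assume e: "e \<in> rcross F A"
    then have "e \<in> E" "src e \<in> A" "dst e \<notin> A" by (auto simp: rcross_def)
    then show "e \<in> {z}" using closed[of "src e" "dst e"] reach_arc[of e "{z}"] dst_V by blast
  qed
  show "e1 \<in> cross A" "e2 \<in> cross A" using tA hA assms(1,2) by (auto simp: cross_def)
qed

lemma cut_reach:
  assumes "A \<subseteq> V" "s \<in> A" "t \<notin> A" "rcross F A \<subseteq> X" "reach X u v" "u \<in> A"
  shows "v \<in> A"
  using assms(5,6) by (rule reach_closed) (use assms(1-4) in \<open>auto simp: rcross_def\<close>)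

text \<open>A crossing flow edge closes a cycle with its reversed arc. A crossing edge outside the
  flow is itself a leaving residual arc and hence equals \<open>z\<close>; the last assumption
  provides the connection in that case.\<close>

lemma cross_conn:
  assumes "A \<subseteq> V" "s \<in> A" "t \<notin> A" "rcross F A \<subseteq> {z}" "e \<in> cross A" "reach {} (ta e) (he e)"
    and "e \<in> F \<or> conn (src z) (dst z)"
  shows "conn (ta e) (he e)" "conn (he e) (dst z)" "\<not> reach {z} (ta e) (he e)"
proof -
  have e: "e \<in> E" "ta e \<in> A" "he e \<notin> A" using assms(5) by (auto simp: cross_def)
  show n: "\<not> reach {z} (ta e) (he e)" using cut_reach[OF assms(1-4)] e by blast
  note t = reach_through[OF assms(6) n]
  show c: "conn (ta e) (he e)"
  proof (cases "e \<in> F")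
    case True
    then have "reach {} (he e) (ta e)" using reach_arc[OF e(1), of "{}"] by (simp add: rsrc_def rdst_def)
    then show ?thesis using assms(6) by (simp add: conn_def)
  next
    case False
    then have "e \<in> rcross F A" using e by (auto simp: rcross_def rsrc_def rdst_def)
    then have "e = z" using assms(4) by blast
    then show ?thesis using False assms(7) by (simp add: rsrc_def rdst_def)
  qed
  have "reach {} (ta e) (dst z)"
    using reach_trans[OF reach_empty[OF t(2)] reach_arc[OF t(1)]] by simp
  then show "conn (he e) (dst z)"
    using conn_between[OF c _ t(3)] conn_sym by blast
qed

text \<open>At most one of two distinct crossing edges can be \<open>z\<close>, so the other carries
  flow. Its ends are connected by a cycle that must pass through \<open>z\<close>.\<close>

lemma cross_pair_conn:
  assumes "A \<subseteq> V" "s \<in> A" "t \<notin> A" "rcross F A \<subseteq> {z}" "e1 \<in> cross A" "e2 \<in> cross A" "e1 \<noteq> e2"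
    "reach {} (ta e1) (he e1)" "reach {} (ta e2) (he e2)"
  shows "conn (src z) (dst z)"
proof -
  have "e \<notin> F \<Longrightarrow> e \<in> cross A \<Longrightarrow> e = z" for e
    using assms(4) by (auto simp: cross_def rcross_def rsrc_def rdst_def)
  then obtain e where e: "e \<in> F" "e \<in> cross A" "reach {} (ta e) (he e)" using assms(5-9) by metis
  note c = cross_conn[OF assms(1-4) e(2,3) disjI1[OF e(1)]]
  note t = reach_through[OF e(3) c(3)]
  have "conn (ta e) (he e)" using c(1) .
  moreover have "reach {} (src z) (he e)"
    using reach_trans[OF reach_arc[OF t(1)] reach_empty[OF t(3)]] by simp
  ultimately have "conn (src z) (he e)" using conn_between[OF _ t(2)] by blast
  then show ?thesis using c(2) conn_trans by blast
qed

text \<open>Since the root lies in \<open>A\<close> and the heads do not, \<open>z\<close> separates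
  both edges. A walk from \<open>ta e\<close> to \<open>he e'\<close> without the outermost
  separator \<open>g\<close> would have to leave \<open>A\<close> through \<open>z\<close>; from
  \<open>dst z\<close> it could go on to \<open>he e\<close> inside \<open>dom z\<close>, although
  \<open>g\<close> separates the ends of \<open>e\<close>.\<close>

lemma paired_complete:
  assumes "A \<subseteq> V" "s \<in> A" "t \<notin> A" "rcross F A \<subseteq> {z}" "e1 \<in> cross A" "e2 \<in> cross A" "e1 \<noteq> e2"
    "reach {} (ta e1) (he e1)" "reach {} (ta e2) (he e2)" "r (dst z) \<in> A"
  shows "paired e1 e2"
proof -
  have cz: "conn (src z) (dst z)" by (rule cross_pair_conn[OF assms(1-9)])
  have *: "\<exists>g. top_sep e = Some g \<and> he e \<in> dom z \<and> dom z \<subseteq> dom g"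
    if e: "e \<in> cross A" "reach {} (ta e) (he e)" for e
  proof -
    note c = cross_conn[OF assms(1-4) e disjI2[OF cz]]
    have "he e \<notin> A" using e(1) by (simp add: cross_def)
    then have "\<not> reach {z} (r (he e)) (he e)"
      using cut_reach[OF assms(1-4)] assms(10) root_eq[OF c(2)] by auto
    then have "z \<in> seps e" "he e \<in> dom z" using e(2) c(3) by (auto simp: seps_def dom_def)
    then show ?thesis using top_sep_exists by blast
  qed
  have **: "\<not> reach {g} (ta e) (he e')" if e: "e \<in> cross A" "reach {} (ta e) (he e)" "e' \<in> cross A"
    and g: "top_sep e = Some g" "dom z \<subseteq> dom g" "he e \<in> dom z" "he e' \<in> dom z" for e e' g
  proof
    assume 1: "reach {g} (ta e) (he e')"
    have "ta e \<in> A" "he e' \<notin> A" using e by (auto simp: cross_def)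
    then have "\<not> reach {z} (ta e) (he e')" using cut_reach[OF assms(1-4)] by blast
    then have 2: "\<not> reach {z, g} (ta e) (he e')" using reach_mono[of "{z, g}" _ _ "{z}"] by blast
    note t = reach_through[OF 1 2]
    show False
    proof (cases "z = g")
      case True
      then show ?thesis using 1 \<open>\<not> reach {z} (ta e) (he e')\<close> by simp
    next
      case False
      have "reach {g} (ta e) (src z)" using t(2) by (rule reach_mono) auto
      moreover have "reach {g} (src z) (dst z)" using reach_arc[OF t(1)] False by simp
      moreover have "reach {g} (dst z) (he e)"
        by (rule reach_inside'[OF dom_through(3)[OF g(3)] g(3) conn_sym[OF dom_through(5)[OF g(3)]] g(2)])
      ultimately have "reach {g} (ta e) (he e)" using reach_trans by blast
      then show False using top_sepD(1)[OF g(1)] by (simp add: seps_def)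
    qed
  qed
  obtain g1 where g1: "top_sep e1 = Some g1" "he e1 \<in> dom z" "dom z \<subseteq> dom g1" using *[of e1] assms by blast
  obtain g2 where g2: "top_sep e2 = Some g2" "he e2 \<in> dom z" "dom z \<subseteq> dom g2" using *[of e2] assms by blast
  show ?thesis unfolding paired_def
    using g1 g2 **[of e1 e2 g1] **[of e2 e1 g2] assms(5,6,8,9) by blast
qed

end

section \<open>Compact reachability tables\<close>

context residual
begin

text \<open>The ancestor relation of the dominator forest: a bridge is represented by its head, and
  all other vertices are leaves.\<close>

definition anc :: "'v \<Rightarrow> 'v \<Rightarrow> bool" where
  "anc u v \<longleftrightarrow> u = v \<or> (\<exists>z. dst z = u \<and> v \<in> dom z)"

definition pre :: "'v \<Rightarrow> nat" where
  "pre = (SOME f. bij_betw f V {..<card V} \<and>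
    (\<forall>u\<in>V. f ` {v \<in> V. anc u v} = {f u ..< f u + card {v \<in> V. anc u v}}))"

lemma pre_props: "bij_betw pre V {..<card V}"
  "\<And>u. u \<in> V \<Longrightarrow> pre ` {v \<in> V. anc u v} = {pre u ..< pre u + card {v \<in> V. anc u v}}"
proof -
  have tr: "anc u w" if "anc u v" "anc v w" for u v w
    using that dom_subset unfolding anc_def by blast
  have as: "u = v" if uv: "anc u v" "anc v u" for u v
  proof (rule ccontr)
    assume "u \<noteq> v"
    then obtain z z' where z: "dst z = u" "v \<in> dom z" "dst z' = v" "u \<in> dom z'"
      using uv by (auto simp: anc_def)
    then have "dom z = dom z'" using dom_subset[of z z'] dom_subset[of z' z] by blast
    then show False using dom_inj[of v z z'] z \<open>u \<noteq> v\<close> by auto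
  qed
  have ch: "anc u u' \<or> anc u' u" if "anc u v" "anc u' v" for u u' v
    using that dom_laminar[of v] unfolding anc_def by metis
  have "\<exists>f. bij_betw f V {..<card V} \<and>
    (\<forall>u\<in>V. f ` {v \<in> V. anc u v} = {f u ..< f u + card {v \<in> V. anc u v}})"
  proof (rule forest_preorder_numbering[OF finite_V])
    show "anc u u" for u by (simp add: anc_def)
    show "u = v" if "anc u v" "anc v u" for u v by (rule as[OF that])
    show "anc u w" if "anc u v" "anc v w" for u v w by (rule tr[OF that])
    show "anc u u' \<or> anc u' u" if "anc u v" "anc u' v" for u u' v by (rule ch[OF that])
  qed
  then have "bij_betw pre V {..<card V} \<and>
    (\<forall>u\<in>V. pre ` {v \<in> V. anc u v} = {pre u ..< pre u + card {v \<in> V. anc u v}})"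
    unfolding pre_def by (rule someI_ex)
  then show "bij_betw pre V {..<card V}"
    "\<And>u. u \<in> V \<Longrightarrow> pre ` {v \<in> V. anc u v} = {pre u ..< pre u + card {v \<in> V. anc u v}}" by auto
qed

lemma pre_less: "v \<in> V \<Longrightarrow> pre v < card V"
  using pre_props(1) by (auto simp: bij_betw_def)

lemma pre_inj: "u \<in> V \<Longrightarrow> v \<in> V \<Longrightarrow> pre u = pre v \<longleftrightarrow> u = v"
  using pre_props(1) by (auto simp: bij_betw_def inj_on_def)

definition lo :: "'e \<Rightarrow> nat" where "lo z = pre (dst z)"
definition hi :: "'e \<Rightarrow> nat" where "hi z = pre (dst z) + card (dom z)"

text \<open>The descendants of \<open>dst z\<close> form exactly \<open>dom z\<close>, because by
  \<open>dom_same_dst\<close> no other bridge ends there.\<close>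

lemma pre_dom:
  assumes "dom z \<noteq> {}"
  shows "pre ` dom z = {lo z ..< hi z}"
proof -
  obtain u where u: "u \<in> dom z" using assms by blast
  have d: "dst z \<in> dom z" by (rule dst_in_dom[OF u])
  have "{v \<in> V. anc (dst z) v} = dom z"
  proof (intro equalityI subsetI)
    fix v assume "v \<in> {v \<in> V. anc (dst z) v}"
    then consider "v = dst z" | z' where "dst z' = dst z" "v \<in> dom z'" by (auto simp: anc_def)
    then show "v \<in> dom z" using d dom_same_dst[OF u] by (cases; metis)
  qed (use dom_V in \<open>auto simp: anc_def\<close>)
  then show ?thesis using pre_props(2)[of "dst z"] d dom_V by (auto simp: lo_def hi_def)
qed

lemma in_dom_iff:
  assumes "dom z \<noteq> {}" "v \<in> V"
  shows "v \<in> dom z \<longleftrightarrow> lo z \<le> pre v \<and> pre v < hi z"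
proof -
  have "v \<in> dom z \<longleftrightarrow> pre v \<in> pre ` dom z"
    using pre_inj dom_V assms(2) by blast
  then show ?thesis using pre_dom[OF assms(1)] by simp
qed

lemma hi_le: "dom z \<noteq> {} \<Longrightarrow> hi z \<le> card V"
proof -
  assume a: "dom z \<noteq> {}"
  then have "0 < card (dom z)" using finite_dom card_gt_0_iff by blast
  then have "hi z - 1 \<in> pre ` dom z" using pre_dom[OF a] by (auto simp: lo_def hi_def)
  then obtain v where "v \<in> V" "hi z - 1 = pre v" using dom_V by blast
  then show ?thesis using pre_less[of v] by linarith
qed

text \<open>The head of a bridge does not count as inside its own set. The level of
  \<open>dst z\<close> is thus the next larger bridge set, and passing from a vertex to the head of
  its level climbs strictly.\<close>

definition inner :: "'v \<Rightarrow> 'e \<Rightarrow> bool" where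
  "inner v z \<longleftrightarrow> v \<in> dom z \<and> v \<noteq> dst z \<and> (\<forall>z'. v \<in> dom z' \<and> v \<noteq> dst z' \<longrightarrow> dom z \<subseteq> dom z')"

definition lvl :: "'v \<Rightarrow> 'e option" where
  "lvl v = (if \<exists>z. inner v z then Some (SOME z. inner v z) else None)"

lemma lvl_inner: "lvl v = Some y \<Longrightarrow> inner v y"
  unfolding lvl_def by (auto split: if_splits intro: someI)

lemma lvl_exists:
  assumes "v \<in> dom z" "v \<noteq> dst z"
  shows "\<exists>y. lvl v = Some y"
proof -
  let ?S = "{z. v \<in> dom z \<and> v \<noteq> dst z}"
  have "?S \<noteq> {}" "?S \<subseteq> E" using assms dom_through(1) by auto
  then obtain y where y: "y \<in> ?S" "\<And>z'. z' \<in> ?S \<Longrightarrow> card (dom y) \<le> card (dom z')"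
    using ex_has_least_nat[of "\<lambda>z. z \<in> ?S" _ "\<lambda>z. card (dom z)"] by blast
  have "dom y \<subseteq> dom z'" if z': "z' \<in> ?S" for z'
  proof -
    have "dom y \<subseteq> dom z' \<or> dom z' \<subseteq> dom y" using dom_nested y(1) z' by blast
    then show ?thesis using y(2)[OF z'] card_seteq[OF finite_dom, of "dom z'" y] by blast
  qed
  then have "inner v y" using y(1) unfolding inner_def by blast
  then show ?thesis by (auto simp: lvl_def)
qed

text \<open>
  Reachability from \<open>ta e\<close> inside \<open>dom z\<close>, for any \<open>z\<close> separating the ends of \<open>e\<close>, is determined by
  reachability inside the smallest bridge set around the target, which does not depend on \<open>z\<close>.
\<close>

lemma head_unreached:
  assumes "z \<in> seps e"
  shows "\<not> reach {z} (ta e) (dst z)"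
  using assms dom_through(3)[of "he e" z] reach_trans by (auto simp: seps_def)

lemma reach_level:
  assumes "e \<in> E" "z \<in> seps e" "v \<in> dom z" "lvl v = Some y" "v \<noteq> dst z"
  shows "dom y \<subseteq> dom z" "dst y \<in> dom z"
    "reach {z} (ta e) v \<longleftrightarrow> (if ta e \<in> dom y then reach {y} (ta e) v else reach {z} (ta e) (dst y))"
proof -
  have y: "v \<in> dom y" "v \<noteq> dst y" using lvl_inner[OF assms(4)] by (auto simp: inner_def)
  show sub: "dom y \<subseteq> dom z" using lvl_inner[OF assms(4)] assms(3,5) by (auto simp: inner_def)
  show dy: "dst y \<in> dom z" using dst_in_dom[OF y(1)] sub by blast
  have z: "he e \<in> dom z" "\<not> reach {z} (ta e) (he e)" using assms(2) by (auto simp: seps_def)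
  have ce: "conn (ta e) (he e)" by (rule seps_conn[OF assms(1,2)])
  have cv: "conn (ta e) v" using ce dom_conn[OF z(1) assms(3)] conn_trans by blast
  \<comment> \<open>From \<open>dst y\<close> the walk would continue inside \<open>dom y\<close> to
    \<open>he e\<close>, which \<open>z\<close> separates from \<open>ta e\<close>.\<close>
  have no_head: "\<not> reach {z} (ta e) (dst y)" if "he e \<in> dom y"
  proof
    assume "reach {z} (ta e) (dst y)"
    moreover have "reach {z} (dst y) (he e)"
      by (rule reach_inside'[OF dom_through(3)[OF that] that conn_sym[OF dom_through(5)[OF that]] sub])
    ultimately show False using z(2) reach_trans by blast
  qed
  show "reach {z} (ta e) v \<longleftrightarrow> (if ta e \<in> dom y then reach {y} (ta e) v else reach {z} (ta e) (dst y))"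
  proof (cases "ta e \<in> dom y")
    case True
    \<comment> \<open>If \<open>y\<close> were unavoidable, \<open>dst y\<close> would be reached
      and \<open>he e\<close> would lie outside \<open>dom y\<close>. Then \<open>e\<close> carries
      flow, and its reversed arc enters \<open>dom y\<close> from outside, so it is \<open>y\<close>
      itself. Hence \<open>dst y = ta e\<close>, and the part of the walk after \<open>y\<close>
      already starts at \<open>ta e\<close>.\<close>
    have "reach {y} (ta e) v" if 1: "reach {z} (ta e) v"
    proof (rule ccontr)
      assume n: "\<not> reach {y} (ta e) v"
      then have yz: "y \<noteq> z" using 1 by auto
      have "\<not> reach {y, z} (ta e) v" using n reach_mono[of "{y, z}" _ _ "{y}"] by blast
      note t = reach_through[OF 1 this]
      have 2: "reach {z} (ta e) (dst y)"
      proof -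
        have "reach {z} (ta e) (src y)" using t(2) by (rule reach_mono) auto
        moreover have "reach {z} (src y) (dst y)" using reach_arc[OF t(1)] yz by simp
        ultimately show ?thesis by (rule reach_trans)
      qed
      then have hb: "he e \<notin> dom y" using no_head by blast
      have eF: "e \<in> F"
      proof (rule ccontr)
        assume "e \<notin> F"
        then have "z = e" "src e = ta e" using seps_nonflow[OF assms(1)] assms(2) by (auto simp: rsrc_def)
        then show False using True sub src_notin_dom[of e] by auto
      qed
      have "e = y"
      proof (rule ccontr)
        assume "e \<noteq> y"
        then have "reach {y} (he e) (ta e)"
          using reach_arc[OF assms(1), of "{y}"] eF by (simp add: rsrc_def rdst_def)
        then show False using dom_backward True conn_sym[OF ce] hb by blast
      qed
      then have "dst y = ta e" using eF by (simp add: rdst_def)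
      moreover have "reach {y} (dst y) v" using t(3) by (rule reach_mono) auto
      ultimately show False using n by simp
    qed
    moreover have "reach {z} (ta e) v" if "reach {y} (ta e) v"
      by (rule reach_inside'[OF that y(1) cv sub])
    ultimately show ?thesis using True by auto
  next
    case False
    \<comment> \<open>Only \<open>y\<close> enters \<open>dom y\<close>, so the walk passes through
      \<open>dst y\<close>.\<close>
    have "reach {z} (ta e) (dst y)" if 1: "reach {z} (ta e) v"
    proof -
      have n: "\<not> reach {y} (ta e) v" using dom_backward[OF _ y(1) cv] False by blast
      then have yz: "y \<noteq> z" using 1 by auto
      have "\<not> reach {y, z} (ta e) v" using n reach_mono[of "{y, z}" _ _ "{y}"] by blast
      note t = reach_through[OF 1 this]
      have "reach {z} (ta e) (src y)" using t(2) by (rule reach_mono) auto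
      moreover have "reach {z} (src y) (dst y)" using reach_arc[OF t(1)] yz by simp
      ultimately show ?thesis by (rule reach_trans)
    qed
    moreover have "reach {z} (ta e) v" if "reach {z} (ta e) (dst y)"
      using that reach_inside'[OF dom_through(3)[OF y(1)] y(1) conn_sym[OF dom_through(5)[OF y(1)]] sub]
      by (rule reach_trans)
    ultimately show ?thesis using False by auto
  qed
qed

section \<open>Thresholds along the flow paths\<close>

definition pos :: "'e \<Rightarrow> nat \<times> nat" where
  "pos e = (SOME p. fst p < lam \<and> snd p < len (fst p) \<and> e = pe (fst p) (snd p))"

definition pidx :: "'e \<Rightarrow> nat" where "pidx e = fst (pos e)"
definition ppos :: "'e \<Rightarrow> nat" where "ppos e = snd (pos e)"

lemma pos_props:
  assumes "e \<in> F"
  shows "pidx e < lam" "ppos e < len (pidx e)" "pe (pidx e) (ppos e) = e"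
    "P (pidx e) (ppos e) = ta e" "P (pidx e) (Suc (ppos e)) = he e"
proof -
  have "\<exists>p. fst p < lam \<and> snd p < len (fst p) \<and> e = pe (fst p) (snd p)"
    using F_pe[OF assms] by auto
  then have "pidx e < lam \<and> ppos e < len (pidx e) \<and> e = pe (pidx e) (ppos e)"
    unfolding pidx_def ppos_def pos_def by (rule someI_ex)
  then show "pidx e < lam" "ppos e < len (pidx e)" "pe (pidx e) (ppos e) = e"
    "P (pidx e) (ppos e) = ta e" "P (pidx e) (Suc (ppos e)) = he e"
    using ta_pe[of "pidx e" "ppos e"] he_pe[of "pidx e" "ppos e"] by auto
qed

lemma pos_pe: "i < lam \<Longrightarrow> x < len i \<Longrightarrow> pidx (pe i x) = i \<and> ppos (pe i x) = x"
  using pos_props[OF pe_F] pe_inj by blast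

text \<open>
  Walking a flow path backwards is possible in the residual graph without \<open>z\<close>, unless \<open>z\<close> breaks
  that path; the part of the path behind the break is then moved to an extra column \<open>lam\<close>.
\<close>

definition col :: "'e option \<Rightarrow> nat \<Rightarrow> nat \<Rightarrow> nat" where
  "col zo i x = (case zo of None \<Rightarrow> i
     | Some z \<Rightarrow> if z \<in> F \<and> i = pidx z \<and> ppos z < x then lam else i)"

lemma path_reach:
  assumes "i < lam" "x \<le> len i" "x' \<le> x" "\<And>y. x' \<le> y \<Longrightarrow> y < x \<Longrightarrow> pe i y \<notin> X"
  shows "reach X (P i x) (P i x')"
  using assms
proof (induction "x - x'" arbitrary: x)
  case (Suc d)
  then obtain y where y: "x = Suc y" "x' \<le> y" "y < len i" by (cases x) auto
  have "pe i y \<in> F" using pe_F y Suc.prems by auto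
  then have "reach X (P i x) (P i y)"
    using reach_arc[of "pe i y" X] Suc.prems y ta_pe[of i y] he_pe[of i y] F_E
    by (auto simp: rsrc_def rdst_def)
  moreover have "reach X (P i y) (P i x')" using Suc.hyps(1)[of y] Suc.hyps(2) Suc.prems y by auto
  ultimately show ?case by (rule reach_trans)
qed auto

lemma col_reach:
  assumes "i < lam" "i' < lam" "x \<le> len i" "x' \<le> x" "col zo i x = col zo i' x'"
  shows "i = i' \<and> reach (set_option zo) (P i x) (P i' x')"
proof -
  have "i = i'" using assms(1,2,5) by (auto simp: col_def split: option.splits if_splits)
  moreover have "reach (set_option zo) (P i x) (P i x')"
  proof (rule path_reach[OF assms(1,3,4)])
    fix y assume y: "x' \<le> y" "y < x"
    then have "pidx (pe i y) = i" "ppos (pe i y) = y" "pe i y \<in> F"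
      using pos_pe[of i y] pe_F[of i y] assms(1,3) by auto
    then show "pe i y \<notin> set_option zo"
      using y assms(1,5) \<open>i = i'\<close> by (auto simp: col_def split: option.splits)
  qed
  ultimately show ?thesis by simp
qed

text \<open>Since paths are walked backwards, the positions of one column that reach
  \<open>v\<close> are upward closed, and a threshold describes them. The default
  \<open>card V\<close> exceeds every position.\<close>

definition minreach :: "'e option \<Rightarrow> 'v \<Rightarrow> nat \<Rightarrow> nat" where
  "minreach zo v c =
    (let S = {x. \<exists>i<lam. x \<le> len i \<and> col zo i x = c \<and> reach (set_option zo) (P i x) v}
     in if S = {} then card V else Min S)"

text \<open>Dually, the positions reached from \<open>v\<close> are downward closed. The successor
  separates position 0 from the empty set and makes the test a strict inequality.\<close>

definition maxreach :: "'e \<Rightarrow> 'v \<Rightarrow> nat \<Rightarrow> nat" where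
  "maxreach z v c =
    (let S = {x. \<exists>i<lam. x \<le> len i \<and> col (Some z) i x = c \<and> reach {z} v (P i x)}
     in if S = {} then 0 else Suc (Max S))"

lemma finite_positions: "finite {x. \<exists>i<lam. x \<le> len i \<and> R i x}"
proof (rule finite_subset)
  show "{x. \<exists>i<lam. x \<le> len i \<and> R i x} \<subseteq> {..card V}"
  proof
    fix x assume "x \<in> {x. \<exists>i<lam. x \<le> len i \<and> R i x}"
    then obtain i where "i < lam" "x \<le> len i" by blast
    then show "x \<in> {..card V}" using len_less[of i] by simp
  qed
qed simp

lemma minreach_iff:
  assumes "i < lam" "x \<le> len i"
  shows "minreach zo v (col zo i x) \<le> x \<longleftrightarrow> reach (set_option zo) (P i x) v"
proof -
  define S where "S = {x'. \<exists>i'<lam. x' \<le> len i' \<and> col zo i' x' = col zo i x \<and> reach (set_option zo) (P i' x') v}"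
  have fin: "finite S" unfolding S_def by (rule finite_positions)
  have m: "minreach zo v (col zo i x) = (if S = {} then card V else Min S)"
    by (simp only: minreach_def S_def Let_def)
  show ?thesis
  proof
    assume 1: "minreach zo v (col zo i x) \<le> x"
    have "x < card V" using assms len_less by fastforce
    then have "S \<noteq> {}" "Min S \<le> x" using 1 m by (auto split: if_splits)
    then have "Min S \<in> S" using fin by simp
    then obtain i' where i': "i' < lam" "Min S \<le> len i'" "col zo i' (Min S) = col zo i x"
      "reach (set_option zo) (P i' (Min S)) v" by (auto simp: S_def)
    then show "reach (set_option zo) (P i x) v"
      using reach_trans[OF _ i'(4)] col_reach[OF assms(1) i'(1) assms(2) \<open>Min S \<le> x\<close> i'(3)[symmetric]]
      by blast
  next
    assume "reach (set_option zo) (P i x) v"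
    then have "x \<in> S" using assms by (auto simp: S_def)
    then show "minreach zo v (col zo i x) \<le> x" using m fin by auto
  qed
qed

lemma minreach_le: "minreach zo v c \<le> card V"
proof -
  define S where "S = {x. \<exists>i<lam. x \<le> len i \<and> col zo i x = c \<and> reach (set_option zo) (P i x) v}"
  have "finite S" unfolding S_def by (rule finite_positions)
  then have "S \<noteq> {} \<Longrightarrow> Min S \<in> S" by simp
  then have "S \<noteq> {} \<Longrightarrow> Min S \<le> card V" using len_less by (fastforce simp: S_def)
  moreover have "minreach zo v c = (if S = {} then card V else Min S)"
    by (simp only: minreach_def S_def Let_def)
  ultimately show ?thesis by simp
qed

lemma maxreach_iff:
  assumes "i < lam" "x \<le> len i"
  shows "x < maxreach z v (col (Some z) i x) \<longleftrightarrow> reach {z} v (P i x)"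
proof -
  define S where "S = {x'. \<exists>i'<lam. x' \<le> len i' \<and> col (Some z) i' x' = col (Some z) i x \<and> reach {z} v (P i' x')}"
  have fin: "finite S" unfolding S_def by (rule finite_positions)
  have m: "maxreach z v (col (Some z) i x) = (if S = {} then 0 else Suc (Max S))"
    by (simp only: maxreach_def S_def Let_def)
  show ?thesis
  proof
    assume 1: "x < maxreach z v (col (Some z) i x)"
    then have "S \<noteq> {}" "x \<le> Max S" using m by (auto split: if_splits)
    then have "Max S \<in> S" using fin by simp
    then obtain i' where i': "i' < lam" "Max S \<le> len i'" "col (Some z) i' (Max S) = col (Some z) i x"
      "reach {z} v (P i' (Max S))" by (auto simp: S_def)
    have "reach {z} (P i' (Max S)) (P i x)"
      using col_reach[OF i'(1) assms(1) i'(2) \<open>x \<le> Max S\<close> i'(3)] by force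
    then show "reach {z} v (P i x)" using reach_trans[OF i'(4)] by blast
  next
    assume "reach {z} v (P i x)"
    then have "x \<in> S" using assms by (auto simp: S_def)
    then show "x < maxreach z v (col (Some z) i x)" using m fin by (auto simp: less_Suc_eq_le)
  qed
qed

lemma maxreach_le: "maxreach z v c \<le> card V"
proof -
  define S where "S = {x. \<exists>i<lam. x \<le> len i \<and> col (Some z) i x = c \<and> reach {z} v (P i x)}"
  have "finite S" unfolding S_def by (rule finite_positions)
  then have "S \<noteq> {} \<Longrightarrow> Max S \<in> S" by simp
  then have "S \<noteq> {} \<Longrightarrow> Max S < card V" using len_less by (fastforce simp: S_def)
  moreover have "maxreach z v c = (if S = {} then 0 else Suc (Max S))"
    by (simp only: maxreach_def S_def Let_def)
  ultimately show ?thesis by (auto simp: Suc_le_eq)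
qed

lemma maxreach_out: "lam < c \<Longrightarrow> maxreach z v c = 0"
  by (auto simp: maxreach_def col_def split: if_splits)

text \<open>
  Edges with the same tail share a row of the table of \<open>maxreach\<close>, except for those that are
  themselves bridges; of these there is only one per tail.
\<close>

definition row :: "'e \<Rightarrow> nat" where
  "row e = (case top_sep e of None \<Rightarrow> 2 * card V
     | Some g \<Rightarrow> if e \<in> F \<and> ta e \<in> dom g then (if dom e = {} then pre (ta e) else card V + pre (ta e))
       else 2 * card V)"

text \<open>If the arcs differ, \<open>g'\<close> does not separate the ends of \<open>e\<close>, so
  \<open>ta e\<close> reaches \<open>dst g\<close> without \<open>g'\<close>. Then
  \<open>he e'\<close> cannot lie in \<open>dom g\<close>. But the reversed arc of \<open>e'\<close>
  is not \<open>g\<close> and leads from \<open>he e'\<close> into \<open>dom g\<close>, which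
  contradicts \<open>dom_backward\<close>.\<close>

lemma same_top_sep:
  assumes "e \<in> F" "e' \<in> F" "ta e = ta e'" "top_sep e = Some g" "top_sep e' = Some g'"
    "ta e \<in> dom g" "ta e' \<in> dom g'" "dom e = {}" "dom e' = {}" "dom g \<subseteq> dom g'"
  shows "g = g'"
proof (rule ccontr)
  assume ne: "g \<noteq> g'"
  have E: "e \<in> E" "e' \<in> E" using assms(1,2) F_E by auto
  have g: "g \<in> seps e" "g' \<in> seps e'" using top_sepD(1) assms(4,5) by auto
  then have h: "reach {} (ta e) (he e)" "he e \<in> dom g" "\<not> reach {g} (ta e) (he e)"
    "he e' \<in> dom g'" "\<not> reach {g'} (ta e') (he e')" by (auto simp: seps_def)
  have "g' \<notin> seps e"
  proof
    assume "g' \<in> seps e"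
    then have "dom g' = dom g" using top_sepD(2)[OF assms(4)] assms(10) by blast
    then show False using dom_inj[OF h(4)] ne by blast
  qed
  then have 1: "reach {g'} (ta e) (he e)" using h assms(10) by (auto simp: seps_def)
  have "\<not> reach {g, g'} (ta e) (he e)" using h(3) reach_mono[of "{g, g'}" _ _ "{g}"] by blast
  note t = reach_through[OF 1 this]
  have 2: "reach {g'} (ta e') (dst g)"
  proof -
    have "reach {g'} (ta e') (src g)" unfolding assms(3)[symmetric] using t(2) by (rule reach_mono) auto
    moreover have "reach {g'} (src g) (dst g)" using reach_arc[OF t(1)] ne by simp
    ultimately show ?thesis by (rule reach_trans)
  qed
  have hb: "he e' \<notin> dom g"
  proof
    assume b: "he e' \<in> dom g"
    have "reach {g'} (dst g) (he e')"
      by (rule reach_inside'[OF dom_through(3)[OF b] b conn_sym[OF dom_through(5)[OF b]] assms(10)])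
    then show False using 2 h(5) reach_trans by blast
  qed
  have "e' \<noteq> g" using h(2) assms(9) by auto
  then have "reach {g} (he e') (ta e')"
    using reach_arc[OF E(2), of "{g}"] assms(2) by (simp add: rsrc_def rdst_def)
  moreover have "conn (he e') (ta e')" using seps_conn[OF E(2) g(2)] conn_sym by blast
  ultimately show False using dom_backward hb assms(3,6) by auto
qed

lemma row_lessD:
  assumes "row e < 2 * card V"
  shows "\<exists>g. top_sep e = Some g \<and> e \<in> F \<and> ta e \<in> dom g \<and>
    row e = (if dom e = {} then pre (ta e) else card V + pre (ta e))"
  using assms by (auto simp: row_def split: option.splits if_splits)

text \<open>The two blocks of rows keep bridges and other edges apart. The residual arc of a flow
  edge ends at its tail, so among bridges the tail determines the edge.\<close>

lemma row_inj:
  assumes "row e = row e'" "row e < 2 * card V"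
  shows "ta e = ta e' \<and> top_sep e = top_sep e'"
proof -
  obtain g where g: "top_sep e = Some g" "e \<in> F" "ta e \<in> dom g"
    "row e = (if dom e = {} then pre (ta e) else card V + pre (ta e))" using row_lessD assms(2) by blast
  obtain g' where g': "top_sep e' = Some g'" "e' \<in> F" "ta e' \<in> dom g'"
    "row e' = (if dom e' = {} then pre (ta e') else card V + pre (ta e'))" using row_lessD assms by metis
  have V: "ta e \<in> V" "ta e' \<in> V" using g g' dom_V by auto
  have "(dom e = {} \<longleftrightarrow> dom e' = {}) \<and> ta e = ta e'"
    using assms(1) g(4) g'(4) pre_less[OF V(1)] pre_less[OF V(2)] pre_inj[OF V] by (auto split: if_splits)
  then have d: "dom e = {} \<longleftrightarrow> dom e' = {}" and ta: "ta e = ta e'" by auto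
  have "g = g'"
  proof (cases "dom e = {}")
    case True
    have "dom g \<subseteq> dom g' \<or> dom g' \<subseteq> dom g" using dom_nested g(3) g'(3) ta by metis
    then show ?thesis
      using same_top_sep[OF g(2) g'(2) ta g(1) g'(1)] same_top_sep[OF g'(2) g(2) ta[symmetric] g'(1) g(1)]
        g(3) g'(3) True d by metis
  next
    case False
    then have "e = e'" using d ta dom_same_dst[of _ e _ e'] g(2) g'(2) by (auto simp: rdst_def)
    then show ?thesis using g(1) g'(1) by simp
  qed
  then show ?thesis using ta g g' by simp
qed

text \<open>By \<open>row_inj\<close> any representative of a row gives the same entries. Rows
  without an edge, and the last row, are zero.\<close>

definition mm_tab :: "nat \<Rightarrow> nat \<Rightarrow> nat" where
  "mm_tab \<rho> c = (if \<rho> < 2 * card V \<and> (\<exists>e. row e = \<rho>)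
     then let e = SOME e. row e = \<rho> in maxreach (the (top_sep e)) (ta e) c else 0)"

lemma mm_tab_row:
  assumes "row e < 2 * card V"
  shows "mm_tab (row e) c = maxreach (the (top_sep e)) (ta e) c"
proof -
  have "row (SOME e'. row e' = row e) = row e" by (rule someI) simp
  then have "ta (SOME e'. row e' = row e) = ta e \<and> top_sep (SOME e'. row e' = row e) = top_sep e"
    using row_inj assms by metis
  then show ?thesis using assms by (auto simp: mm_tab_def Let_def)
qed

lemma mm_tab_le: "mm_tab \<rho> c \<le> card V"
  by (simp add: mm_tab_def Let_def maxreach_le)

lemma mm_tab_out: "lam < c \<Longrightarrow> mm_tab \<rho> c = 0"
  by (simp add: mm_tab_def Let_def maxreach_out)

lemma row_le: "e \<in> E \<Longrightarrow> row e \<le> 2 * card V"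
  using pre_less[OF ta_V, of e] by (auto simp: row_def split: option.splits)

definition head_reached :: "'e \<Rightarrow> 'e \<Rightarrow> bool" where
  "head_reached e e' \<longleftrightarrow> e' \<in> F \<and>
     Suc (ppos e') < mm_tab (row e) (col (top_sep e) (pidx e') (Suc (ppos e')))"

text \<open>The zero row is right for edges with tail outside \<open>dom g\<close>: such a tail
  reaches nothing in \<open>dom g\<close> without \<open>g\<close>.\<close>

lemma head_reached_iff:
  assumes "e \<in> E" "e' \<in> F" "top_sep e = Some g" "he e' \<in> dom g"
  shows "head_reached e e' \<longleftrightarrow> reach {g} (ta e) (he e')"
proof (cases "row e < 2 * card V")
  case True
  then show ?thesis
    using maxreach_iff[of "pidx e'" "Suc (ppos e')" g "ta e"] pos_props[OF assms(2)] assms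
    by (simp add: head_reached_def mm_tab_row)
next
  case False
  have "ta e \<notin> dom g"
  proof
    assume a: "ta e \<in> dom g"
    then have "e \<notin> F" using False assms(3) pre_less[OF ta_V[OF assms(1)]]
      by (auto simp: row_def split: if_splits)
    then show False using top_sep_nonflow[OF assms(1) _ assms(3)] a src_notin_dom[of e] by (simp add: rsrc_def)
  qed
  moreover have "conn (ta e) (he e')"
    using seps_conn[OF assms(1) top_sepD(1)[OF assms(3)]] dom_conn[OF _ assms(4), of "he e"]
      top_sepD(1)[OF assms(3)] conn_trans by (auto simp: seps_def)
  ultimately have "\<not> reach {g} (ta e) (he e')" using dom_backward assms(4) by blast
  then show ?thesis using False by (simp add: head_reached_def mm_tab_def)
qed

text \<open>For \<open>e'\<close> outside the flow the table answers no. This is correct: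
  \<open>e'\<close> is then its own outermost separator, so \<open>he e'\<close> leads on to
  \<open>he e\<close> inside \<open>dom e'\<close>, and reaching \<open>he e'\<close> without
  \<open>g\<close> would contradict that \<open>g\<close> separates the ends of
  \<open>e\<close>.\<close>

lemma paired_iff:
  assumes "e1 \<in> E" "e2 \<in> E"
  shows "paired e1 e2 \<longleftrightarrow> (\<exists>g1 g2. top_sep e1 = Some g1 \<and> top_sep e2 = Some g2 \<and>
     he e2 \<in> dom g1 \<and> he e1 \<in> dom g2 \<and> \<not> head_reached e1 e2 \<and> \<not> head_reached e2 e1)"
proof -
  have *: "head_reached e e' \<longleftrightarrow> reach {g} (ta e) (he e')"
    if e: "e \<in> E" "e' \<in> E" "top_sep e = Some g" "top_sep e' = Some g'" "he e' \<in> dom g" "he e \<in> dom g'"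
    for e e' g g'
  proof (cases "e' \<in> F")
    case True
    then show ?thesis using head_reached_iff e by blast
  next
    case False
    then have g': "g' = e'" "dst e' = he e'" using top_sep_nonflow e by (auto simp: rdst_def)
    have he: "he e \<in> dom e'" using e(6) g' by simp
    have "\<not> reach {g} (ta e) (he e')"
    proof
      assume "reach {g} (ta e) (he e')"
      moreover have "reach {g} (he e') (he e)"
        using reach_inside'[OF dom_through(3)[OF he] he conn_sym[OF dom_through(5)[OF he]], of g]
          dom_subset[of e' g] e(5) g' by simp
      ultimately have "reach {g} (ta e) (he e)" by (rule reach_trans)
      then show False using top_sepD(1)[OF e(3)] by (simp add: seps_def)
    qed
    then show ?thesis using False by (simp add: head_reached_def)
  qed
  show ?thesis unfolding paired_def using *[of e1 e2] *[of e2 e1] assms by blast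
qed

end

section \<open>Compiling expressions and counting loops\<close>

datatype exp = Num nat | Reg nat | Op binop exp exp | Ld exp

fun ev :: "nat \<Rightarrow> (nat \<Rightarrow> nat) \<Rightarrow> (nat \<Rightarrow> nat) \<Rightarrow> exp \<Rightarrow> nat" where
  "ev w \<rho> M (Num a) = take_bit w a"
| "ev w \<rho> M (Reg i) = \<rho> i"
| "ev w \<rho> M (Op f a b) = eval_binop w f (ev w \<rho> M a) (ev w \<rho> M b)"
| "ev w \<rho> M (Ld a) = M (ev w \<rho> M a)"

fun below :: "nat \<Rightarrow> exp \<Rightarrow> bool" where
  "below d (Num a) \<longleftrightarrow> True"
| "below d (Reg i) \<longleftrightarrow> i < d"
| "below d (Op f a b) \<longleftrightarrow> below d a \<and> below d b"
| "below d (Ld a) \<longleftrightarrow> below d a"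

text \<open>The registers from \<open>d\<close> on form an evaluation stack with the result in
  \<open>d\<close>. A move between registers is an \<open>Or\<close> with zero.\<close>

fun comp_exp :: "nat \<Rightarrow> exp \<Rightarrow> instr list" where
  "comp_exp d (Num a) = [Const d a]"
| "comp_exp d (Reg i) = [Const d 0, Binop Or d d i]"
| "comp_exp d (Op f a b) = comp_exp d a @ comp_exp (Suc d) b @ [Binop f d d (Suc d)]"
| "comp_exp d (Ld a) = comp_exp d a @ [Load d d]"

fun straight :: "instr \<Rightarrow> bool" where
  "straight (Jump_eq i j l) = False"
| "straight (Jump_less i j l) = False"
| "straight Halt = False"
| "straight _ = True"

lemma straight_comp_exp: "list_all straight (comp_exp d e)"
  by (induction e arbitrary: d) auto

lemma eval_binop_less: "eval_binop w f a b < 2 ^ w"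
  by (cases f) (simp_all only: eval_binop.simps take_bit_nat_less_exp)

lemma ev_cong: "below d e \<Longrightarrow> (\<And>i. i < d \<Longrightarrow> \<rho> i = \<rho>' i) \<Longrightarrow> ev w \<rho> M e = ev w \<rho>' M e"
  by (induction e) auto

lemma ev_less:
  assumes "below d e" "\<And>i. i < d \<Longrightarrow> \<rho> i < 2 ^ w" "\<And>i. M i < 2 ^ w"
  shows "ev w \<rho> M e < 2 ^ w"
  using assms by (induction e) (auto simp: eval_binop_less simp del: eval_binop.simps)

lemma exec_pc: "straight i \<Longrightarrow> pc (exec w i c) = Suc (pc c)"
  by (cases i) auto

lemma steps_straight:
  assumes "P = xs @ is @ ys" "list_all straight is" "pc c = length xs"
  shows "(step w P ^^ length is) c = fold (exec w) is c \<and>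
    pc (fold (exec w) is c) = length xs + length is"
  using assms
proof (induction "is" arbitrary: xs c)
  case (Cons i "is")
  have "P ! pc c = i" "pc c < length P" using Cons.prems by auto
  then have s: "step w P c = exec w i c"
    using Cons.prems by (auto simp: step_def halted_def)
  have "(step w P ^^ length is) (exec w i c) = fold (exec w) is (exec w i c) \<and>
    pc (fold (exec w) is (exec w i c)) = length (xs @ [i]) + length is"
    by (rule Cons.IH) (use Cons.prems in \<open>auto simp: exec_pc\<close>)
  then show ?case using s by (simp add: funpow_swap1 del: funpow.simps add: funpow_Suc_right)
qed auto

lemma comp_exp_correct:
  assumes "below b e" "b \<le> d" "\<And>i. i < b \<Longrightarrow> regs c i < 2 ^ w"
  shows "\<exists>\<rho> p. fold (exec w) (comp_exp d e) c = c\<lparr>pc := p, regs := \<rho>\<rparr> \<and>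
    \<rho> d = ev w (regs c) (mem c) e \<and> (\<forall>i<d. \<rho> i = regs c i)"
  using assms
proof (induction e arbitrary: c d)
  case (Num a)
  then show ?case by (auto intro!: exI)
next
  case (Reg i)
  then have "or 0 (regs c i) = regs c i" "take_bit w (regs c i) = regs c i"
    by (auto simp: take_bit_nat_eq_self)
  then show ?case using Reg.prems
    by (intro exI[of _ "(regs c)(d := regs c i)"] exI[of _ "Suc (Suc (pc c))"] conjI config.equality)
      (auto simp: fun_eq_iff)
next
  case (Op f e1 e2)
  obtain \<rho>1 p1 where 1: "fold (exec w) (comp_exp d e1) c = c\<lparr>pc := p1, regs := \<rho>1\<rparr>"
    "\<rho>1 d = ev w (regs c) (mem c) e1" "\<forall>i<d. \<rho>1 i = regs c i"
    using Op.IH(1)[of d c] Op.prems by auto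
  obtain \<rho>2 p2 where 2: "fold (exec w) (comp_exp (Suc d) e2) (c\<lparr>pc := p1, regs := \<rho>1\<rparr>)
      = c\<lparr>pc := p2, regs := \<rho>2\<rparr>"
    "\<rho>2 (Suc d) = ev w \<rho>1 (mem c) e2" "\<forall>i<Suc d. \<rho>2 i = \<rho>1 i"
    using Op.IH(2)[of "Suc d" "c\<lparr>pc := p1, regs := \<rho>1\<rparr>"] Op.prems 1(3) by auto
  have "ev w \<rho>1 (mem c) e2 = ev w (regs c) (mem c) e2"
    using ev_cong[of b e2 \<rho>1 "regs c"] Op.prems 1(3) by auto
  then show ?case using 1 2
    by (intro exI[of _ "\<rho>2(d := eval_binop w f (\<rho>2 d) (\<rho>2 (Suc d)))"] exI[of _ "Suc p2"] conjI config.equality)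
      (auto simp: fun_eq_iff)
next
  case (Ld e)
  obtain \<rho>1 p1 where 1: "fold (exec w) (comp_exp d e) c = c\<lparr>pc := p1, regs := \<rho>1\<rparr>"
    "\<rho>1 d = ev w (regs c) (mem c) e" "\<forall>i<d. \<rho>1 i = regs c i"
    using Ld.IH[of d c] Ld.prems by auto
  then show ?case
    by (intro exI[of _ "\<rho>1(d := mem c (\<rho>1 d))"] exI[of _ "Suc p1"] conjI config.equality)
      (auto simp: fun_eq_iff)
qed

section \<open>Compilation of statements, loops and programs\<close>

datatype stmt = Assign nat exp | Put exp exp | Out exp

type_synonym state = "(nat \<Rightarrow> nat) \<times> (nat \<Rightarrow> nat) \<times> nat list"

fun run :: "nat \<Rightarrow> stmt \<Rightarrow> state \<Rightarrow> state" where
  "run w (Assign r e) (\<rho>, M, os) = (\<rho>(r := ev w \<rho> M e), M, os)"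
| "run w (Put a e) (\<rho>, M, os) = (\<rho>, M(ev w \<rho> M a := ev w \<rho> M e), os)"
| "run w (Out e) (\<rho>, M, os) = (\<rho>, M, os @ [ev w \<rho> M e])"

fun comp_stmt :: "nat \<Rightarrow> stmt \<Rightarrow> instr list" where
  "comp_stmt d (Assign r e) = comp_exp d e @ [Const r 0, Binop Or r r d]"
| "comp_stmt d (Put a e) = comp_exp d a @ comp_exp (Suc d) e @ [Store d (Suc d)]"
| "comp_stmt d (Out e) = comp_exp d e @ [Emit d]"

fun below_stmt :: "nat \<Rightarrow> stmt \<Rightarrow> bool" where
  "below_stmt d (Assign r e) \<longleftrightarrow> r < d \<and> below d e"
| "below_stmt d (Put a e) \<longleftrightarrow> below d a \<and> below d e"
| "below_stmt d (Out e) \<longleftrightarrow> below d e"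

text \<open>Registers from \<open>d\<close> on are compiler scratch and have no abstract
  counterpart; the program counter is tracked separately.\<close>

definition represents :: "nat \<Rightarrow> nat \<Rightarrow> config \<Rightarrow> state \<Rightarrow> bool" where
  "represents w d c a \<longleftrightarrow> (case a of (\<rho>, M, os) \<Rightarrow>
    (\<forall>i<d. regs c i = \<rho> i \<and> \<rho> i < 2 ^ w) \<and> mem c = M \<and> (\<forall>i. M i < 2 ^ w) \<and> out c = os)"

lemma comp_stmt_correct:
  assumes "represents w d c a" "below_stmt d s"
  shows "represents w d (fold (exec w) (comp_stmt d s) c) (run w s a)"
proof -
  obtain \<rho> M os where a: "a = (\<rho>, M, os)" by (cases a)
  have r: "\<And>i. i < d \<Longrightarrow> regs c i = \<rho> i" "\<And>i. i < d \<Longrightarrow> \<rho> i < 2 ^ w"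
    "mem c = M" "\<And>i. M i < 2 ^ w" "out c = os"
    using assms(1) by (auto simp: represents_def a)
  have E: "ev w (regs c) (mem c) e = ev w \<rho> M e" "ev w \<rho> M e < 2 ^ w" if "below d e" for e
    using ev_cong[OF that, of "regs c" \<rho>] ev_less[OF that, of \<rho>] r by auto
  show ?thesis
  proof (cases s)
    case (Assign x e)
    obtain \<rho>1 p1 where 1: "fold (exec w) (comp_exp d e) c = c\<lparr>pc := p1, regs := \<rho>1\<rparr>"
      "\<rho>1 d = ev w (regs c) (mem c) e" "\<forall>i<d. \<rho>1 i = regs c i"
      using comp_exp_correct[of d e d c w] Assign assms(2) r by auto
    then show ?thesis using Assign assms(2) r E[of e]
      by (auto simp: represents_def a take_bit_nat_eq_self)
  next
    case (Put e1 e2)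
    obtain \<rho>1 p1 where 1: "fold (exec w) (comp_exp d e1) c = c\<lparr>pc := p1, regs := \<rho>1\<rparr>"
      "\<rho>1 d = ev w (regs c) (mem c) e1" "\<forall>i<d. \<rho>1 i = regs c i"
      using comp_exp_correct[of d e1 d c w] Put assms(2) r by auto
    obtain \<rho>2 p2 where 2: "fold (exec w) (comp_exp (Suc d) e2) (c\<lparr>pc := p1, regs := \<rho>1\<rparr>)
        = c\<lparr>pc := p2, regs := \<rho>2\<rparr>"
      "\<rho>2 (Suc d) = ev w \<rho>1 (mem c) e2" "\<forall>i<Suc d. \<rho>2 i = \<rho>1 i"
      using comp_exp_correct[of d e2 "Suc d" "c\<lparr>pc := p1, regs := \<rho>1\<rparr>" w] Put assms(2) r 1(3) by auto
    have "ev w \<rho>1 (mem c) e2 = ev w (regs c) (mem c) e2"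
      using ev_cong[of d e2 \<rho>1 "regs c"] Put assms(2) 1(3) by auto
    then show ?thesis using Put assms(2) r E[of e1] E[of e2] 1 2
      by (auto simp: represents_def a)
  next
    case (Out e)
    obtain \<rho>1 p1 where 1: "fold (exec w) (comp_exp d e) c = c\<lparr>pc := p1, regs := \<rho>1\<rparr>"
      "\<rho>1 d = ev w (regs c) (mem c) e" "\<forall>i<d. \<rho>1 i = regs c i"
      using comp_exp_correct[of d e d c w] Out assms(2) r by auto
    then show ?thesis using Out assms(2) r E[of e] by (auto simp: represents_def a)
  qed
qed

abbreviation comp_block :: "nat \<Rightarrow> stmt list \<Rightarrow> instr list" where
  "comp_block d ss \<equiv> concat (map (comp_stmt d) ss)"

lemma straight_comp_block: "list_all straight (comp_block d ss)"
proof (induction ss)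
  case (Cons s ss)
  then show ?case by (cases s) (auto simp: straight_comp_exp)
qed auto

lemma comp_block_correct:
  assumes "represents w d c a" "list_all (below_stmt d) ss"
  shows "represents w d (fold (exec w) (comp_block d ss) c) (fold (run w) ss a)"
  using assms by (induction ss arbitrary: c a) (auto simp: comp_stmt_correct)

lemma block_steps:
  assumes "P = xs @ comp_block d ss @ ys" "pc c = length xs"
    "represents w d c a" "list_all (below_stmt d) ss"
  shows "represents w d ((step w P ^^ length (comp_block d ss)) c) (fold (run w) ss a) \<and>
    pc ((step w P ^^ length (comp_block d ss)) c) = length xs + length (comp_block d ss)"
  using steps_straight[OF assms(1) straight_comp_block assms(2)] comp_block_correct[OF assms(3,4)] by simp

text \<open>
  \<open>Loop r n ss\<close> runs \<open>ss\<close> for the values \<open>0, \<dots>, N - 1\<close> of register \<open>r\<close>, where \<open>N \<ge> 1\<close> is the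
  content of register \<open>n\<close>.
\<close>

datatype com = Block "stmt list" | Loop nat nat "stmt list"

fun keeps :: "nat \<Rightarrow> stmt \<Rightarrow> bool" where
  "keeps r (Assign x e) \<longleftrightarrow> x \<noteq> r"
| "keeps r _ \<longleftrightarrow> True"

fun below_com :: "nat \<Rightarrow> com \<Rightarrow> bool" where
  "below_com d (Block ss) \<longleftrightarrow> list_all (below_stmt d) ss"
| "below_com d (Loop r n ss) \<longleftrightarrow> list_all (below_stmt d) ss \<and> r < d \<and> n < d \<and> r \<noteq> n \<and>
     list_all (keeps r) ss \<and> list_all (keeps n) ss"

definition loop_body :: "nat \<Rightarrow> nat \<Rightarrow> nat \<Rightarrow> stmt list \<Rightarrow> instr list" where
  "loop_body d r n ss = comp_block d (ss @ [Assign r (Op Add (Reg r) (Num 1))])"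

text \<open>Jump targets are absolute, hence the start address \<open>p\<close>.\<close>

fun comp_com :: "nat \<Rightarrow> nat \<Rightarrow> com \<Rightarrow> instr list" where
  "comp_com d p (Block ss) = comp_block d ss"
| "comp_com d p (Loop r n ss) = comp_block d [Assign r (Num 0)] @ loop_body d r n ss @
     [Jump_less r n (p + length (comp_block d [Assign r (Num 0)]))]"

fun run_com :: "nat \<Rightarrow> com \<Rightarrow> state \<Rightarrow> state" where
  "run_com w (Block ss) a = fold (run w) ss a"
| "run_com w (Loop r n ss) a = (fold (run w) (ss @ [Assign r (Op Add (Reg r) (Num 1))]) ^^ fst a n)
     (run w (Assign r (Num 0)) a)"

fun cost :: "nat \<Rightarrow> com \<Rightarrow> state \<Rightarrow> nat" where
  "cost d (Block ss) a = length (comp_block d ss)"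
| "cost d (Loop r n ss) a = length (comp_block d [Assign r (Num 0)]) +
     fst a n * Suc (length (loop_body d r n ss))"

fun ready :: "com \<Rightarrow> state \<Rightarrow> bool" where
  "ready (Block ss) a \<longleftrightarrow> True"
| "ready (Loop r n ss) a \<longleftrightarrow> 0 < fst a n"

lemma run_keeps: "keeps r s \<Longrightarrow> fst (run w s a) r = fst a r"
  by (cases a; cases s) auto

lemma fold_run_keeps: "list_all (keeps r) ss \<Longrightarrow> fst (fold (run w) ss a) r = fst a r"
  by (induction ss arbitrary: a) (auto simp: run_keeps)

lemma run_incr:
  assumes "fst a r < fst a n" "fst a n < 2 ^ w" "r \<noteq> n"
    "list_all (keeps r) ss" "list_all (keeps n) ss"
  shows "fst (fold (run w) (ss @ [Assign r (Op Add (Reg r) (Num 1))]) a) n = fst a n"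
    "fst (fold (run w) (ss @ [Assign r (Op Add (Reg r) (Num 1))]) a) r = Suc (fst a r)"
proof -
  obtain \<rho> M os where a': "fold (run w) ss a = (\<rho>, M, os)" by (cases "fold (run w) ss a")
  have k: "\<rho> n = fst a n" "\<rho> r = fst a r"
    using fold_run_keeps[of n ss w a] fold_run_keeps[of r ss w a] assms(4,5) a' by simp_all
  have "0 < w" using assms(1,2) by (cases w) auto
  then have "take_bit w (1::nat) = 1" by (cases w) auto
  moreover have "take_bit w (Suc (fst a r)) = Suc (fst a r)"
    using assms(1,2) by (simp add: take_bit_nat_eq_self)
  ultimately show
    "fst (fold (run w) (ss @ [Assign r (Op Add (Reg r) (Num 1))]) a) n = fst a n"
    "fst (fold (run w) (ss @ [Assign r (Op Add (Reg r) (Num 1))]) a) r = Suc (fst a r)"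
    using a' k assms(3) by simp_all
qed

text \<open>Induction on the number of iterations after the current one; \<open>Suc k\<close> occurs
  because the test follows the body.\<close>

lemma loop_steps:
  assumes P: "P = xs @ loop_body d r n ss @ [Jump_less r n (length xs)] @ ys"
    and b: "below_com d (Loop r n ss)"
    and "pc c = length xs" "represents w d c a" "fst a n = fst a r + Suc k"
  defines "B \<equiv> fold (run w) (ss @ [Assign r (Op Add (Reg r) (Num 1))])"
  shows "represents w d ((step w P ^^ (Suc k * Suc (length (loop_body d r n ss)))) c) ((B ^^ Suc k) a) \<and>
    pc ((step w P ^^ (Suc k * Suc (length (loop_body d r n ss)))) c) =
      length xs + Suc (length (loop_body d r n ss))"
  using assms(3-5)
proof (induction k arbitrary: c a)
  case IH: (0 c a)
  let ?l = "length (loop_body d r n ss)"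
  have bs: "list_all (below_stmt d) (ss @ [Assign r (Op Add (Reg r) (Num 1))])" using b by auto
  define c1 where "c1 = (step w P ^^ ?l) c"
  have 1: "represents w d c1 (B a)" "pc c1 = length xs + ?l"
    using block_steps[OF P[unfolded loop_body_def] IH(1,2) bs]
    by (simp_all add: c1_def B_def loop_body_def)
  have "fst a n < 2 ^ w" using IH(2) b by (auto simp: represents_def split: prod.splits)
  then have "fst (B a) n = fst a n" "fst (B a) r = Suc (fst a r)"
    using run_incr[of a r n w ss] b IH(3) by (auto simp: B_def)
  then have 2: "regs c1 r = Suc (fst a r)" "regs c1 n = fst a n"
    using 1(1) b by (auto simp: represents_def split: prod.splits)
  have "step w P c1 = c1\<lparr>pc := Suc (pc c1)\<rparr>"
    using 1(2) 2 IH(3) by (auto simp: step_def halted_def P nth_append)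
  moreover have "(step w P ^^ (Suc 0 * Suc ?l)) c = step w P c1" by (simp add: c1_def)
  ultimately show ?case using 1 by (simp add: represents_def split: prod.splits)
next
  case IH: (Suc k c a)
  let ?l = "length (loop_body d r n ss)"
  have bs: "list_all (below_stmt d) (ss @ [Assign r (Op Add (Reg r) (Num 1))])" using b by auto
  define c1 where "c1 = (step w P ^^ ?l) c"
  have 1: "represents w d c1 (B a)" "pc c1 = length xs + ?l"
    using block_steps[OF P[unfolded loop_body_def] IH(2,3) bs]
    by (simp_all add: c1_def B_def loop_body_def)
  have "fst a n < 2 ^ w" using IH(3) b by (auto simp: represents_def split: prod.splits)
  then have 3: "fst (B a) n = fst a n" "fst (B a) r = Suc (fst a r)"
    using run_incr[of a r n w ss] b IH(4) by (auto simp: B_def)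
  then have 2: "regs c1 r = Suc (fst a r)" "regs c1 n = fst a n"
    using 1(1) b by (auto simp: represents_def split: prod.splits)
  have s: "step w P c1 = c1\<lparr>pc := length xs\<rparr>"
    using 1(2) 2 IH(4) by (auto simp: step_def halted_def P nth_append)
  have "represents w d (c1\<lparr>pc := length xs\<rparr>) (B a)"
    using 1(1) by (simp add: represents_def split: prod.splits)
  note ih = IH(1)[OF _ this]
  have e: "(step w P ^^ (Suc (Suc k) * Suc ?l)) c = (step w P ^^ (Suc k * Suc ?l)) (c1\<lparr>pc := length xs\<rparr>)"
  proof -
    have "Suc (Suc k) * Suc ?l = Suc k * Suc ?l + Suc ?l" by simp
    then have "(step w P ^^ (Suc (Suc k) * Suc ?l)) c = (step w P ^^ (Suc k * Suc ?l)) ((step w P ^^ Suc ?l) c)"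
      by (metis funpow_add comp_apply)
    then show ?thesis using s by (simp add: c1_def)
  qed
  show ?case unfolding e funpow_Suc_right[of "Suc k"] comp_apply
    using ih 3 IH(4) by simp
qed

lemma com_steps:
  assumes "P = xs @ comp_com d (length xs) m @ ys" "pc c = length xs"
    "represents w d c a" "below_com d m" "ready m a"
  shows "represents w d ((step w P ^^ cost d m a) c) (run_com w m a) \<and>
    pc ((step w P ^^ cost d m a) c) = length xs + length (comp_com d (length xs) m)"
proof (cases m)
  case (Block ss)
  then show ?thesis using block_steps assms by auto
next
  case (Loop r n ss)
  let ?i = "comp_block d [Assign r (Num 0)]"
  let ?a = "run w (Assign r (Num 0)) a"
  have P: "P = xs @ ?i @ (loop_body d r n ss @ [Jump_less r n (length (xs @ ?i))] @ ys)"
    using assms(1) Loop by simp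
  define c1 where "c1 = (step w P ^^ length ?i) c"
  have 1: "represents w d c1 ?a" "pc c1 = length (xs @ ?i)"
    using block_steps[OF P assms(2,3)] assms(4) Loop by (auto simp: c1_def)
  have P': "P = (xs @ ?i) @ loop_body d r n ss @ [Jump_less r n (length (xs @ ?i))] @ ys"
    using P by simp
  obtain k where k: "fst a n = Suc k" using assms(5) Loop by (cases "fst a n") auto
  have f: "fst ?a n = fst ?a r + Suc k" "fst ?a n = fst a n"
    using k assms(4) Loop by (cases a; auto)+
  have "(step w P ^^ cost d m a) c = (step w P ^^ (Suc k * Suc (length (loop_body d r n ss)))) c1"
    using funpow_add[of "Suc k * Suc (length (loop_body d r n ss))" "length ?i" "step w P"]
    unfolding c1_def cost.simps Loop k
    by (simp only: comp_apply add.commute[of "length ?i"])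
  then show ?thesis
    using loop_steps[OF P' assms(4)[unfolded Loop] 1(2,1) f(1)] Loop k by simp
qed

fun comp_prog :: "nat \<Rightarrow> nat \<Rightarrow> com list \<Rightarrow> instr list" where
  "comp_prog d p [] = [Halt]"
| "comp_prog d p (m # ms) = comp_com d p m @ comp_prog d (p + length (comp_com d p m)) ms"

fun costs :: "nat \<Rightarrow> nat \<Rightarrow> com list \<Rightarrow> state \<Rightarrow> nat" where
  "costs w d [] a = 0"
| "costs w d (m # ms) a = cost d m a + costs w d ms (run_com w m a)"

fun readys :: "nat \<Rightarrow> com list \<Rightarrow> state \<Rightarrow> bool" where
  "readys w [] a \<longleftrightarrow> True"
| "readys w (m # ms) a \<longleftrightarrow> ready m a \<and> readys w ms (run_com w m a)"

lemma prog_steps: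
  assumes "P = xs @ comp_prog d (length xs) ms" "pc c = length xs" "represents w d c a"
    "list_all (below_com d) ms" "readys w ms a"
  shows "represents w d ((step w P ^^ costs w d ms a) c) (fold (run_com w) ms a) \<and>
    halted P ((step w P ^^ costs w d ms a) c)"
  using assms
proof (induction ms arbitrary: xs c a)
  case Nil
  then show ?case by (simp add: halted_def)
next
  case (Cons m ms)
  let ?c = "(step w P ^^ cost d m a) c"
  have 1: "represents w d ?c (run_com w m a)" "pc ?c = length xs + length (comp_com d (length xs) m)"
    using com_steps[of P xs d m _ c w a] Cons.prems by auto
  have "represents w d ((step w P ^^ costs w d ms (run_com w m a)) ?c) (fold (run_com w) ms (run_com w m a)) \<and>
    halted P ((step w P ^^ costs w d ms (run_com w m a)) ?c)"
    by (rule Cons.IH[of "xs @ comp_com d (length xs) m"]) (use Cons.prems 1 in auto)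
  moreover have "(step w P ^^ costs w d (m # ms) a) c = (step w P ^^ costs w d ms (run_com w m a)) ?c"
    using funpow_add[of "costs w d ms (run_com w m a)" "cost d m a" "step w P"] by (simp add: add.commute)
  ultimately show ?case by simp
qed

lemma halted_steps: "halted P c \<Longrightarrow> (step w P ^^ k) c = c"
  by (induction k) (auto simp: step_def)

definition init_regs :: "nat list \<Rightarrow> nat \<Rightarrow> nat" where
  "init_regs args i = (if i < length args then args ! i else 0)"

text \<open>A halted configuration is stationary, so any \<open>T\<close> above the exact cost is a
  valid time bound.\<close>

theorem query_comp_prog:
  assumes "\<forall>x\<in>set args. x < 2 ^ w" "list_all (below_com d) ms"
    and "\<And>M. \<forall>i. M i < 2 ^ w \<Longrightarrow> stored D M \<Longrightarrow>
      readys w ms (init_regs args, M, []) \<and> costs w d ms (init_regs args, M, []) \<le> T \<and>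
      (\<exists>\<rho> M' os. fold (run_com w) ms (init_regs args, M, []) = (\<rho>, M', os) \<and> R os \<and> stored D M')"
  shows "query w (comp_prog d 0 ms) D args T R"
  unfolding query_def Let_def
proof (intro allI impI)
  fix M assume M: "(\<forall>i. M i < 2 ^ w) \<and> stored D M"
  let ?P = "comp_prog d 0 ms"
  let ?c = "init_config args M"
  let ?a = "(init_regs args, M, [])"
  have rep: "represents w d ?c ?a"
    using M assms(1) by (auto simp: represents_def init_config_def init_regs_def)
  obtain \<rho> M' os where a: "readys w ms ?a" "costs w d ms ?a \<le> T"
    "fold (run_com w) ms ?a = (\<rho>, M', os)" "R os" "stored D M'"
    using assms(3)[of M] M by blast
  let ?c' = "(step w ?P ^^ costs w d ms ?a) ?c"
  have 1: "represents w d ?c' (fold (run_com w) ms ?a)" "halted ?P ?c'"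
    using prog_steps[of ?P "[]" d ms ?c w ?a] rep assms(2) a(1) by (auto simp: init_config_def)
  have "(step w ?P ^^ T) ?c = (step w ?P ^^ (T - costs w d ms ?a)) ?c'"
    using a(2) by (metis funpow_add comp_apply le_add_diff_inverse2)
  then have "(step w ?P ^^ T) ?c = ?c'" using halted_steps[OF 1(2)] by simp
  then show "halted ?P ((step w ?P ^^ T) ?c) \<and> R (out ((step w ?P ^^ T) ?c)) \<and>
      stored D (mem ((step w ?P ^^ T) ?c))"
    using 1 a by (auto simp: represents_def)
qed

section \<open>The query programs\<close>

text \<open>
  The data structure consists of 40 arrays of equal length \<open>Z\<close>, which are interleaved: entry \<open>i\<close> of
  array \<open>a\<close> is cell \<open>40 * i + a\<close>. All branches are replaced by arithmetic on bits. Register 2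
  contains \<open>w - 1\<close>: for numbers below \<open>2 ^ (w - 1)\<close>, the leading bit of a difference is a comparison.
\<close>

datatype hexp = HN nat | HR nat | HRd hexp hexp | HLd hexp
  | HAdd hexp hexp | HMul hexp hexp | HDiv hexp hexp | HMod hexp hexp
  | HLt hexp hexp | HEq hexp hexp | HAnd hexp hexp | HOr hexp hexp | HNot hexp | HXor hexp hexp
  | HSel hexp hexp hexp

fun lower :: "hexp \<Rightarrow> exp" where
  "lower (HN a) = Num a"
| "lower (HR i) = Reg i"
| "lower (HRd a b) = Ld (Op Add (Op Mul (Num 40) (lower b)) (lower a))"
| "lower (HLd a) = Ld (lower a)"
| "lower (HAdd a b) = Op Add (lower a) (lower b)"
| "lower (HMul a b) = Op Mul (lower a) (lower b)"
| "lower (HDiv a b) = Op Div (lower a) (lower b)"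
| "lower (HMod a b) = Op Mod (lower a) (lower b)"
| "lower (HLt a b) = Op Shr (Op Sub (lower a) (lower b)) (Reg 2)"
| "lower (HEq a b) = Op And (Op Xor (Op Shr (Op Sub (lower a) (lower b)) (Reg 2)) (Num 1))
     (Op Xor (Op Shr (Op Sub (lower b) (lower a)) (Reg 2)) (Num 1))"
| "lower (HAnd a b) = Op And (lower a) (lower b)"
| "lower (HOr a b) = Op Or (lower a) (lower b)"
| "lower (HNot a) = Op Xor (lower a) (Num 1)"
| "lower (HXor a b) = Op Xor (lower a) (lower b)"
| "lower (HSel c a b) = Op Add (Op Mul (lower c) (lower a)) (Op Mul (Op Xor (lower c) (Num 1)) (lower b))"

type_synonym arrays = "nat \<Rightarrow> nat \<Rightarrow> nat"

fun hv :: "arrays \<Rightarrow> (nat \<Rightarrow> nat) \<Rightarrow> (nat \<Rightarrow> nat) \<Rightarrow> hexp \<Rightarrow> nat" where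
  "hv A \<rho> M (HN a) = a"
| "hv A \<rho> M (HR i) = \<rho> i"
| "hv A \<rho> M (HRd a b) = A (hv A \<rho> M a) (hv A \<rho> M b)"
| "hv A \<rho> M (HLd a) = M (hv A \<rho> M a)"
| "hv A \<rho> M (HAdd a b) = hv A \<rho> M a + hv A \<rho> M b"
| "hv A \<rho> M (HMul a b) = hv A \<rho> M a * hv A \<rho> M b"
| "hv A \<rho> M (HDiv a b) = hv A \<rho> M a div hv A \<rho> M b"
| "hv A \<rho> M (HMod a b) = hv A \<rho> M a mod hv A \<rho> M b"
| "hv A \<rho> M (HLt a b) = of_bool (hv A \<rho> M a < hv A \<rho> M b)"
| "hv A \<rho> M (HEq a b) = of_bool (hv A \<rho> M a = hv A \<rho> M b)"
| "hv A \<rho> M (HAnd a b) = of_bool (hv A \<rho> M a \<noteq> 0 \<and> hv A \<rho> M b \<noteq> 0)"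
| "hv A \<rho> M (HOr a b) = of_bool (hv A \<rho> M a \<noteq> 0 \<or> hv A \<rho> M b \<noteq> 0)"
| "hv A \<rho> M (HNot a) = of_bool (hv A \<rho> M a = 0)"
| "hv A \<rho> M (HXor a b) = of_bool ((hv A \<rho> M a = 0) \<noteq> (hv A \<rho> M b = 0))"
| "hv A \<rho> M (HSel c a b) = (if hv A \<rho> M c \<noteq> 0 then hv A \<rho> M a else hv A \<rho> M b)"

text \<open>Conditions under which the ideal value \<open>hv\<close> agrees with the truncated
  machine arithmetic: no overflow, array indices in range, and bits as operands of logical
  operators.\<close>

fun hok :: "nat \<Rightarrow> nat \<Rightarrow> arrays \<Rightarrow> (nat \<Rightarrow> nat) \<Rightarrow> (nat \<Rightarrow> nat) \<Rightarrow> hexp \<Rightarrow> bool" where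
  "hok w Z A \<rho> M (HN a) \<longleftrightarrow> a < 2 ^ w"
| "hok w Z A \<rho> M (HR i) \<longleftrightarrow> True"
| "hok w Z A \<rho> M (HRd a b) \<longleftrightarrow> hok w Z A \<rho> M a \<and> hok w Z A \<rho> M b \<and>
     hv A \<rho> M a < 40 \<and> hv A \<rho> M b < Z"
| "hok w Z A \<rho> M (HLd a) \<longleftrightarrow> hok w Z A \<rho> M a"
| "hok w Z A \<rho> M (HAdd a b) \<longleftrightarrow> hok w Z A \<rho> M a \<and> hok w Z A \<rho> M b \<and> hv A \<rho> M a + hv A \<rho> M b < 2 ^ w"
| "hok w Z A \<rho> M (HMul a b) \<longleftrightarrow> hok w Z A \<rho> M a \<and> hok w Z A \<rho> M b \<and> hv A \<rho> M a * hv A \<rho> M b < 2 ^ w"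
| "hok w Z A \<rho> M (HDiv a b) \<longleftrightarrow> hok w Z A \<rho> M a \<and> hok w Z A \<rho> M b \<and> hv A \<rho> M a < 2 ^ w"
| "hok w Z A \<rho> M (HMod a b) \<longleftrightarrow> hok w Z A \<rho> M a \<and> hok w Z A \<rho> M b \<and> hv A \<rho> M a < 2 ^ w"
| "hok w Z A \<rho> M (HLt a b) \<longleftrightarrow> hok w Z A \<rho> M a \<and> hok w Z A \<rho> M b \<and>
     hv A \<rho> M a < 2 ^ (w - 1) \<and> hv A \<rho> M b < 2 ^ (w - 1) \<and> \<rho> 2 = w - 1"
| "hok w Z A \<rho> M (HEq a b) \<longleftrightarrow> hok w Z A \<rho> M a \<and> hok w Z A \<rho> M b \<and>
     hv A \<rho> M a < 2 ^ (w - 1) \<and> hv A \<rho> M b < 2 ^ (w - 1) \<and> \<rho> 2 = w - 1"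
| "hok w Z A \<rho> M (HAnd a b) \<longleftrightarrow> hok w Z A \<rho> M a \<and> hok w Z A \<rho> M b \<and> hv A \<rho> M a \<le> 1 \<and> hv A \<rho> M b \<le> 1"
| "hok w Z A \<rho> M (HOr a b) \<longleftrightarrow> hok w Z A \<rho> M a \<and> hok w Z A \<rho> M b \<and> hv A \<rho> M a \<le> 1 \<and> hv A \<rho> M b \<le> 1"
| "hok w Z A \<rho> M (HNot a) \<longleftrightarrow> hok w Z A \<rho> M a \<and> hv A \<rho> M a \<le> 1"
| "hok w Z A \<rho> M (HXor a b) \<longleftrightarrow> hok w Z A \<rho> M a \<and> hok w Z A \<rho> M b \<and> hv A \<rho> M a \<le> 1 \<and> hv A \<rho> M b \<le> 1"
| "hok w Z A \<rho> M (HSel c a b) \<longleftrightarrow> hok w Z A \<rho> M c \<and> hok w Z A \<rho> M a \<and> hok w Z A \<rho> M b \<and>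
     hv A \<rho> M c \<le> 1 \<and> hv A \<rho> M a < 2 ^ w \<and> hv A \<rho> M b < 2 ^ w"

lemma eval_compare:
  assumes "0 < w" "x < 2 ^ (w - 1)" "y < 2 ^ (w - 1)"
  shows "eval_binop w Shr (eval_binop w Sub x y) (w - 1) = of_bool (x < y)"
proof -
  have p: "(2::nat) ^ w = 2 * 2 ^ (w - 1)" using assms(1) by (cases w) auto
  show ?thesis
  proof (cases "x < y")
    case True
    define d where "d = 2 ^ w + x - y"
    have d: "d < 2 ^ w" "2 ^ (w - 1) \<le> d" using True assms p by (auto simp: d_def)
    have "d div 2 ^ (w - 1) = 1" by (rule div_nat_eqI) (use d p in simp_all)
    moreover have "take_bit w (1::nat) = 1" using assms(1) by (cases w) auto
    ultimately show ?thesis using True d(1) by (simp add: take_bit_nat_eq_self drop_bit_eq_div flip: d_def)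
  next
    case False
    have "take_bit w (2 ^ w + x - y) = x - y"
    proof -
      have "2 ^ w + x - y = 2 ^ w + (x - y)" using False by simp
      moreover have "x - y < 2 ^ w" using assms p by linarith
      ultimately show ?thesis by (simp only: take_bit_eq_mod mod_add_self1 mod_less)
    qed
    then show ?thesis using False assms by (simp add: drop_bit_eq_div less_imp_diff_less)
  qed
qed

lemma take_bit_of_bool: "0 < w \<Longrightarrow> take_bit w (of_bool p :: nat) = of_bool p"
  by (cases p; cases w) auto

lemma eval_bits:
  assumes "0 < w"
  shows "eval_binop w And (of_bool p) (of_bool q) = of_bool (p \<and> q)"
    "eval_binop w Or (of_bool p) (of_bool q) = of_bool (p \<or> q)"
    "eval_binop w Xor (of_bool p) (of_bool q) = of_bool (p \<noteq> q)"
  using take_bit_of_bool[OF assms, of True] by (cases p; cases q; simp)+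

lemma bit_cases: "(x::nat) \<le> 1 \<Longrightarrow> x = of_bool (x \<noteq> 0)"
  by (cases x) auto

lemma ev_lower:
  assumes "0 < w" "40 * Z < 2 ^ w" "\<And>a i. a < 40 \<Longrightarrow> i < Z \<Longrightarrow> M (40 * i + a) = A a i"
  shows "hok w Z A \<rho> M e \<Longrightarrow> ev w \<rho> M (lower e) = hv A \<rho> M e"
proof (induction e)
  case (HRd a b)
  then have h: "hv A \<rho> M a < 40" "hv A \<rho> M b < Z" by auto
  then have l: "40 * hv A \<rho> M b + hv A \<rho> M a < 2 ^ w" using assms(2) by linarith
  have "(40::nat) < 2 ^ w" using assms(2) h by linarith
  then have "take_bit w 40 = (40::nat)" by (simp add: take_bit_nat_eq_self)
  moreover have "take_bit w (40 * hv A \<rho> M b) = 40 * hv A \<rho> M b"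
    "take_bit w (40 * hv A \<rho> M b + hv A \<rho> M a) = 40 * hv A \<rho> M b + hv A \<rho> M a"
    using l by (simp_all add: take_bit_nat_eq_self)
  ultimately show ?case using HRd h assms(3) by simp
next
  case (HDiv a b)
  have "hv A \<rho> M a div hv A \<rho> M b \<le> hv A \<rho> M a" by simp
  then have "hv A \<rho> M a div hv A \<rho> M b < 2 ^ w" by (rule le_less_trans) (use HDiv.prems in simp)
  then show ?case using HDiv by (simp add: take_bit_nat_eq_self)
next
  case (HMod a b)
  have "hv A \<rho> M a mod hv A \<rho> M b \<le> hv A \<rho> M a" by simp
  then have "hv A \<rho> M a mod hv A \<rho> M b < 2 ^ w" by (rule le_less_trans) (use HMod.prems in simp)
  then show ?case using HMod by (simp add: take_bit_nat_eq_self)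
next
  case (HLt a b)
  then show ?case using eval_compare[OF assms(1)] by (simp del: eval_binop.simps)
next
  case (HEq a b)
  define x where "x = hv A \<rho> M a"
  define y where "y = hv A \<rho> M b"
  have 1: "ev w \<rho> M (Num 1) = of_bool True" using take_bit_of_bool[OF assms(1), of True] by simp
  have "ev w \<rho> M (lower (HEq a b)) = eval_binop w And
      (eval_binop w Xor (of_bool (x < y)) (of_bool True)) (eval_binop w Xor (of_bool (y < x)) (of_bool True))"
    using HEq eval_compare[OF assms(1)] 1 by (simp add: x_def y_def del: eval_binop.simps)
  also have "\<dots> = of_bool (x = y)" unfolding eval_bits[OF assms(1)] by auto
  finally show ?case by (simp only: hv.simps x_def y_def)
next
  case (HAnd a b)
  then have "hv A \<rho> M a = of_bool (hv A \<rho> M a \<noteq> 0)" "hv A \<rho> M b = of_bool (hv A \<rho> M b \<noteq> 0)"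
    by (auto intro: bit_cases)
  then show ?case using HAnd eval_bits(1)[OF assms(1)] by (metis ev.simps(3) hok.simps(11) hv.simps(11) lower.simps(11))
next
  case (HOr a b)
  then have "hv A \<rho> M a = of_bool (hv A \<rho> M a \<noteq> 0)" "hv A \<rho> M b = of_bool (hv A \<rho> M b \<noteq> 0)"
    by (auto intro: bit_cases)
  then show ?case using HOr eval_bits(2)[OF assms(1)] by (metis ev.simps(3) hok.simps(12) hv.simps(12) lower.simps(12))
next
  case (HNot a)
  then have 1: "hv A \<rho> M a = of_bool (hv A \<rho> M a \<noteq> 0)" by (auto intro: bit_cases)
  have 2: "ev w \<rho> M (Num 1) = of_bool True" using take_bit_of_bool[OF assms(1), of True] by simp
  have "ev w \<rho> M (lower (HNot a)) = eval_binop w Xor (of_bool (hv A \<rho> M a \<noteq> 0)) (of_bool True)"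
    using HNot 1 2 by (simp del: eval_binop.simps)
  then show ?case unfolding eval_bits[OF assms(1)] by simp
next
  case (HXor a b)
  have 1: "hv A \<rho> M a = of_bool (hv A \<rho> M a \<noteq> 0)" "hv A \<rho> M b = of_bool (hv A \<rho> M b \<noteq> 0)"
    using HXor.prems by (auto intro: bit_cases)
  have "ev w \<rho> M (lower (HXor a b)) =
      eval_binop w Xor (of_bool (hv A \<rho> M a \<noteq> 0)) (of_bool (hv A \<rho> M b \<noteq> 0))"
    using HXor 1 by (simp del: eval_binop.simps)
  then show ?case unfolding eval_bits[OF assms(1)] by auto
next
  case (HSel c a b)
  have 1: "hv A \<rho> M c = of_bool (hv A \<rho> M c \<noteq> 0)" using HSel.prems by (auto intro: bit_cases)
  have 2: "ev w \<rho> M (Num 1) = of_bool True" using take_bit_of_bool[OF assms(1), of True] by simp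
  have "ev w \<rho> M (lower (HSel c a b)) = eval_binop w Add
      (eval_binop w Mul (of_bool (hv A \<rho> M c \<noteq> 0)) (hv A \<rho> M a))
      (eval_binop w Mul (eval_binop w Xor (of_bool (hv A \<rho> M c \<noteq> 0)) (of_bool True)) (hv A \<rho> M b))"
    using HSel 1 2 by (simp del: eval_binop.simps)
  then show ?case unfolding eval_bits[OF assms(1)]
    using HSel.prems by (simp add: take_bit_nat_eq_self)
qed (auto simp: take_bit_nat_eq_self)

text \<open>
  Array 0 contains scalars, arrays 1 to 4 the dictionary of edge numbers, and array 5 the flags of
  the edges in minimum cuts. The remaining arrays come in pairs: one for the network and one for its
  reversal.
\<close>

abbreviation scal :: "arrays \<Rightarrow> nat \<Rightarrow> nat" where "scal A j \<equiv> A 0 j"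
definition fld :: "nat \<Rightarrow> arrays \<Rightarrow> nat \<Rightarrow> nat \<Rightarrow> nat" where "fld j A u i = A (6 + 2 * j + u) i"

abbreviation "PA \<equiv> fld 0" abbreviation "PB \<equiv> fld 1" abbreviation "IP \<equiv> fld 2" abbreviation "JJ \<equiv> fld 3"
abbreviation "LO \<equiv> fld 4" abbreviation "HI \<equiv> fld 5" abbreviation "ROW \<equiv> fld 6" abbreviation "GP \<equiv> fld 7"
abbreviation "GL \<equiv> fld 8" abbreviation "LLO \<equiv> fld 9" abbreviation "LHI \<equiv> fld 10" abbreviation "LP \<equiv> fld 11"
abbreviation "LL \<equiv> fld 12" abbreviation "TT \<equiv> fld 13" abbreviation "MX \<equiv> fld 14" abbreviation "MN \<equiv> fld 15"
abbreviation "PRE \<equiv> fld 16"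

text \<open>Two-level hashing: bucket \<open>b\<close> has offset \<open>A 1 b\<close>, multiplier
  \<open>A 2 b\<close> and modulus \<open>A 3 b\<close>, while the block length
  \<open>scal A 3\<close> is common to both levels.\<close>

definition cell :: "arrays \<Rightarrow> nat \<Rightarrow> nat" where
  "cell A x = (let b = scal A 5 * x mod scal A 4 div scal A 3
     in A 1 b + A 2 b * x mod A 3 b div scal A 3)"

text \<open>Comparison with the stored key detects edges without a record. They are sent to slot 0,
  which holds the default record.\<close>

definition slot :: "arrays \<Rightarrow> nat \<Rightarrow> nat" where
  "slot A x = (if A 4 (cell A x) = x then Suc (cell A x) else 0)"

definition colf :: "arrays \<Rightarrow> nat \<Rightarrow> nat \<Rightarrow> nat \<Rightarrow> nat \<Rightarrow> nat" where
  "colf A p l i y = (if i = p \<and> l < y then scal A 2 else i)"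

text \<open>\<open>JJ\<close> is the position of the head, one above that of the tail, and break
  positions are shifted in the same way. The added 1 aligns the column test with the head of
  \<open>b\<close>.\<close>

definition hrf :: "arrays \<Rightarrow> nat \<Rightarrow> nat \<Rightarrow> nat \<Rightarrow> bool" where
  "hrf A u a b \<longleftrightarrow>
     JJ A u b < MX A u (ROW A u a * scal A 1 + colf A (GP A u a) (GL A u a) (IP A u b) (JJ A u b + 1))"

definition pairf :: "arrays \<Rightarrow> nat \<Rightarrow> nat \<Rightarrow> nat \<Rightarrow> bool" where
  "pairf A u a b \<longleftrightarrow> (LO A u a \<le> PB A u b \<and> PB A u b < HI A u a) \<and>
     (LO A u b \<le> PB A u a \<and> PB A u a < HI A u b) \<and> \<not> hrf A u a b \<and> \<not> hrf A u b a"

text \<open>As \<open>JJ\<close> is one above the position of the tail, \<open>TT < JJ\<close> means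
  that the tail reaches the vertex whose row is read.\<close>

definition dblf :: "arrays \<Rightarrow> nat \<Rightarrow> nat \<Rightarrow> bool" where
  "dblf A a b \<longleftrightarrow> A 5 a \<noteq> 0 \<and> A 5 b \<noteq> 0 \<and>
     \<not> TT A 0 (PB A 0 b * scal A 1 + IP A 0 a) < JJ A 0 a \<and>
     \<not> TT A 0 (PB A 0 a * scal A 1 + IP A 0 b) < JJ A 0 b"

definition sizef :: "arrays \<Rightarrow> nat \<Rightarrow> nat \<Rightarrow> nat" where
  "sizef A a b = (if dblf A a b then scal A 9
     else if A 5 a \<noteq> 0 \<or> A 5 b \<noteq> 0 \<or> pairf A 0 a b \<or> pairf A 1 a b then scal A 8 else scal A 2)"

text \<open>The search climbs through the heads of levels until the tail number \<open>p\<close>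
  lies in the interval of the level or the separator's head \<open>l\<close> is met, which the tail
  never reaches. Level heads have smaller numbers; the guard exposes this to the termination
  proof.\<close>

fun stf :: "arrays \<Rightarrow> nat \<Rightarrow> nat \<Rightarrow> nat \<Rightarrow> nat \<Rightarrow> nat \<Rightarrow> nat \<Rightarrow> bool" where
  "stf A u l p i j q \<longleftrightarrow> q \<noteq> l \<and>
     (if LLO A u q \<le> p \<and> p < LHI A u q
      then MN A u (q * scal A 1 + colf A (LP A u q) (LL A u q) i j) < j
      else if LLO A u q < q then stf A u l p i j (LLO A u q) else False)"

declare stf.simps [simp del]

definition side :: "arrays \<Rightarrow> nat \<Rightarrow> nat \<Rightarrow> nat" where
  "side A a b = of_bool (A 5 a = 0 \<and> A 5 b = 0 \<and> \<not> pairf A 0 a b \<and> pairf A 1 a b)"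

definition actf :: "arrays \<Rightarrow> nat \<Rightarrow> nat \<Rightarrow> bool" where
  "actf A a b \<longleftrightarrow> A 5 a = 0 \<and> A 5 b = 0 \<and> (pairf A 0 a b \<or> pairf A 1 a b)"

definition deff :: "arrays \<Rightarrow> nat \<Rightarrow> nat \<Rightarrow> bool" where
  "deff A a b \<longleftrightarrow> A 5 a = 0 \<and> A 5 b = 0 \<and> \<not> pairf A 0 a b \<and> \<not> pairf A 1 a b"

text \<open>If no failure reduces the cut, the first edge is replaced by the source, whose column is
  \<open>lam + 1\<close> and whose threshold is 1. A threshold 0 switches an edge off.\<close>

definition i1f :: "arrays \<Rightarrow> nat \<Rightarrow> nat \<Rightarrow> nat" where
  "i1f A a b = (if deff A a b then scal A 2 + 1 else IP A (side A a b) a)"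
definition j1f :: "arrays \<Rightarrow> nat \<Rightarrow> nat \<Rightarrow> nat" where
  "j1f A a b = (if deff A a b then 1 else if A 5 a \<noteq> 0 \<or> actf A a b then JJ A (side A a b) a else 0)"
definition j2f :: "arrays \<Rightarrow> nat \<Rightarrow> nat \<Rightarrow> nat" where
  "j2f A a b = (if dblf A a b \<or> (A 5 b \<noteq> 0 \<and> A 5 a = 0) \<or> actf A a b then JJ A (side A a b) b else 0)"
definition lof :: "arrays \<Rightarrow> nat \<Rightarrow> nat \<Rightarrow> nat" where
  "lof A a b = (if actf A a b then max (LO A (side A a b) a) (LO A (side A a b) b) else 0)"
definition hif :: "arrays \<Rightarrow> nat \<Rightarrow> nat \<Rightarrow> nat" where
  "hif A a b = (if actf A a b then min (HI A (side A a b) a) (HI A (side A a b) b) else 0)"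

text \<open>On side 1 the tables describe the cut of the reversed network, whose complement is
  wanted.\<close>

definition bitf :: "arrays \<Rightarrow> nat \<Rightarrow> nat \<Rightarrow> nat \<Rightarrow> bool" where
  "bitf A a b v \<longleftrightarrow> (let u = side A a b; q = PRE A u v in
     (if lof A a b \<le> q \<and> q < hif A a b
      then stf A u (lof A a b) (PA A u a) (i1f A a b) (j1f A a b) q \<or>
        stf A u (lof A a b) (PA A u b) (IP A u b) (j2f A a b) q
      else TT A u (q * scal A 1 + i1f A a b) < j1f A a b \<or>
        TT A u (q * scal A 1 + IP A u b) < j2f A a b) \<noteq> (u \<noteq> 0))"

abbreviation hsc :: "nat \<Rightarrow> hexp" where "hsc j \<equiv> HRd (HN 0) (HN j)"
definition hfld :: "nat \<Rightarrow> hexp \<Rightarrow> hexp \<Rightarrow> hexp" where "hfld j u i = HRd (HAdd (HN (6 + 2 * j)) u) i"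
abbreviation hin :: "hexp \<Rightarrow> hexp \<Rightarrow> hexp \<Rightarrow> hexp" where
  "hin x l h \<equiv> HAnd (HNot (HLt x l)) (HLt x h)"
abbreviation hidx :: "hexp \<Rightarrow> hexp \<Rightarrow> hexp" where
  "hidx r c \<equiv> HAdd (HMul r (hsc 1)) c"
abbreviation hcol :: "hexp \<Rightarrow> hexp \<Rightarrow> hexp \<Rightarrow> hexp \<Rightarrow> hexp" where
  "hcol p l i y \<equiv> HSel (HAnd (HEq i p) (HLt l y)) (hsc 2) i"
abbreviation hhr :: "hexp \<Rightarrow> hexp \<Rightarrow> hexp \<Rightarrow> hexp" where
  "hhr u a b \<equiv> HLt (hfld 3 u b) (hfld 14 u (hidx (hfld 6 u a)
     (hcol (hfld 7 u a) (hfld 8 u a) (hfld 2 u b) (HAdd (hfld 3 u b) (HN 1)))))"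
abbreviation hpair :: "hexp \<Rightarrow> hexp \<Rightarrow> hexp \<Rightarrow> hexp" where
  "hpair u a b \<equiv> HAnd (hin (hfld 1 u b) (hfld 4 u a) (hfld 5 u a))
     (HAnd (hin (hfld 1 u a) (hfld 4 u b) (hfld 5 u b)) (HAnd (HNot (hhr u a b)) (HNot (hhr u b a))))"
abbreviation hdbl :: "hexp \<Rightarrow> hexp \<Rightarrow> hexp" where
  "hdbl a b \<equiv> HAnd (HRd (HN 5) a) (HAnd (HRd (HN 5) b) (HAnd
     (HNot (HLt (hfld 13 (HN 0) (hidx (hfld 1 (HN 0) b) (hfld 2 (HN 0) a))) (hfld 3 (HN 0) a)))
     (HNot (HLt (hfld 13 (HN 0) (hidx (hfld 1 (HN 0) a) (hfld 2 (HN 0) b))) (hfld 3 (HN 0) b)))))"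

abbreviation asg :: "nat \<Rightarrow> hexp \<Rightarrow> stmt" where "asg r e \<equiv> Assign r (lower e)"

definition find_slot :: "nat \<Rightarrow> nat \<Rightarrow> stmt list" where
  "find_slot r x = [
     asg r (HDiv (HMod (HMul (hsc 5) (HR x)) (hsc 4)) (hsc 3)),
     asg r (HAdd (HRd (HN 1) (HR r))
       (HDiv (HMod (HMul (HRd (HN 2) (HR r)) (HR x)) (HRd (HN 3) (HR r))) (hsc 3))),
     asg r (HMul (HEq (HRd (HN 4) (HR r)) (HR x)) (HAdd (HR r) (HN 1)))]"

definition flags :: "stmt list" where
  "flags = [asg 6 (hdbl (HR 4) (HR 5)), asg 7 (HRd (HN 5) (HR 4)), asg 8 (HRd (HN 5) (HR 5)),
     asg 9 (hpair (HN 0) (HR 4) (HR 5)), asg 10 (hpair (HN 1) (HR 4) (HR 5))]"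

definition prefix :: "stmt list" where
  "prefix = [asg 2 (hsc 6)] @ find_slot 4 0 @ find_slot 5 1 @ flags"

definition size_coms :: "com list" where
  "size_coms = [Block (prefix @
     [Out (lower (HSel (HR 6) (hsc 9)
       (HSel (HOr (HOr (HR 7) (HR 8)) (HOr (HR 9) (HR 10))) (hsc 8) (hsc 2))))])]"

definition setup_cut :: "stmt list" where
  "setup_cut = [
     asg 11 (HNot (HOr (HR 7) (HR 8))),
     asg 12 (HAnd (HR 11) (HOr (HR 9) (HR 10))),
     asg 13 (HAnd (HR 11) (HAnd (HNot (HR 9)) (HR 10))),
     asg 14 (HAnd (HR 11) (HNot (HOr (HR 9) (HR 10)))),
     asg 15 (HSel (HR 14) (HAdd (hsc 2) (HN 1)) (hfld 2 (HR 13) (HR 4))),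
     asg 16 (HSel (HR 14) (HN 1) (HSel (HOr (HR 7) (HR 12)) (hfld 3 (HR 13) (HR 4)) (HN 0))),
     asg 17 (hfld 2 (HR 13) (HR 5)),
     asg 18 (HSel (HOr (HR 6) (HOr (HAnd (HR 8) (HNot (HR 7))) (HR 12))) (hfld 3 (HR 13) (HR 5)) (HN 0)),
     asg 19 (HSel (HR 12) (HSel (HLt (hfld 4 (HR 13) (HR 4)) (hfld 4 (HR 13) (HR 5)))
       (hfld 4 (HR 13) (HR 5)) (hfld 4 (HR 13) (HR 4))) (HN 0)),
     asg 20 (HSel (HR 12) (HSel (HLt (hfld 5 (HR 13) (HR 4)) (hfld 5 (HR 13) (HR 5)))
       (hfld 5 (HR 13) (HR 4)) (hfld 5 (HR 13) (HR 5))) (HN 0)),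
     asg 21 (hfld 0 (HR 13) (HR 4)),
     asg 22 (hfld 0 (HR 13) (HR 5)),
     asg 23 (hsc 0),
     asg 24 (hsc 7)]"

abbreviation hst :: "nat \<Rightarrow> nat \<Rightarrow> nat \<Rightarrow> nat \<Rightarrow> hexp" where
  "hst p i j k \<equiv> HAnd (HNot (HEq (HR 3) (HR 19)))
     (HSel (hin (HR p) (HR 27) (HR 28))
       (HLt (hfld 15 (HR 13) (hidx (HR 3) (hcol (hfld 11 (HR 13) (HR 3)) (hfld 12 (HR 13) (HR 3)) (HR i) (HR j)))) (HR j))
       (HLd (HAdd (HR 24) (HAdd (HMul (HN 2) (HR 27)) (HN k)))))"

definition body1 :: "stmt list" where
  "body1 = [
     asg 27 (hfld 9 (HR 13) (HR 3)),
     asg 28 (hfld 10 (HR 13) (HR 3)),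
     asg 29 (hst 21 15 16 0),
     asg 30 (hst 22 17 18 1),
     Put (lower (HAdd (HR 24) (HAdd (HMul (HN 2) (HR 3)) (HN 0)))) (lower (HR 29)),
     Put (lower (HAdd (HR 24) (HAdd (HMul (HN 2) (HR 3)) (HN 1)))) (lower (HR 30))]"

definition body2 :: "stmt list" where
  "body2 = [
     asg 27 (hfld 16 (HR 13) (HR 3)),
     asg 28 (HSel (hin (HR 27) (HR 19) (HR 20))
       (HOr (HLd (HAdd (HR 24) (HAdd (HMul (HN 2) (HR 27)) (HN 0))))
         (HLd (HAdd (HR 24) (HAdd (HMul (HN 2) (HR 27)) (HN 1)))))
       (HOr (HLt (hfld 13 (HR 13) (hidx (HR 27) (HR 15))) (HR 16))
         (HLt (hfld 13 (HR 13) (hidx (HR 27) (HR 17))) (HR 18)))),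
     Out (lower (HXor (HR 28) (HR 13)))]"

definition cut_coms :: "com list" where
  "cut_coms = [Block (prefix @ setup_cut), Loop 3 23 body1, Loop 3 23 body2]"

section \<open>Execution of the queries without overflow\<close>

locale query_arrays =
  fixes w Z X n m :: nat and A :: arrays
  assumes w_pos: "0 < w" and X_big: "100 * (X * X) \<le> 2 ^ (w - 1)"
    and A_less: "A a i < X"
    and Z_ge: "10 \<le> Z" and n_pos: "1 \<le> n" and n_Z: "n \<le> Z" and m_X: "m \<le> X"
    and scal_n: "scal A 0 = n" and scal_W: "scal A 1 = scal A 2 + 2"
    and scal_w: "scal A 6 = w - 1" and scal_B: "scal A 7 = 40 * Z"
    and bucket_Z: "x < m \<Longrightarrow> scal A 5 * x mod scal A 4 div scal A 3 < Z"
    and cell_Z: "x < m \<Longrightarrow> Suc (cell A x) < Z"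
    and flag_le: "A 5 i \<le> 1"
    and PA_n: "u < 2 \<Longrightarrow> PA A u i < n" and PB_n: "u < 2 \<Longrightarrow> PB A u i < n"
    and IP_W: "u < 2 \<Longrightarrow> IP A u i < scal A 1"
    and ROW_Z: "u < 2 \<Longrightarrow> c < scal A 1 \<Longrightarrow> ROW A u i * scal A 1 + c < Z"
    and n_W_Z: "q < n \<Longrightarrow> c < scal A 1 \<Longrightarrow> q * scal A 1 + c < Z"
    and LLO_or: "u < 2 \<Longrightarrow> q < n \<Longrightarrow> LLO A u q < q \<or> (LLO A u q = 0 \<and> LHI A u q = n)"
    and PRE_n: "u < 2 \<Longrightarrow> v < n \<Longrightarrow> PRE A u v < n"
begin

definition D :: "nat list" where
  "D = map (\<lambda>p. A (p mod 40) (p div 40)) [0..<40 * Z]"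

lemma X_pos: "0 < X" using A_less[of 0 0] by linarith

lemma Z_X: "40 * Z < X" using A_less[of 0 7] scal_B by simp

lemma half: "x < X \<Longrightarrow> x < 2 ^ (w - 1)" "100 * X \<le> 2 ^ (w - 1)"
proof -
  have "100 * X \<le> 100 * (X * X)" using X_pos by simp
  then show "100 * X \<le> 2 ^ (w - 1)" using X_big by linarith
  then show "x < X \<Longrightarrow> x < 2 ^ (w - 1)" by linarith
qed

lemma full: "(2::nat) ^ (w - 1) < 2 ^ w" using w_pos by simp

lemma full': "x \<le> 2 ^ (w - 1) \<Longrightarrow> x < (2::nat) ^ w" using full by linarith

lemma fullX: "x < X \<Longrightarrow> x < 2 ^ w" by (rule less_trans[OF half(1) full])

lemma mul_less: "x < X \<Longrightarrow> y < X \<Longrightarrow> x * y < 2 ^ w"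
proof -
  assume "x < X" "y < X"
  then have "x * y \<le> X * X" by (intro mult_le_mono) auto
  then show ?thesis using X_big by (intro full') linarith
qed

lemma fld_less: "fld j A u i < X" by (simp add: fld_def A_less)

definition good_mem :: "(nat \<Rightarrow> nat) \<Rightarrow> bool" where
  "good_mem M \<longleftrightarrow> (\<forall>i. M i < 2 ^ w) \<and> (\<forall>a<40. \<forall>i<Z. M (40 * i + a) = A a i)"

text \<open>Value and absence of overflow are bundled, so that each step of a program is verified by
  syntax-directed rules.\<close>

definition den :: "(nat \<Rightarrow> nat) \<Rightarrow> (nat \<Rightarrow> nat) \<Rightarrow> hexp \<Rightarrow> nat \<Rightarrow> bool" where
  "den \<rho> M e x \<longleftrightarrow> \<rho> 2 = w - 1 \<and> hok w Z A \<rho> M e \<and> hv A \<rho> M e = x"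

lemma ev_den: "good_mem M \<Longrightarrow> den \<rho> M e x \<Longrightarrow> ev w \<rho> M (lower e) = x"
  using ev_lower[OF w_pos, of Z M A \<rho> e] fullX[OF Z_X] by (auto simp: den_def good_mem_def)

lemma run_asg: "good_mem M \<Longrightarrow> den \<rho> M e x \<Longrightarrow> run w (asg r e) (\<rho>, M, os) = (\<rho>(r := x), M, os)"
  by (simp add: ev_den)

lemma den_N: "\<rho> 2 = w - 1 \<Longrightarrow> a < 100 \<Longrightarrow> den \<rho> M (HN a) a"
  using half(2) X_pos by (auto simp: den_def intro!: full')
lemma den_R: "\<rho> 2 = w - 1 \<Longrightarrow> \<rho> r = x \<Longrightarrow> den \<rho> M (HR r) x"
  by (simp add: den_def)
lemma den_Rd: "den \<rho> M i y \<Longrightarrow> a < 40 \<Longrightarrow> y < Z \<Longrightarrow> den \<rho> M (HRd (HN a) i) (A a y)"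
  using den_N[of \<rho> a M] by (auto simp: den_def)
lemma den_sc: "\<rho> 2 = w - 1 \<Longrightarrow> j < 10 \<Longrightarrow> den \<rho> M (hsc j) (scal A j)"
  using Z_ge by (auto intro!: den_Rd den_N)
lemma den_flag: "den \<rho> M i y \<Longrightarrow> y < Z \<Longrightarrow> den \<rho> M (HRd (HN 5) i) (of_bool (A 5 y \<noteq> 0))"
  using den_Rd[of \<rho> M i y 5] bit_cases[OF flag_le[of y]] by simp
lemma den_fld: "j < 17 \<Longrightarrow> den \<rho> M u x \<Longrightarrow> den \<rho> M i y \<Longrightarrow> x < 2 \<Longrightarrow> y < Z \<Longrightarrow>
    den \<rho> M (hfld j u i) (fld j A x y)"
  using den_N[of \<rho> "6 + 2 * j" M] den_N[of \<rho> "6 + 2 * j + x" M]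
  by (auto simp: den_def hfld_def fld_def)
lemma den_Add: "den \<rho> M a x \<Longrightarrow> den \<rho> M b y \<Longrightarrow> x + y < 2 ^ w \<Longrightarrow> den \<rho> M (HAdd a b) (x + y)"
  and den_Mul: "den \<rho> M a x \<Longrightarrow> den \<rho> M b y \<Longrightarrow> x * y < 2 ^ w \<Longrightarrow> den \<rho> M (HMul a b) (x * y)"
  and den_Div: "den \<rho> M a x \<Longrightarrow> den \<rho> M b y \<Longrightarrow> x < 2 ^ w \<Longrightarrow> den \<rho> M (HDiv a b) (x div y)"
  and den_Mod: "den \<rho> M a x \<Longrightarrow> den \<rho> M b y \<Longrightarrow> x < 2 ^ w \<Longrightarrow> den \<rho> M (HMod a b) (x mod y)"
  by (simp_all add: den_def)
lemma den_Lt: "den \<rho> M a x \<Longrightarrow> den \<rho> M b y \<Longrightarrow> x < 2 ^ (w - 1) \<Longrightarrow> y < 2 ^ (w - 1) \<Longrightarrow>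
    den \<rho> M (HLt a b) (of_bool (x < y))"
  and den_Eq: "den \<rho> M a x \<Longrightarrow> den \<rho> M b y \<Longrightarrow> x < 2 ^ (w - 1) \<Longrightarrow> y < 2 ^ (w - 1) \<Longrightarrow>
    den \<rho> M (HEq a b) (of_bool (x = y))"
  by (simp_all add: den_def)
lemma den_And: "den \<rho> M a (of_bool p) \<Longrightarrow> den \<rho> M b (of_bool q) \<Longrightarrow> den \<rho> M (HAnd a b) (of_bool (p \<and> q))"
  and den_Or: "den \<rho> M a (of_bool p) \<Longrightarrow> den \<rho> M b (of_bool q) \<Longrightarrow> den \<rho> M (HOr a b) (of_bool (p \<or> q))"
  and den_Xor: "den \<rho> M a (of_bool p) \<Longrightarrow> den \<rho> M b (of_bool q) \<Longrightarrow> den \<rho> M (HXor a b) (of_bool (p \<noteq> q))"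
  and den_Not: "den \<rho> M a (of_bool p) \<Longrightarrow> den \<rho> M (HNot a) (of_bool (\<not> p))"
  by (auto simp: den_def)
lemma den_Sel: "den \<rho> M c (of_bool p) \<Longrightarrow> den \<rho> M a x \<Longrightarrow> den \<rho> M b y \<Longrightarrow> x < 2 ^ w \<Longrightarrow> y < 2 ^ w \<Longrightarrow>
    den \<rho> M (HSel c a b) (if p then x else y)"
  by (auto simp: den_def)
lemma den_Ld: "den \<rho> M a x \<Longrightarrow> den \<rho> M (HLd a) (M x)"
  by (simp add: den_def)

lemma den_in: "den \<rho> M a x \<Longrightarrow> den \<rho> M l y \<Longrightarrow> den \<rho> M h z \<Longrightarrow> x < X \<Longrightarrow> y < X \<Longrightarrow> z < X \<Longrightarrow>
    den \<rho> M (hin a l h) (of_bool (y \<le> x \<and> x < z))"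
  using den_And[OF den_Not[OF den_Lt[of \<rho> M a x l y]] den_Lt[of \<rho> M a x h z]] half(1)
  by (simp add: not_less)

lemma colf_less: "i < scal A 1 \<Longrightarrow> colf A p l i y < scal A 1"
  using scal_W by (auto simp: colf_def)

lemma den_col: "den \<rho> M p x1 \<Longrightarrow> den \<rho> M l x2 \<Longrightarrow> den \<rho> M i x3 \<Longrightarrow> den \<rho> M y x4 \<Longrightarrow>
    x1 < X \<Longrightarrow> x2 < X \<Longrightarrow> x3 < X \<Longrightarrow> x4 \<le> X \<Longrightarrow> den \<rho> M (hcol p l i y) (colf A x1 x2 x3 x4)"
  unfolding colf_def using half
  by (intro den_Sel den_And den_Eq den_Lt den_sc) (auto simp: den_def A_less intro: fullX)

lemma den_idx: "den \<rho> M a x \<Longrightarrow> den \<rho> M c y \<Longrightarrow> x * scal A 1 + y < Z \<Longrightarrow>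
    den \<rho> M (hidx a c) (x * scal A 1 + y)"
  using Z_X fullX by (intro den_Add den_Mul den_sc) (auto simp: den_def)

lemma den_hr:
  assumes "den \<rho> M u x" "den \<rho> M a y" "den \<rho> M b z" "x < 2" "y < Z" "z < Z"
  shows "den \<rho> M (hhr u a b) (of_bool (hrf A x y z))"
proof -
  have r: "\<rho> 2 = w - 1" using assms(1) by (simp add: den_def)
  have "colf A (GP A x y) (GL A x y) (IP A x z) (JJ A x z + 1) < scal A 1"
    using colf_less IP_W assms(4) by blast
  then have "ROW A x y * scal A 1 + colf A (GP A x y) (GL A x y) (IP A x z) (JJ A x z + 1) < Z"
    by (rule ROW_Z[OF assms(4)])
  moreover have "JJ A x z + 1 \<le> X" using fld_less[of 3 x z] by simp
  ultimately show ?thesis unfolding hrf_def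
    by (intro den_Lt den_fld den_idx den_col den_Add den_N assms half(1) fld_less r)
      (use half(2) X_pos in \<open>auto intro: full'\<close>)
qed

lemma den_pair:
  assumes "den \<rho> M u x" "den \<rho> M a y" "den \<rho> M b z" "x < 2" "y < Z" "z < Z"
  shows "den \<rho> M (hpair u a b) (of_bool (pairf A x y z))"
  unfolding pairf_def
  by (intro den_And[where p = "_ \<le> _ \<and> _ < _"] den_And den_in den_Not den_hr den_fld assms fld_less) simp_all

lemma den_dbl:
  assumes "den \<rho> M a y" "den \<rho> M b z" "y < Z" "z < Z"
  shows "den \<rho> M (hdbl a b) (of_bool (dblf A y z))"
proof -
  have r: "\<rho> 2 = w - 1" using assms(1) by (simp add: den_def)
  have *: "PB A 0 i * scal A 1 + IP A 0 i' < Z" for i i'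
    by (rule n_W_Z[OF PB_n IP_W]) simp_all
  show ?thesis unfolding dblf_def
    by (intro den_And den_flag den_Not den_Lt den_fld den_idx den_N assms half(1) fld_less r * ) simp_all
qed

lemma run_find_slot:
  assumes M: "good_mem M" and r: "\<rho> 2 = w - 1" "\<rho> x = e" "e < m" "x \<noteq> r" "r \<noteq> 2"
  shows "fold (run w) (find_slot r x) (\<rho>, M, os) = (\<rho>(r := slot A e), M, os)"
proof -
  define b where "b = scal A 5 * e mod scal A 4 div scal A 3"
  have eX: "e < X" using r(3) m_X by simp
  have bZ: "b < Z" using bucket_Z[OF r(3)] by (simp add: b_def)
  have c: "cell A e = A 1 b + A 2 b * e mod A 3 b div scal A 3" by (simp only: cell_def b_def Let_def)
  have cX: "Suc (cell A e) < Z" by (rule cell_Z[OF r(3)])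
  have m1: "scal A 5 * e < 2 ^ w" "A 2 b * e < 2 ^ w" using mul_less A_less eX by auto
  have m2: "scal A 5 * e mod scal A 4 < 2 ^ w" "A 2 b * e mod A 3 b < 2 ^ w"
    using m1 by (auto intro: le_less_trans[OF mod_less_eq_dividend])
  have m3: "A 1 b + A 2 b * e mod A 3 b div scal A 3 < 2 ^ w"
    using cX[unfolded c] Z_X by (intro fullX) linarith
  have 1: "den \<rho> M (HDiv (HMod (HMul (hsc 5) (HR x)) (hsc 4)) (hsc 3)) b"
    unfolding b_def
    by (intro den_Div den_Mod den_Mul den_sc den_R r m1 m2) simp_all
  let ?\<rho>1 = "\<rho>(r := b)"
  have r1: "?\<rho>1 2 = w - 1" "?\<rho>1 x = e" "?\<rho>1 r = b" using r by auto
  have 2: "den ?\<rho>1 M (HAdd (HRd (HN 1) (HR r))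
       (HDiv (HMod (HMul (HRd (HN 2) (HR r)) (HR x)) (HRd (HN 3) (HR r))) (hsc 3))) (cell A e)"
    unfolding c
    by (intro den_Add den_Div den_Mod den_Mul den_Rd den_sc den_R r1 m1 m2 m3 bZ) simp_all
  let ?\<rho>2 = "\<rho>(r := cell A e)"
  have r2: "?\<rho>2 2 = w - 1" "?\<rho>2 x = e" "?\<rho>2 r = cell A e" using r by auto
  have s: "slot A e = of_bool (A 4 (cell A e) = e) * (cell A e + 1)" by (simp add: slot_def)
  have 3: "den ?\<rho>2 M (HMul (HEq (HRd (HN 4) (HR r)) (HR x)) (HAdd (HR r) (HN 1))) (slot A e)"
    unfolding s
    by (intro den_Mul den_Eq den_Rd den_Add den_N den_R r2 half(1) A_less eX)
      (use cX Z_X fullX in auto)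
  show ?thesis
    by (simp only: find_slot_def fold_Cons fold_Nil comp_apply id_apply fun_upd_upd
        run_asg[OF M 1] run_asg[OF M 2] run_asg[OF M 3])
qed

lemma slot_Z: "e < m \<Longrightarrow> slot A e < Z"
  using cell_Z[of e] by (auto simp: slot_def)

definition flags_set :: "nat \<Rightarrow> nat \<Rightarrow> (nat \<Rightarrow> nat) \<Rightarrow> bool" where
  "flags_set a b \<rho> \<longleftrightarrow> \<rho> 2 = w - 1 \<and> \<rho> 4 = a \<and> \<rho> 5 = b \<and> \<rho> 6 = of_bool (dblf A a b) \<and>
     \<rho> 7 = of_bool (A 5 a \<noteq> 0) \<and> \<rho> 8 = of_bool (A 5 b \<noteq> 0) \<and>
     \<rho> 9 = of_bool (pairf A 0 a b) \<and> \<rho> 10 = of_bool (pairf A 1 a b)"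

lemma run_prefix:
  assumes M: "good_mem M" and e: "e1 < m" "e2 < m"
  shows "\<exists>\<rho>. fold (run w) prefix (init_regs [e1, e2], M, os) = (\<rho>, M, os) \<and>
    flags_set (slot A e1) (slot A e2) \<rho>"
proof -
  define a where "a = slot A e1"
  define b where "b = slot A e2"
  have Z: "a < Z" "b < Z" using slot_Z e by (auto simp: a_def b_def)
  let ?r0 = "init_regs [e1, e2]"
  have h: "ev w ?r0 M (lower (hsc 6)) = w - 1"
  proof -
    have "hok w Z A ?r0 M (hsc 6)" using Z_ge fullX[OF Z_X] by simp
    then show ?thesis using ev_lower[OF w_pos, of Z M A ?r0 "hsc 6"] M fullX[OF Z_X] scal_w
      by (auto simp: good_mem_def)
  qed
  let ?r1 = "?r0(2 := w - 1)"
  have h': "run w (asg 2 (hsc 6)) (?r0, M, os) = (?r1, M, os)" using h by simp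
  let ?r2 = "?r1(4 := a)"
  let ?r3 = "?r2(5 := b)"
  let ?r4 = "?r3(6 := of_bool (dblf A a b))"
  let ?r5 = "?r4(7 := of_bool (A 5 a \<noteq> 0))"
  let ?r6 = "?r5(8 := of_bool (A 5 b \<noteq> 0))"
  let ?r7 = "?r6(9 := of_bool (pairf A 0 a b))"
  let ?r8 = "?r7(10 := of_bool (pairf A 1 a b))"
  have 1: "fold (run w) (find_slot 4 0) (?r1, M, os) = (?r2, M, os)"
    unfolding a_def by (rule run_find_slot[OF M]) (use e in \<open>auto simp: init_regs_def\<close>)
  have 2: "fold (run w) (find_slot 5 1) (?r2, M, os) = (?r3, M, os)"
    unfolding b_def by (rule run_find_slot[OF M]) (use e in \<open>auto simp: init_regs_def\<close>)
  have 3: "den ?r3 M (hdbl (HR 4) (HR 5)) (of_bool (dblf A a b))"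
    by (intro den_dbl den_R Z) simp_all
  have 4: "den ?r4 M (HRd (HN 5) (HR 4)) (of_bool (A 5 a \<noteq> 0))"
    by (intro den_flag den_R Z) simp_all
  have 5: "den ?r5 M (HRd (HN 5) (HR 5)) (of_bool (A 5 b \<noteq> 0))"
    by (intro den_flag den_R Z) simp_all
  have 6: "den ?r6 M (hpair (HN 0) (HR 4) (HR 5)) (of_bool (pairf A 0 a b))"
    by (intro den_pair den_R den_N Z) simp_all
  have 7: "den ?r7 M (hpair (HN 1) (HR 4) (HR 5)) (of_bool (pairf A 1 a b))"
    by (intro den_pair den_R den_N Z) simp_all
  have "fold (run w) prefix (?r0, M, os) = (?r8, M, os)"
    by (simp only: prefix_def flags_def fold_append fold_Cons fold_Nil comp_apply id_apply h' 1 2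
        run_asg[OF M 3] run_asg[OF M 4] run_asg[OF M 5] run_asg[OF M 6] run_asg[OF M 7])
  moreover have "flags_set a b ?r8" by (simp add: flags_set_def)
  ultimately show ?thesis unfolding a_def b_def by blast
qed

lemma stored_D: "stored D M \<longleftrightarrow> (\<forall>a<40. \<forall>i<Z. M (40 * i + a) = A a i)"
proof
  assume "stored D M"
  then have s: "M p = A (p mod 40) (p div 40)" if "p < 40 * Z" for p
    using that by (simp add: stored_def D_def)
  show "\<forall>a<40. \<forall>i<Z. M (40 * i + a) = A a i"
  proof (intro allI impI)
    fix a i :: nat assume "a < 40" "i < Z"
    then show "M (40 * i + a) = A a i" using s[of "40 * i + a"] by simp
  qed
next
  assume s: "\<forall>a<40. \<forall>i<Z. M (40 * i + a) = A a i"
  have "M p = A (p mod 40) (p div 40)" if "p < 40 * Z" for p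
  proof -
    have "p div 40 < Z" using that by (simp add: div_less_iff_less_mult mult.commute)
    then show ?thesis using s[rule_format, of "p mod 40" "p div 40"] by simp
  qed
  then show "stored D M" by (simp add: stored_def D_def)
qed

lemma good_mem_iff: "good_mem M \<longleftrightarrow> (\<forall>i. M i < 2 ^ w) \<and> stored D M"
  by (simp add: good_mem_def stored_D)

lemma args_less: "e1 < m \<Longrightarrow> e2 < m \<Longrightarrow> \<forall>x\<in>set [e1, e2]. x < 2 ^ w"
  using m_X fullX by simp

lemma below_prefix: "list_all (below_stmt 40) prefix"
  by (simp add: prefix_def find_slot_def flags_def hfld_def)

lemma below_setup: "list_all (below_stmt 40) setup_cut"
  by (simp add: setup_cut_def hfld_def)

lemma below_body: "list_all (below_stmt 40) body1" "list_all (below_stmt 40) body2"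
  by (simp_all add: body1_def body2_def hfld_def)

lemma keeps_body: "list_all (keeps 3) body1" "list_all (keeps 23) body1"
  "list_all (keeps 3) body2" "list_all (keeps 23) body2"
  by (simp_all add: body1_def body2_def)

lemma size_query:
  assumes e: "e1 < m" "e2 < m" and T: "length (comp_prog 40 0 size_coms) \<le> T"
  shows "query w (comp_prog 40 0 size_coms) D [e1, e2] T
    (\<lambda>xs. xs = [sizef A (slot A e1) (slot A e2)])"
proof (rule query_comp_prog[OF args_less[OF e]])
  let ?o = "Out (lower (HSel (HR 6) (hsc 9)
       (HSel (HOr (HOr (HR 7) (HR 8)) (HOr (HR 9) (HR 10))) (hsc 8) (hsc 2))))"
  show "list_all (below_com 40) size_coms"
    using below_prefix by (simp add: size_coms_def)
  fix M assume "\<forall>i. M i < 2 ^ w" "stored D M"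
  then have M: "good_mem M" by (simp add: good_mem_iff)
  define a where "a = slot A e1"
  define b where "b = slot A e2"
  obtain \<rho> where \<rho>: "fold (run w) prefix (init_regs [e1, e2], M, []) = (\<rho>, M, [])" "flags_set a b \<rho>"
    using run_prefix[OF M e, of "[]"] by (auto simp: a_def b_def)
  note f = \<rho>(2)[unfolded flags_set_def]
  have "den \<rho> M (HSel (HR 6) (hsc 9)
       (HSel (HOr (HOr (HR 7) (HR 8)) (HOr (HR 9) (HR 10))) (hsc 8) (hsc 2)))
     (if dblf A a b then scal A 9 else if (A 5 a \<noteq> 0 \<or> A 5 b \<noteq> 0) \<or> pairf A 0 a b \<or> pairf A 1 a b
       then scal A 8 else scal A 2)"
    by (intro den_Sel den_Or den_sc den_R) (use f fullX A_less in auto)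
  moreover have "(if dblf A a b then scal A 9 else if (A 5 a \<noteq> 0 \<or> A 5 b \<noteq> 0) \<or> pairf A 0 a b \<or> pairf A 1 a b
       then scal A 8 else scal A 2) = sizef A a b"
    by (auto simp: sizef_def)
  ultimately have 1: "run w ?o (\<rho>, M, []) = (\<rho>, M, [sizef A a b])"
    using ev_den[OF M] by (simp del: lower.simps)
  have "fold (run_com w) size_coms (init_regs [e1, e2], M, []) = (\<rho>, M, [sizef A a b])"
    using \<rho>(1) 1 by (simp add: size_coms_def del: run.simps)
  moreover have "costs w 40 size_coms (init_regs [e1, e2], M, []) \<le> T"
    using T by (simp add: size_coms_def)
  moreover have "readys w size_coms (init_regs [e1, e2], M, [])"
    by (simp add: size_coms_def)
  ultimately show "readys w size_coms (init_regs [e1, e2], M, []) \<and>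
      costs w 40 size_coms (init_regs [e1, e2], M, []) \<le> T \<and>
      (\<exists>\<rho> M' os. fold (run_com w) size_coms (init_regs [e1, e2], M, []) = (\<rho>, M', os) \<and>
        os = [sizef A (slot A e1) (slot A e2)] \<and> stored D M')"
    using \<open>stored D M\<close> by (simp add: a_def b_def)
qed

definition cut_regs :: "nat \<Rightarrow> nat \<Rightarrow> (nat \<Rightarrow> nat) \<Rightarrow> bool" where
  "cut_regs a b \<rho> \<longleftrightarrow> \<rho> 2 = w - 1 \<and> \<rho> 13 = side A a b \<and> \<rho> 15 = i1f A a b \<and> \<rho> 16 = j1f A a b \<and>
     \<rho> 17 = IP A (side A a b) b \<and> \<rho> 18 = j2f A a b \<and> \<rho> 19 = lof A a b \<and> \<rho> 20 = hif A a b \<and>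
     \<rho> 21 = PA A (side A a b) a \<and> \<rho> 22 = PA A (side A a b) b \<and> \<rho> 23 = n \<and> \<rho> 24 = 40 * Z"

lemma side_less: "side A a b < 2" by (simp add: side_def)

lemma one_X: "1 < X" using Z_X Z_ge by linarith

lemma scal_2_less: "scal A 2 + 1 < X" using scal_W A_less[of 0 1] by simp

lemma run_setup:
  assumes M: "good_mem M" and f: "flags_set a b \<rho>" and Z: "a < Z" "b < Z"
  shows "\<exists>\<rho>'. fold (run w) setup_cut (\<rho>, M, os) = (\<rho>', M, os) \<and> cut_regs a b \<rho>'"
proof -
  note f = f[unfolded flags_set_def]
  let ?u = "side A a b"
  let ?any = "A 5 a \<noteq> 0 \<or> A 5 b \<noteq> 0"
  let ?r1 = "\<rho>(11 := of_bool (\<not> ?any))"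
  let ?r2 = "?r1(12 := of_bool (actf A a b))"
  let ?r3 = "?r2(13 := ?u)"
  let ?r4 = "?r3(14 := of_bool (deff A a b))"
  let ?r5 = "?r4(15 := i1f A a b)"
  let ?r6 = "?r5(16 := j1f A a b)"
  let ?r7 = "?r6(17 := IP A ?u b)"
  let ?r8 = "?r7(18 := j2f A a b)"
  let ?r9 = "?r8(19 := lof A a b)"
  let ?r10 = "?r9(20 := hif A a b)"
  let ?r11 = "?r10(21 := PA A ?u a)"
  let ?r12 = "?r11(22 := PA A ?u b)"
  let ?r13 = "?r12(23 := n)"
  let ?r14 = "?r13(24 := 40 * Z)"
  have X0: "0 < (2::nat) ^ w" "1 < (2::nat) ^ w" using fullX[OF one_X] by simp_all
  have ff: "fld j A u i < 2 ^ w" for j u i by (rule fullX[OF fld_less])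
  have s2: "scal A 2 + 1 < 2 ^ w" by (rule fullX[OF scal_2_less])
  have 1: "den \<rho> M (HNot (HOr (HR 7) (HR 8))) (of_bool (\<not> ?any))"
    by (intro den_Not den_Or den_R) (use f in auto)
  have "den ?r1 M (HAnd (HR 11) (HOr (HR 9) (HR 10))) (of_bool (\<not> ?any \<and> (pairf A 0 a b \<or> pairf A 1 a b)))"
    by (intro den_And den_Or den_R) (use f in auto)
  moreover have "(\<not> ?any \<and> (pairf A 0 a b \<or> pairf A 1 a b)) = actf A a b" by (simp add: actf_def)
  ultimately have 2: "den ?r1 M (HAnd (HR 11) (HOr (HR 9) (HR 10))) (of_bool (actf A a b))" by simp
  have "den ?r2 M (HAnd (HR 11) (HAnd (HNot (HR 9)) (HR 10)))
      (of_bool (\<not> ?any \<and> \<not> pairf A 0 a b \<and> pairf A 1 a b))"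
    by (intro den_And den_Not den_R) (use f in auto)
  moreover have "of_bool (\<not> ?any \<and> \<not> pairf A 0 a b \<and> pairf A 1 a b) = ?u" by (auto simp: side_def)
  ultimately have 3: "den ?r2 M (HAnd (HR 11) (HAnd (HNot (HR 9)) (HR 10))) ?u" by simp
  have "den ?r3 M (HAnd (HR 11) (HNot (HOr (HR 9) (HR 10))))
      (of_bool (\<not> ?any \<and> \<not> (pairf A 0 a b \<or> pairf A 1 a b)))"
    by (intro den_And den_Or den_Not den_R) (use f in auto)
  moreover have "(\<not> ?any \<and> \<not> (pairf A 0 a b \<or> pairf A 1 a b)) = deff A a b" by (auto simp: deff_def)
  ultimately have 4: "den ?r3 M (HAnd (HR 11) (HNot (HOr (HR 9) (HR 10)))) (of_bool (deff A a b))" by simp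
  have 5: "den ?r4 M (HSel (HR 14) (HAdd (hsc 2) (HN 1)) (hfld 2 (HR 13) (HR 4))) (i1f A a b)"
    unfolding i1f_def by (intro den_Sel den_Add den_sc den_N den_fld den_R side_less Z ff s2) (use f in auto)
  have 6: "den ?r5 M (HSel (HR 14) (HN 1) (HSel (HOr (HR 7) (HR 12)) (hfld 3 (HR 13) (HR 4)) (HN 0))) (j1f A a b)"
    unfolding j1f_def by (intro den_Sel den_Or den_N den_fld den_R side_less Z ff X0) (use f X0 ff in auto)
  have 7: "den ?r6 M (hfld 2 (HR 13) (HR 5)) (IP A ?u b)"
    by (intro den_fld den_R side_less Z) (use f in auto)
  have 8: "den ?r7 M (HSel (HOr (HR 6) (HOr (HAnd (HR 8) (HNot (HR 7))) (HR 12))) (hfld 3 (HR 13) (HR 5)) (HN 0))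
      (if dblf A a b \<or> (A 5 b \<noteq> 0 \<and> \<not> A 5 a \<noteq> 0) \<or> actf A a b then JJ A ?u b else 0)"
    by (intro den_Sel den_Or den_And den_Not den_N den_fld den_R side_less Z ff X0) (use f in auto)
  have 8: "den ?r7 M (HSel (HOr (HR 6) (HOr (HAnd (HR 8) (HNot (HR 7))) (HR 12))) (hfld 3 (HR 13) (HR 5)) (HN 0))
      (j2f A a b)" using 8 by (simp add: j2f_def)
  have "den ?r8 M (HSel (HR 12) (HSel (HLt (hfld 4 (HR 13) (HR 4)) (hfld 4 (HR 13) (HR 5)))
       (hfld 4 (HR 13) (HR 5)) (hfld 4 (HR 13) (HR 4))) (HN 0))
      (if actf A a b then if LO A ?u a < LO A ?u b then LO A ?u b else LO A ?u a else 0)"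
    by (intro den_Sel den_Lt den_N den_fld den_R side_less Z ff half(1) fld_less X0) (use f X0 ff in auto)
  moreover have "(if actf A a b then if LO A ?u a < LO A ?u b then LO A ?u b else LO A ?u a else 0) = lof A a b"
    by (auto simp: lof_def max_def)
  ultimately have 9: "den ?r8 M (HSel (HR 12) (HSel (HLt (hfld 4 (HR 13) (HR 4)) (hfld 4 (HR 13) (HR 5)))
       (hfld 4 (HR 13) (HR 5)) (hfld 4 (HR 13) (HR 4))) (HN 0)) (lof A a b)" by simp
  have "den ?r9 M (HSel (HR 12) (HSel (HLt (hfld 5 (HR 13) (HR 4)) (hfld 5 (HR 13) (HR 5)))
       (hfld 5 (HR 13) (HR 4)) (hfld 5 (HR 13) (HR 5))) (HN 0))
      (if actf A a b then if HI A ?u a < HI A ?u b then HI A ?u a else HI A ?u b else 0)"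
    by (intro den_Sel den_Lt den_N den_fld den_R side_less Z ff half(1) fld_less X0) (use f X0 ff in auto)
  moreover have "(if actf A a b then if HI A ?u a < HI A ?u b then HI A ?u a else HI A ?u b else 0) = hif A a b"
    by (auto simp: hif_def min_def)
  ultimately have 10: "den ?r9 M (HSel (HR 12) (HSel (HLt (hfld 5 (HR 13) (HR 4)) (hfld 5 (HR 13) (HR 5)))
       (hfld 5 (HR 13) (HR 4)) (hfld 5 (HR 13) (HR 5))) (HN 0)) (hif A a b)" by simp
  have 11: "den ?r10 M (hfld 0 (HR 13) (HR 4)) (PA A ?u a)"
    by (intro den_fld den_R side_less Z) (use f in auto)
  have 12: "den ?r11 M (hfld 0 (HR 13) (HR 5)) (PA A ?u b)"
    by (intro den_fld den_R side_less Z) (use f in auto)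
  have 13: "den ?r12 M (hsc 0) n"
    unfolding scal_n[symmetric] by (intro den_sc) (use f in auto)
  have 14: "den ?r13 M (hsc 7) (40 * Z)"
    unfolding scal_B[symmetric] by (intro den_sc) (use f in auto)
  have "fold (run w) setup_cut (\<rho>, M, os) = (?r14, M, os)"
    by (simp only: setup_cut_def fold_Cons fold_Nil comp_apply id_apply
        run_asg[OF M 1] run_asg[OF M 2] run_asg[OF M 3] run_asg[OF M 4] run_asg[OF M 5]
        run_asg[OF M 6] run_asg[OF M 7] run_asg[OF M 8] run_asg[OF M 9] run_asg[OF M 10]
        run_asg[OF M 11] run_asg[OF M 12] run_asg[OF M 13] run_asg[OF M 14])
  moreover have "cut_regs a b ?r14" using f by (simp add: cut_regs_def)
  ultimately show ?thesis by blast
qed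

text \<open>Two cells per vertex number memoise \<open>stf\<close> for the two edges. They lie
  behind the \<open>40 * Z\<close> cells of the data structure.\<close>

definition scratch_done :: "nat \<Rightarrow> nat \<Rightarrow> nat \<Rightarrow> (nat \<Rightarrow> nat) \<Rightarrow> bool" where
  "scratch_done a b k M \<longleftrightarrow> (\<forall>q<k.
     M (40 * Z + 2 * q) =
       of_bool (stf A (side A a b) (lof A a b) (PA A (side A a b) a) (i1f A a b) (j1f A a b) q) \<and>
     M (40 * Z + (2 * q + 1)) =
       of_bool (stf A (side A a b) (lof A a b) (PA A (side A a b) b) (IP A (side A a b) b) (j2f A a b) q))"

lemma scratch_less: "q < n \<Longrightarrow> 40 * Z + (2 * q + 1) < 2 ^ w" "q < n \<Longrightarrow> 2 * q + 1 < 2 ^ w"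
proof -
  assume "q < n"
  then have "40 * Z + (2 * q + 1) < 100 * X" using n_Z Z_X by linarith
  then show "40 * Z + (2 * q + 1) < 2 ^ w" using half(2) by (intro full') linarith
  then show "2 * q + 1 < 2 ^ w" by linarith
qed

lemma den_scratch:
  assumes "\<rho> 2 = w - 1" "\<rho> 24 = 40 * Z" "\<rho> r = q" "q < n" "k \<le> 1"
  shows "den \<rho> M (HAdd (HR 24) (HAdd (HMul (HN 2) (HR r)) (HN k))) (40 * Z + (2 * q + k))"
  by (intro den_Add den_Mul den_N den_R assms)
    (use scratch_less[OF assms(4)] assms(5) in auto)

lemma i1f_less: "i1f A a b < scal A 1"
  using IP_W[OF side_less] scal_W by (simp add: i1f_def)

lemma j1f_less: "j1f A a b < X"
  using one_X fld_less by (simp add: j1f_def)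

lemma j2f_less: "j2f A a b < X"
  using X_pos fld_less by (simp add: j2f_def)

lemma lof_less: "lof A a b < X" "hif A a b < X"
  using X_pos fld_less by (simp_all add: lof_def hif_def max_def min_def)

lemma n_X: "n < X" using n_Z Z_X by linarith

text \<open>The recursive call of \<open>stf\<close> is read from scratch memory. Its cell is
  already filled because levels point to smaller numbers, so a scan in preorder takes constant time
  per vertex.\<close>

lemma den_st:
  assumes r: "\<rho> 2 = w - 1" "\<rho> 13 = u" "\<rho> 3 = q" "\<rho> 19 = l" "\<rho> p = pa" "\<rho> i = iv" "\<rho> j = jv"
      "\<rho> 24 = 40 * Z" "\<rho> 27 = LLO A u q" "\<rho> 28 = LHI A u q"
    and b: "u < 2" "q < n" "l < X" "pa < n" "iv < scal A 1" "jv < X" "k \<le> 1"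
    and M: "\<forall>i. M i < 2 ^ w"
    and prev: "LLO A u q < q \<Longrightarrow> M (40 * Z + (2 * LLO A u q + k)) = of_bool (stf A u l pa iv jv (LLO A u q))"
  shows "den \<rho> M (hst p i j k) (of_bool (stf A u l pa iv jv q))"
proof -
  define inn where "inn = (LLO A u q \<le> pa \<and> pa < LHI A u q)"
  define c where "c = colf A (LP A u q) (LL A u q) iv jv"
  define lt where "lt = (MN A u (q * scal A 1 + c) < jv)"
  have qZ: "q < Z" using b(2) n_Z by simp
  have q_le: "LLO A u q < n" using LLO_or[OF b(1,2)] b(2) by auto
  have c: "c < scal A 1" using colf_less b(5) by (simp add: c_def)
  have ivX: "iv < X" using b(5) A_less[of 0 1] by (rule less_trans)
  have 1: "den \<rho> M (hin (HR p) (HR 27) (HR 28)) (of_bool inn)"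
    unfolding inn_def by (intro den_in den_R r fld_less) (use b(4) n_X in auto)
  have "den \<rho> M (hidx (HR 3) (hcol (hfld 11 (HR 13) (HR 3)) (hfld 12 (HR 13) (HR 3)) (HR i) (HR j))) (q * scal A 1 + c)"
    using n_W_Z[OF b(2) c] unfolding c_def
    by (intro den_idx den_col den_fld den_R r b qZ fld_less ivX less_imp_le) simp_all
  then have 2: "den \<rho> M (HLt (hfld 15 (HR 13) (hidx (HR 3)
      (hcol (hfld 11 (HR 13) (HR 3)) (hfld 12 (HR 13) (HR 3)) (HR i) (HR j)))) (HR j)) (of_bool lt)"
    unfolding lt_def by (intro den_Lt den_fld den_R r b half(1) fld_less n_W_Z c) simp_all
  have 3: "den \<rho> M (HLd (HAdd (HR 24) (HAdd (HMul (HN 2) (HR 27)) (HN k)))) (M (40 * Z + (2 * LLO A u q + k)))"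
    by (intro den_Ld den_scratch r q_le b)
  have sel: "den \<rho> M (HSel (hin (HR p) (HR 27) (HR 28))
       (HLt (hfld 15 (HR 13) (hidx (HR 3) (hcol (hfld 11 (HR 13) (HR 3)) (hfld 12 (HR 13) (HR 3)) (HR i) (HR j)))) (HR j))
       (HLd (HAdd (HR 24) (HAdd (HMul (HN 2) (HR 27)) (HN k)))))
     (if inn then of_bool lt else M (40 * Z + (2 * LLO A u q + k)))"
    by (intro den_Sel 1 2 3) (use M fullX[OF one_X] in auto)
  \<comment> \<open>Without a proper level the interval is the whole range and contains
    \<open>pa\<close>.\<close>
  have less: "LLO A u q < q" if "\<not> inn"
    using that LLO_or[OF b(1,2)] b(4) by (auto simp: inn_def)
  have "(if inn then of_bool lt else M (40 * Z + (2 * LLO A u q + k))) =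
      of_bool (if inn then lt else LLO A u q < q \<and> stf A u l pa iv jv (LLO A u q))"
    using less prev by auto
  then have "den \<rho> M (hst p i j k)
      (of_bool (\<not> q = l \<and> (if inn then lt else LLO A u q < q \<and> stf A u l pa iv jv (LLO A u q))))"
    using sel by (intro den_And den_Not den_Eq den_R r half(1) b) (use b(2) n_X in auto)
  moreover have "(\<not> q = l \<and> (if inn then lt else LLO A u q < q \<and> stf A u l pa iv jv (LLO A u q))) =
      stf A u l pa iv jv q"
    by (subst (2) stf.simps) (simp add: inn_def lt_def c_def)
  ultimately show ?thesis by simp
qed

lemma run_put: "good_mem M \<Longrightarrow> den \<rho> M e x \<Longrightarrow> den \<rho> M e' y \<Longrightarrow>
    run w (Put (lower e) (lower e')) (\<rho>, M, os) = (\<rho>, M(x := y), os)"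
  by (simp add: ev_den)

lemma good_mem_upd: "good_mem M \<Longrightarrow> y < 2 ^ w \<Longrightarrow> good_mem (M(40 * Z + x := y))"
  by (auto simp: good_mem_def)

lemma incr_reg:
  assumes "\<rho> r = k" "k < n"
  shows "run w (Assign r (Op Add (Reg r) (Num 1))) (\<rho>, M, os) = (\<rho>(r := Suc k), M, os)"
proof -
  have "take_bit w (1::nat) = 1" "take_bit w (Suc k) = Suc k"
    using w_pos fullX[of "Suc k"] assms(2) n_X by (auto simp: take_bit_nat_eq_self)
  then show ?thesis using assms(1) by simp
qed

lemma run_body1:
  assumes M: "good_mem M" and c: "cut_regs a b \<rho>" "\<rho> 3 = k" "k < n" and s: "scratch_done a b k M"
  shows "\<exists>\<rho>' M'. fold (run w) (body1 @ [Assign 3 (Op Add (Reg 3) (Num 1))]) (\<rho>, M, os) = (\<rho>', M', os) \<and>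
    good_mem M' \<and> cut_regs a b \<rho>' \<and> \<rho>' 3 = Suc k \<and> scratch_done a b (Suc k) M'"
proof -
  note c' = c(1)[unfolded cut_regs_def] c(2)
  define u where "u = side A a b"
  define s1 where "s1 = stf A u (lof A a b) (PA A u a) (i1f A a b) (j1f A a b)"
  define s2 where "s2 = stf A u (lof A a b) (PA A u b) (IP A u b) (j2f A a b)"
  have u: "u < 2" by (simp add: u_def side_less)
  have kZ: "k < Z" using c(3) n_Z by simp
  have Mw: "\<forall>i. M i < 2 ^ w" using M by (simp add: good_mem_def)
  let ?r1 = "\<rho>(27 := LLO A u k)"
  let ?r2 = "?r1(28 := LHI A u k)"
  let ?r3 = "?r2(29 := of_bool (s1 k))"
  let ?r4 = "?r3(30 := of_bool (s2 k))"
  let ?M1 = "M(40 * Z + (2 * k + 0) := of_bool (s1 k))"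
  let ?M2 = "?M1(40 * Z + (2 * k + 1) := of_bool (s2 k))"
  have bw: "of_bool p < (2::nat) ^ w" for p using fullX[OF one_X] by (cases p) auto
  have M1: "good_mem ?M1" by (rule good_mem_upd[OF M bw])
  have M2: "good_mem ?M2" by (rule good_mem_upd[OF M1 bw])
  have sd: "M (40 * Z + 2 * q) = of_bool (s1 q)" "M (40 * Z + (2 * q + 1)) = of_bool (s2 q)" if "q < k" for q
    using s that unfolding scratch_done_def s1_def s2_def u_def by blast+
  have 1: "den \<rho> M (hfld 9 (HR 13) (HR 3)) (LLO A u k)"
    by (intro den_fld den_R u kZ) (use c' in \<open>auto simp: u_def\<close>)
  have 2: "den ?r1 M (hfld 10 (HR 13) (HR 3)) (LHI A u k)"
    by (intro den_fld den_R u kZ) (use c' in \<open>auto simp: u_def\<close>)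
  have 3: "den ?r2 M (hst 21 15 16 0) (of_bool (s1 k))"
    unfolding s1_def
    by (rule den_st) (use c' c(3) u PA_n[OF u] i1f_less j1f_less lof_less Mw sd(1) in \<open>auto simp: u_def s1_def\<close>)
  have 4: "den ?r3 M (hst 22 17 18 1) (of_bool (s2 k))"
    unfolding s2_def
    by (rule den_st) (use c' c(3) u PA_n[OF u] IP_W[OF u] j2f_less lof_less Mw sd(2) in \<open>auto simp: u_def s2_def\<close>)
  have 5: "den ?r4 M (HAdd (HR 24) (HAdd (HMul (HN 2) (HR 3)) (HN 0))) (40 * Z + (2 * k + 0))"
    by (rule den_scratch) (use c' c(3) in auto)
  have 6: "den ?r4 M (HR 29) (of_bool (s1 k))" by (rule den_R) (use c' in auto)
  have 7: "den ?r4 ?M1 (HAdd (HR 24) (HAdd (HMul (HN 2) (HR 3)) (HN 1))) (40 * Z + (2 * k + 1))"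
    by (rule den_scratch) (use c' c(3) in auto)
  have 8: "den ?r4 ?M1 (HR 30) (of_bool (s2 k))" by (rule den_R) (use c' in auto)
  have "?r4 3 = k" using c' by simp
  note 9 = incr_reg[of ?r4 3 k ?M2 os, OF this c(3)]
  have "fold (run w) (body1 @ [Assign 3 (Op Add (Reg 3) (Num 1))]) (\<rho>, M, os) = (?r4(3 := Suc k), ?M2, os)"
    by (simp only: body1_def fold_append fold_Cons fold_Nil comp_apply id_apply 9
        run_asg[OF M 1] run_asg[OF M 2] run_asg[OF M 3] run_asg[OF M 4] run_put[OF M 5 6] run_put[OF M1 7 8])
  moreover have "cut_regs a b (?r4(3 := Suc k))" using c' by (simp add: cut_regs_def)
  moreover have "scratch_done a b (Suc k) ?M2"
  proof -
    have "?M2 (40 * Z + 2 * q) = of_bool (s1 q) \<and> ?M2 (40 * Z + (2 * q + 1)) = of_bool (s2 q)" if "q < Suc k" for q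
    proof (cases "q = k")
      case False
      then have "q < k" using that by simp
      moreover have "2 * q \<noteq> 2 * k + 1" "2 * q + 1 \<noteq> 2 * k" by presburger+
      ultimately show ?thesis using sd[of q] by simp
    qed simp
    then show ?thesis unfolding scratch_done_def s1_def s2_def u_def by blast
  qed
  ultimately show ?thesis using M2 by (intro exI[of _ "?r4(3 := Suc k)"] exI[of _ ?M2]) simp
qed

lemma run_body2:
  assumes M: "good_mem M" and c: "cut_regs a b \<rho>" "\<rho> 3 = k" "k < n" and s: "scratch_done a b n M"
  shows "\<exists>\<rho>'. fold (run w) (body2 @ [Assign 3 (Op Add (Reg 3) (Num 1))]) (\<rho>, M, os) =
      (\<rho>', M, os @ [of_bool (bitf A a b k)]) \<and> cut_regs a b \<rho>' \<and> \<rho>' 3 = Suc k"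
proof -
  note c' = c(1)[unfolded cut_regs_def] c(2)
  define u where "u = side A a b"
  define s1 where "s1 = stf A u (lof A a b) (PA A u a) (i1f A a b) (j1f A a b)"
  define s2 where "s2 = stf A u (lof A a b) (PA A u b) (IP A u b) (j2f A a b)"
  define q where "q = PRE A u k"
  define t where "t = (if lof A a b \<le> q \<and> q < hif A a b then s1 q \<or> s2 q
    else TT A u (q * scal A 1 + i1f A a b) < j1f A a b \<or> TT A u (q * scal A 1 + IP A u b) < j2f A a b)"
  have u: "u < 2" by (simp add: u_def side_less)
  have kZ: "k < Z" using c(3) n_Z by simp
  have qn: "q < n" using PRE_n[OF u c(3)] by (simp add: q_def)
  have "M (40 * Z + 2 * q) = of_bool (s1 q) \<and> M (40 * Z + (2 * q + 1)) = of_bool (s2 q)"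
    using s qn unfolding scratch_done_def s1_def s2_def u_def by blast
  then have sd: "M (40 * Z + (2 * q + 0)) = of_bool (s1 q)" "M (40 * Z + (2 * q + 1)) = of_bool (s2 q)" by auto
  let ?r1 = "\<rho>(27 := q)"
  let ?r2 = "?r1(28 := of_bool t)"
  have r1: "?r1 2 = w - 1" "?r1 13 = u" "?r1 27 = q" "?r1 24 = 40 * Z" "?r1 19 = lof A a b" "?r1 20 = hif A a b"
    "?r1 15 = i1f A a b" "?r1 16 = j1f A a b" "?r1 17 = IP A u b" "?r1 18 = j2f A a b"
    using c' by (auto simp: u_def)
  have 1: "den \<rho> M (hfld 16 (HR 13) (HR 3)) q"
    unfolding q_def by (intro den_fld den_R u kZ) (use c' in \<open>auto simp: u_def\<close>)
  have d1: "den ?r1 M (HLd (HAdd (HR 24) (HAdd (HMul (HN 2) (HR 27)) (HN 0)))) (of_bool (s1 q))"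
    using den_Ld[OF den_scratch[of ?r1 27 q 0 M]] r1 qn sd(1) by simp
  have d2: "den ?r1 M (HLd (HAdd (HR 24) (HAdd (HMul (HN 2) (HR 27)) (HN 1)))) (of_bool (s2 q))"
    using den_Ld[OF den_scratch[of ?r1 27 q 1 M]] r1 qn sd(2) by simp
  have "den ?r1 M (HSel (hin (HR 27) (HR 19) (HR 20))
       (HOr (HLd (HAdd (HR 24) (HAdd (HMul (HN 2) (HR 27)) (HN 0))))
         (HLd (HAdd (HR 24) (HAdd (HMul (HN 2) (HR 27)) (HN 1)))))
       (HOr (HLt (hfld 13 (HR 13) (hidx (HR 27) (HR 15))) (HR 16))
         (HLt (hfld 13 (HR 13) (hidx (HR 27) (HR 17))) (HR 18))))
    (if lof A a b \<le> q \<and> q < hif A a b then of_bool (s1 q \<or> s2 q)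
     else of_bool (TT A u (q * scal A 1 + i1f A a b) < j1f A a b \<or> TT A u (q * scal A 1 + IP A u b) < j2f A a b))"
    by (intro den_Sel den_in den_Or d1 d2 den_Lt den_fld den_idx den_R r1 u half(1) fld_less n_W_Z qn
        i1f_less IP_W j1f_less j2f_less lof_less) (use qn n_X fullX[OF one_X] in \<open>auto simp: of_bool_def\<close>)
  moreover have "(if lof A a b \<le> q \<and> q < hif A a b then of_bool (s1 q \<or> s2 q)
     else of_bool (TT A u (q * scal A 1 + i1f A a b) < j1f A a b \<or> TT A u (q * scal A 1 + IP A u b) < j2f A a b))
     = (of_bool t :: nat)" by (simp add: t_def)
  ultimately have 2: "den ?r1 M (HSel (hin (HR 27) (HR 19) (HR 20))
       (HOr (HLd (HAdd (HR 24) (HAdd (HMul (HN 2) (HR 27)) (HN 0))))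
         (HLd (HAdd (HR 24) (HAdd (HMul (HN 2) (HR 27)) (HN 1)))))
       (HOr (HLt (hfld 13 (HR 13) (hidx (HR 27) (HR 15))) (HR 16))
         (HLt (hfld 13 (HR 13) (hidx (HR 27) (HR 17))) (HR 18)))) (of_bool t)" by simp
  have "u = of_bool (u \<noteq> 0)" using u by (cases u) auto
  then have "den ?r2 M (HXor (HR 28) (HR 13)) (of_bool (t \<noteq> (u \<noteq> 0)))"
    by (intro den_Xor den_R) (use c' in \<open>auto simp: u_def\<close>)
  moreover have "(t \<noteq> (u \<noteq> 0)) = bitf A a b k"
    by (simp add: bitf_def t_def s1_def s2_def Let_def flip: u_def q_def)
  ultimately have 3: "run w (Out (lower (HXor (HR 28) (HR 13)))) (?r2, M, os) = (?r2, M, os @ [of_bool (bitf A a b k)])"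
    using ev_den[OF M] by (simp del: lower.simps)
  have "?r2 3 = k" using c' by simp
  note 4 = incr_reg[of ?r2 3 k M "os @ [of_bool (bitf A a b k)]", OF this c(3)]
  have "fold (run w) (body2 @ [Assign 3 (Op Add (Reg 3) (Num 1))]) (\<rho>, M, os) =
      (?r2(3 := Suc k), M, os @ [of_bool (bitf A a b k)])"
    by (simp only: body2_def fold_append fold_Cons fold_Nil comp_apply id_apply 4 3
        run_asg[OF M 1] run_asg[OF M 2])
  moreover have "cut_regs a b (?r2(3 := Suc k))" using c' by (simp add: cut_regs_def)
  ultimately show ?thesis by (intro exI[of _ "?r2(3 := Suc k)"]) simp
qed

lemma loop1:
  assumes M: "good_mem M" and c: "cut_regs a b \<rho>"
  shows "\<exists>\<rho>' M'. run_com w (Loop 3 23 body1) (\<rho>, M, os) = (\<rho>', M', os) \<and>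
    good_mem M' \<and> cut_regs a b \<rho>' \<and> scratch_done a b n M'"
proof -
  let ?B = "fold (run w) (body1 @ [Assign 3 (Op Add (Reg 3) (Num 1))])"
  have *: "\<exists>\<rho>' M'. (?B ^^ k) (\<rho>(3 := 0), M, os) = (\<rho>', M', os) \<and>
    good_mem M' \<and> cut_regs a b \<rho>' \<and> \<rho>' 3 = k \<and> scratch_done a b k M'" if "k \<le> n" for k
    using that
  proof (induction k)
    case 0
    show ?case using M c by (intro exI[of _ "\<rho>(3 := 0)"] exI[of _ M]) (simp add: cut_regs_def scratch_done_def)
  next
    case (Suc k)
    have "k \<le> n" using Suc.prems by simp
    from Suc.IH[OF this] obtain \<rho>1 M1 where 1: "(?B ^^ k) (\<rho>(3 := 0), M, os) = (\<rho>1, M1, os)" "good_mem M1"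
      "cut_regs a b \<rho>1" "\<rho>1 3 = k" "scratch_done a b k M1" by blast
    have "k < n" using Suc.prems by simp
    from run_body1[OF 1(2,3,4) this 1(5), of os] show ?case
      unfolding funpow.simps comp_apply 1(1) .
  qed
  have n: "fst (\<rho>, M, os) 23 = n" using c by (simp add: cut_regs_def)
  have "run w (Assign 3 (Num 0)) (\<rho>, M, os) = (\<rho>(3 := 0), M, os)" by simp
  then have "run_com w (Loop 3 23 body1) (\<rho>, M, os) = (?B ^^ n) (\<rho>(3 := 0), M, os)"
    by (simp only: run_com.simps n)
  then show ?thesis using *[of n] by auto
qed

lemma loop2:
  assumes M: "good_mem M" and c: "cut_regs a b \<rho>" and s: "scratch_done a b n M"
  shows "\<exists>\<rho>'. run_com w (Loop 3 23 body2) (\<rho>, M, []) =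
    (\<rho>', M, map (\<lambda>v. of_bool (bitf A a b v)) [0..<n])"
proof -
  let ?B = "fold (run w) (body2 @ [Assign 3 (Op Add (Reg 3) (Num 1))])"
  have *: "\<exists>\<rho>'. (?B ^^ k) (\<rho>(3 := 0), M, []) = (\<rho>', M, map (\<lambda>v. of_bool (bitf A a b v)) [0..<k]) \<and>
    cut_regs a b \<rho>' \<and> \<rho>' 3 = k" if "k \<le> n" for k
    using that
  proof (induction k)
    case 0
    show ?case using c by (intro exI[of _ "\<rho>(3 := 0)"]) (simp add: cut_regs_def)
  next
    case (Suc k)
    let ?o = "map (\<lambda>v. of_bool (bitf A a b v) :: nat) [0..<k]"
    have "k \<le> n" using Suc.prems by simp
    from Suc.IH[OF this] obtain \<rho>1 where 1: "(?B ^^ k) (\<rho>(3 := 0), M, []) = (\<rho>1, M, ?o)" "cut_regs a b \<rho>1" "\<rho>1 3 = k" by blast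
    have k: "k < n" using Suc.prems by simp
    have o: "map (\<lambda>v. of_bool (bitf A a b v) :: nat) [0..<Suc k] = ?o @ [of_bool (bitf A a b k)]" by simp
    from run_body2[OF M 1(2,3) k s, of ?o] show ?case
      unfolding funpow.simps comp_apply 1(1) o .
  qed
  have n: "fst (\<rho>, M, []) 23 = n" using c by (simp add: cut_regs_def)
  have "run w (Assign 3 (Num 0)) (\<rho>, M, []) = (\<rho>(3 := 0), M, [])" by simp
  then have "run_com w (Loop 3 23 body2) (\<rho>, M, []) = (?B ^^ n) (\<rho>(3 := 0), M, [])"
    by (simp only: run_com.simps n)
  then show ?thesis using *[of n] by auto
qed

lemma cut_query:
  assumes e: "e1 < m" "e2 < m" and T: "length (comp_prog 40 0 cut_coms) * n \<le> T"
  shows "query w (comp_prog 40 0 cut_coms) D [e1, e2] T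
    (\<lambda>xs. xs = map (\<lambda>v. of_bool (bitf A (slot A e1) (slot A e2) v)) [0..<n])"
proof (rule query_comp_prog[OF args_less[OF e]])
  show "list_all (below_com 40) cut_coms"
    using below_prefix below_setup below_body keeps_body by (simp add: cut_coms_def)
  fix M assume "\<forall>i. M i < 2 ^ w" "stored D M"
  then have M: "good_mem M" by (simp add: good_mem_iff)
  define a where "a = slot A e1"
  define b where "b = slot A e2"
  obtain \<rho> where 1: "fold (run w) prefix (init_regs [e1, e2], M, []) = (\<rho>, M, [])" "flags_set a b \<rho>"
    using run_prefix[OF M e, of "[]"] by (auto simp: a_def b_def)
  obtain \<rho>1 where 2: "fold (run w) setup_cut (\<rho>, M, []) = (\<rho>1, M, [])" "cut_regs a b \<rho>1"
    using run_setup[OF M 1(2), of "[]"] slot_Z e by (auto simp: a_def b_def)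
  obtain \<rho>2 M2 where 3: "run_com w (Loop 3 23 body1) (\<rho>1, M, []) = (\<rho>2, M2, [])"
    "good_mem M2" "cut_regs a b \<rho>2" "scratch_done a b n M2" using loop1[OF M 2(2), of "[]"] by auto
  obtain \<rho>3 where 4: "run_com w (Loop 3 23 body2) (\<rho>2, M2, []) =
    (\<rho>3, M2, map (\<lambda>v. of_bool (bitf A a b v)) [0..<n])" using loop2[OF 3(2,3,4)] by auto
  have 0: "run_com w (Block (prefix @ setup_cut)) (init_regs [e1, e2], M, []) = (\<rho>1, M, [])"
    using 1 2 by simp
  have n1: "fst (\<rho>1, M, [] :: nat list) 23 = n" "fst (\<rho>2, M2, [] :: nat list) 23 = n"
    using 2(2) 3(3) by (simp_all add: cut_regs_def)
  have r: "readys w cut_coms (init_regs [e1, e2], M, [])"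
    unfolding cut_coms_def readys.simps ready.simps 0 3(1) n1 using n_pos by simp
  have f: "fold (run_com w) cut_coms (init_regs [e1, e2], M, []) =
      (\<rho>3, M2, map (\<lambda>v. of_bool (bitf A a b v)) [0..<n])"
    by (simp only: cut_coms_def fold_Cons fold_Nil comp_apply id_apply 0 3(1) 4)
  have "costs w 40 cut_coms (init_regs [e1, e2], M, []) =
      length (comp_block 40 (prefix @ setup_cut)) +
      (length (comp_block 40 [Assign 3 (Num 0)]) + n * Suc (length (loop_body 40 3 23 body1)) +
      (length (comp_block 40 [Assign 3 (Num 0)]) + n * Suc (length (loop_body 40 3 23 body2))))"
    by (simp only: cut_coms_def costs.simps cost.simps 0 3(1) n1 add_0_right)
  also have "\<dots> \<le> (length (comp_block 40 (prefix @ setup_cut)) +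
      (length (comp_block 40 [Assign 3 (Num 0)]) + Suc (length (loop_body 40 3 23 body1)) +
      (length (comp_block 40 [Assign 3 (Num 0)]) + Suc (length (loop_body 40 3 23 body2))))) * n"
  proof -
    have "x + (y + n * z + (y' + n * z')) \<le> (x + (y + z + (y' + z'))) * n" for x y z y' z'
    proof -
      have "x \<le> x * n" "y \<le> y * n" "y' \<le> y' * n" using n_pos by simp_all
      then have "x + (y + n * z + (y' + n * z')) \<le> x * n + (y * n + n * z + (y' * n + n * z'))"
        by (intro add_mono order_refl)
      then show ?thesis by (simp add: distrib_left distrib_right mult.commute)
    qed
    then show ?thesis .
  qed
  also have "\<dots> \<le> length (comp_prog 40 0 cut_coms) * n"
    by (intro mult_le_mono1) (simp add: cut_coms_def del: comp_stmt.simps)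
  finally have c: "costs w 40 cut_coms (init_regs [e1, e2], M, []) \<le> T" using T by linarith
  show "readys w cut_coms (init_regs [e1, e2], M, []) \<and>
      costs w 40 cut_coms (init_regs [e1, e2], M, []) \<le> T \<and>
      (\<exists>\<rho> M' os. fold (run_com w) cut_coms (init_regs [e1, e2], M, []) = (\<rho>, M', os) \<and>
        os = map (\<lambda>v. of_bool (bitf A (slot A e1) (slot A e2) v)) [0..<n] \<and> stored D M')"
    using r c f 3(2) by (simp add: a_def b_def good_mem_iff)
qed

lemma D_bounds: "length D = 40 * Z" "x \<in> set D \<Longrightarrow> x < 2 ^ w"
  using fullX[OF A_less] by (auto simp: D_def)

end

section \<open>Minimum cuts after two failures\<close>

lemma card_minus_two: "finite C \<Longrightarrow> card C \<le> card (C - {x, y}) + 2"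
proof -
  assume "finite C"
  then have "card C \<le> card (C - {x, y}) + card {x, y}"
    by (metis card_Un_le card_mono finite.emptyI finite.insertI finite_Diff finite_UnI Un_Diff_cancel2 Un_upper1 le_trans)
  moreover have "card {x, y} \<le> 2" by (simp add: card_insert_if)
  ultimately show ?thesis by linarith
qed

lemma card_minus_one: "finite C \<Longrightarrow> x \<notin> C \<or> y \<notin> C \<Longrightarrow> card C \<le> card (C - {x, y}) + 1"
proof -
  assume "finite C" "x \<notin> C \<or> y \<notin> C"
  then have "C - {x, y} = C - {y} \<or> C - {x, y} = C - {x}" by auto
  moreover have "card C \<le> card (C - {z}) + 1" for z
    using \<open>finite C\<close> by (cases "z \<in> C") (auto simp: card_Diff_singleton_if)
  ultimately show ?thesis by metis
qed

text \<open>Both directions share \<open>r\<close>: if the root of the component of \<open>z\<close>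
  is on the side of \<open>t\<close>, then it is on the source side of the complementary cut in the
  reversed network.\<close>

locale two_sided = N: residual V E ta he s t F lam P pe len r +
  R: residual V E he ta t s F lam P' pe' len r
  for V :: "'v set" and E :: "'e set" and ta he :: "'e \<Rightarrow> 'v" and s t :: 'v
    and F lam P pe len r P' pe' +
  assumes flow: "N.is_flow F lam"
begin

lemma rsrc_swap: "R.rsrc F = N.rdst F" and rdst_swap: "R.rdst F = N.rsrc F"
  by (auto simp: R.rsrc_def R.rdst_def N.rsrc_def N.rdst_def fun_eq_iff)

lemma reach_swap: "R.reach X u v \<longleftrightarrow> N.reach X v u"
proof -
  have "R.rel X = (N.rel X)\<inverse>"
    unfolding R.rel_def N.rel_def unfolding rsrc_swap rdst_swap by auto
  then show ?thesis by (simp add: R.reach_def N.reach_def rtrancl_converse)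
qed

lemma cross_swap: "A \<subseteq> V \<Longrightarrow> R.cross (V - A) = N.cross A"
  unfolding R.cross_def N.cross_def using N.ta_V N.he_V by blast

lemma rcross_swap: "A \<subseteq> V \<Longrightarrow> R.rcross F (V - A) = N.rcross F A"
  unfolding R.rcross_def N.rcross_def rsrc_swap rdst_swap using N.src_V N.dst_V by blast

text \<open>By \<open>flow_cut\<close>, minimum cuts are the separating sets without a leaving
  residual arc. The set reached from \<open>ta e\<close> is the least of those that contain
  \<open>ta e\<close>, so it suffices to ask whether it contains \<open>he e\<close>.\<close>

definition in_min_cut :: "'e \<Rightarrow> bool" where
  "in_min_cut e \<longleftrightarrow> e \<in> F \<and> \<not> N.reach {} (ta e) (he e)"

definition both_in_min_cut :: "'e \<Rightarrow> 'e \<Rightarrow> bool" where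
  "both_in_min_cut e1 e2 \<longleftrightarrow> in_min_cut e1 \<and> in_min_cut e2 \<and>
     \<not> N.reach {} (ta e1) (he e2) \<and> \<not> N.reach {} (ta e2) (he e1)"

text \<open>A cut with one residual arc has \<open>lam + 1\<close> edges. The loss of two of them
  saves as much as the loss of one edge of a minimum cut.\<close>

definition dual_size :: "'e \<Rightarrow> 'e \<Rightarrow> nat" where
  "dual_size e1 e2 = (if both_in_min_cut e1 e2 then lam - 2
     else if in_min_cut e1 \<or> in_min_cut e2 \<or> N.paired e1 e2 \<or> R.paired e1 e2 then lam - 1 else lam)"

definition cl :: "'v \<Rightarrow> 'v set" where "cl a = {v \<in> V. N.reach {} a v}"

definition dual_cut :: "'e \<Rightarrow> 'e \<Rightarrow> 'v set" where
  "dual_cut e1 e2 = (if both_in_min_cut e1 e2 then cl (ta e1) \<union> cl (ta e2)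
     else if in_min_cut e1 then cl (ta e1) else if in_min_cut e2 then cl (ta e2)
     else if N.paired e1 e2 then N.pair_cut (N.pair_sep e1 e2) (ta e1) (ta e2)
     else if R.paired e1 e2 then V - R.pair_cut (R.pair_sep e1 e2) (he e1) (he e2)
     else cl s)"

lemma finite_cross: "finite (N.cross A)" "finite (N.rcross F A)"
  using N.finite_E by (auto simp: N.cross_def N.rcross_def)

lemma card_cross: "A \<subseteq> V \<Longrightarrow> s \<in> A \<Longrightarrow> t \<notin> A \<Longrightarrow> card (N.cross A) = lam + card (N.rcross F A)"
  using N.flow_cut[OF flow] .

text \<open>Unbreakable pairs lead from every vertex to \<open>s\<close>, and from \<open>t\<close>
  to the unreached vertex \<open>b\<close>.\<close>

lemma cl_cut:
  assumes "a \<in> V" "b \<in> V" "\<not> N.reach {} a b"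
  shows "s \<in> cl a" "t \<notin> cl a" "N.rcross F (cl a) = {}"
proof -
  show "s \<in> cl a" using N.reach_s assms(1) N.s_V by (simp add: cl_def)
  show "t \<notin> cl a" using N.reach_t[OF assms(2)] N.reach_trans assms(3) by (auto simp: cl_def)
  show "N.rcross F (cl a) = {}"
    using N.reach_arc[of _ "{}"] N.reach_trans N.dst_V by (auto simp: cl_def N.rcross_def)
qed

text \<open>The unbreakable pairs create no new walk: they start at \<open>t\<close> or lead back to
  \<open>s\<close>.\<close>

lemma not_reach_s_t: "\<not> N.reach {} s t"
proof
  assume a: "N.reach {} s t"
  let ?A = "{v \<in> V. arc_relation.reach E (N.rsrc F) (N.rdst F) {} {} s v}"
  interpret B: arc_relation E "N.rsrc F" "N.rdst F" "{}" .
  have "t \<in> ?A"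
    using a
  proof (rule N.reach_closed)
    show "s \<in> ?A" using N.s_V by simp
    show "q \<in> ?A" if "(p, q) \<in> {t} \<times> V \<union> V \<times> {s}" "p \<in> ?A" for p q
      using that N.no_augment N.s_V by auto
    show "N.rdst F e \<in> ?A" if "e \<in> E" "N.rsrc F e \<in> ?A" for e
      using that B.reach_arc[of e "{}"] B.reach_trans N.dst_V by auto
  qed
  then show False using N.no_augment by simp
qed

lemma cross_in_min_cut:
  assumes "A \<subseteq> V" "s \<in> A" "t \<notin> A" "N.rcross F A = {}" "e \<in> N.cross A" "e' \<in> N.cross A"
  shows "e \<in> F" "\<not> N.reach {} (ta e) (he e')"
proof -
  show "e \<in> F"
    using assms(4,5) by (auto simp: N.cross_def N.rcross_def N.rsrc_def N.rdst_def split: if_splits)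
  show "\<not> N.reach {} (ta e) (he e')"
    using N.cut_reach[OF assms(1-3), of "{}" "ta e" "he e'"] assms(4-6) by (auto simp: N.cross_def)
qed

text \<open>The root of the component of \<open>z\<close> lies on one of the two sides. If it lies
  outside \<open>A\<close>, the complement of \<open>A\<close> is a cut of the reversed network with
  the same crossing edges and the same residual arc.\<close>

lemma cross_paired:
  assumes A: "A \<subseteq> V" "s \<in> A" "t \<notin> A" "card (N.rcross F A) = 1"
    and e: "e1 \<in> N.cross A" "e2 \<in> N.cross A" "e1 \<noteq> e2" "\<not> in_min_cut e1" "\<not> in_min_cut e2"
  shows "N.paired e1 e2 \<or> R.paired e1 e2"
proof -
  obtain z where z: "N.rcross F A = {z}" using A(4) card_1_singletonE by blast
  have E: "e1 \<in> E" "e2 \<in> E" using e by (auto simp: N.cross_def)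
  have re: "N.reach {} (ta e) (he e)" if "e \<in> E" "\<not> in_min_cut e" for e
    using that N.reach_arc[of e "{}"] by (auto simp: in_min_cut_def N.rsrc_def N.rdst_def)
  have sub: "N.rcross F A \<subseteq> {z}" using z by simp
  show ?thesis
  proof (cases "r (N.dst z) \<in> A")
    case True
    then show ?thesis
      using N.paired_complete[OF A(1-3) sub e(1-3) re[OF E(1) e(4)] re[OF E(2) e(5)]] by simp
  next
    case False
    have c: "N.conn (N.src z) (N.dst z)"
      by (rule N.cross_pair_conn[OF A(1-3) sub e(1-3) re[OF E(1) e(4)] re[OF E(2) e(5)]])
    have "z \<in> E" using z by (auto simp: N.rcross_def)
    then have "r (N.dst z) \<in> V"
      using N.conn_root[of "N.dst z"] N.reach_V N.dst_V by (auto simp: N.conn_def)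
    then have r: "r (R.dst z) \<in> V - A" using False N.root_eq[OF c] by (simp add: rdst_swap)
    have A': "V - A \<subseteq> V" "t \<in> V - A" "s \<notin> V - A" using A N.t_V by auto
    have "R.paired e1 e2"
      by (rule R.paired_complete[OF A' _ _ _ e(3), of z])
        (use e(1,2) r re[OF E(1) e(4)] re[OF E(2) e(5)] sub in
          \<open>simp_all add: cross_swap[OF A(1)] rcross_swap[OF A(1)] reach_swap\<close>)
    then show ?thesis ..
  qed
qed

text \<open>A cut with \<open>c\<close> residual arcs that loses \<open>j\<close> edges keeps
  \<open>lam + c - j\<close> of them, so with \<open>j \<le> 2\<close> it falls below
  \<open>lam\<close> only for \<open>c < j\<close>. The case \<open>c = 0\<close> concerns minimum
  cuts, and \<open>c = 1\<close> with \<open>j = 2\<close> is \<open>cross_paired\<close>.\<close>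

lemma dual_size_le:
  assumes "e1 \<in> E" "e2 \<in> E" "e1 \<noteq> e2" and A: "A \<subseteq> V" "s \<in> A" "t \<notin> A"
  shows "dual_size e1 e2 \<le> card (N.cross A - {e1, e2})"
proof -
  let ?C = "N.cross A"
  note cc = card_cross[OF A]
  note two = card_minus_two[OF finite_cross(1)[of A], of e1 e2]
  have both: "both_in_min_cut e1 e2" if "e1 \<in> ?C" "e2 \<in> ?C" "N.rcross F A = {}"
    using cross_in_min_cut[OF A that(3)] that(1,2) by (auto simp: both_in_min_cut_def in_min_cut_def)
  have one: "in_min_cut e" if "e \<in> ?C" "N.rcross F A = {}" for e
    using cross_in_min_cut[OF A that(2)] that(1) by (auto simp: in_min_cut_def)
  consider "e1 \<in> ?C \<and> e2 \<in> ?C" | "e1 \<in> ?C \<or> e2 \<in> ?C" "e1 \<notin> ?C \<or> e2 \<notin> ?C" | "e1 \<notin> ?C" "e2 \<notin> ?C" by blast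
  then show ?thesis
  proof cases
    case 1
    consider "N.rcross F A = {}" | "card (N.rcross F A) = 1" | "2 \<le> card (N.rcross F A)"
    proof -
      have "card (N.rcross F A) = 0 \<or> card (N.rcross F A) = 1 \<or> 2 \<le> card (N.rcross F A)" by linarith
      then show thesis using finite_cross(2)[of A] that by auto
    qed
    then show ?thesis
    proof cases
      case emp: 1
      then have "dual_size e1 e2 = lam - 2" using both 1 by (simp add: dual_size_def)
      moreover have "card ?C = lam" using cc emp by simp
      ultimately show ?thesis using two by linarith
    next
      case one: 2
      then have "in_min_cut e1 \<or> in_min_cut e2 \<or> N.paired e1 e2 \<or> R.paired e1 e2"
        using cross_paired[OF A one] 1 assms(3) by blast
      then have "dual_size e1 e2 \<le> lam - 1" by (auto simp: dual_size_def)
      then show ?thesis using two cc one by linarith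
    next
      case 3
      have "dual_size e1 e2 \<le> lam" by (simp add: dual_size_def)
      then show ?thesis using two cc 3 by linarith
    qed
  next
    case 2
    note o = card_minus_one[OF finite_cross(1) 2(2)]
    show ?thesis
    proof (cases "N.rcross F A = {}")
      case True
      then have "in_min_cut e1 \<or> in_min_cut e2" using one 2(1) by blast
      then have "dual_size e1 e2 \<le> lam - 1" by (auto simp: dual_size_def)
      then show ?thesis using o cc by linarith
    next
      case False
      have "dual_size e1 e2 \<le> lam" by (simp add: dual_size_def)
      moreover have "1 \<le> card (N.rcross F A)" using False finite_cross(2)[of A] by (simp add: Suc_le_eq card_gt_0_iff)
      ultimately show ?thesis using o cc by linarith
    qed
  next
    case 3
    then have eq: "?C - {e1, e2} = ?C" by blast
    have "dual_size e1 e2 \<le> lam" by (simp add: dual_size_def)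
    then show ?thesis unfolding eq using cc by linarith
  qed
qed

lemma dual_cut_correct:
  assumes E: "e1 \<in> E" "e2 \<in> E" "e1 \<noteq> e2"
  shows "dual_cut e1 e2 \<subseteq> V" "s \<in> dual_cut e1 e2" "t \<notin> dual_cut e1 e2"
    "card (N.cross (dual_cut e1 e2) - {e1, e2}) \<le> dual_size e1 e2"
proof -
  have V: "ta e1 \<in> V" "he e1 \<in> V" "ta e2 \<in> V" "he e2 \<in> V" using N.ta_V N.he_V E by auto
  let ?A = "dual_cut e1 e2"
  have "?A \<subseteq> V \<and> s \<in> ?A \<and> t \<notin> ?A \<and> card (N.cross ?A - {e1, e2}) \<le> dual_size e1 e2"
  proof (cases "both_in_min_cut e1 e2")
    case True
    then have n: "\<not> N.reach {} (ta e1) (he e1)" "\<not> N.reach {} (ta e2) (he e2)"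
      "\<not> N.reach {} (ta e1) (he e2)" "\<not> N.reach {} (ta e2) (he e1)"
      by (auto simp: both_in_min_cut_def in_min_cut_def)
    have A: "?A = cl (ta e1) \<union> cl (ta e2)" using True by (simp add: dual_cut_def)
    note c1 = cl_cut[OF V(1,2) n(1)]
    note c2 = cl_cut[OF V(3,4) n(2)]
    have st: "?A \<subseteq> V" "s \<in> ?A" "t \<notin> ?A" using A c1 c2 by (auto simp: cl_def)
    \<comment> \<open>A residual arc that leaves the union also leaves the part that contains its
      source.\<close>
    have "N.rcross F ?A \<subseteq> N.rcross F (cl (ta e1)) \<union> N.rcross F (cl (ta e2))"
      by (auto simp: A N.rcross_def)
    then have "card (N.cross ?A) = lam" using card_cross[OF st] c1 c2 by auto
    moreover have "e1 \<in> N.cross ?A" "e2 \<in> N.cross ?A"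
      using n V E by (auto simp: A cl_def N.cross_def)
    ultimately have "card (N.cross ?A - {e1, e2}) = lam - 2"
      using E(3) by (simp add: card_Diff_subset)
    then show ?thesis using st True by (simp add: dual_size_def)
  next
    case nb: False
    have single: "cl (ta e) \<subseteq> V \<and> s \<in> cl (ta e) \<and> t \<notin> cl (ta e) \<and>
        card (N.cross (cl (ta e)) - {e1, e2}) \<le> lam - 1"
      if e: "e \<in> {e1, e2}" "in_min_cut e" for e
    proof -
      have n: "\<not> N.reach {} (ta e) (he e)" "ta e \<in> V" "he e \<in> V" "e \<in> E"
        using e E V by (auto simp: in_min_cut_def)
      note c = cl_cut[OF n(2,3,1)]
      have sub: "cl (ta e) \<subseteq> V" by (auto simp: cl_def)
      have "card (N.cross (cl (ta e))) = lam" using card_cross[OF sub c(1,2)] c(3) by simp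
      moreover have "e \<in> N.cross (cl (ta e))" using n by (auto simp: cl_def N.cross_def)
      then have "card (N.cross (cl (ta e)) - {e}) = card (N.cross (cl (ta e))) - 1" by simp
      moreover have "card (N.cross (cl (ta e)) - {e1, e2}) \<le> card (N.cross (cl (ta e)) - {e})"
        by (rule card_mono) (use finite_cross e in auto)
      ultimately show ?thesis using sub c by simp
    qed
    have pair: "card (N.cross B - {e1, e2}) \<le> lam - 1"
      if B: "B \<subseteq> V" "s \<in> B" "t \<notin> B" "N.rcross F B \<subseteq> {z}" "e1 \<in> N.cross B" "e2 \<in> N.cross B" for B z
    proof -
      have "card (N.rcross F B) \<le> 1" using card_mono[OF _ B(4)] by simp
      then have "card (N.cross B) \<le> lam + 1" using card_cross[OF B(1-3)] by simp
      moreover have "card (N.cross B - {e1, e2}) = card (N.cross B) - 2"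
        using B(5,6) E(3) by (simp add: card_Diff_subset)
      ultimately show ?thesis by linarith
    qed
    consider "in_min_cut e1" | "\<not> in_min_cut e1" "in_min_cut e2"
      | "\<not> in_min_cut e1" "\<not> in_min_cut e2" "N.paired e1 e2"
      | "\<not> in_min_cut e1" "\<not> in_min_cut e2" "\<not> N.paired e1 e2" "R.paired e1 e2"
      | "\<not> in_min_cut e1" "\<not> in_min_cut e2" "\<not> N.paired e1 e2" "\<not> R.paired e1 e2" by blast
    then show ?thesis
    proof cases
      case 1
      then show ?thesis using single[of e1] nb by (simp add: dual_cut_def dual_size_def)
    next
      case 2
      then show ?thesis using single[of e2] nb by (simp add: dual_cut_def dual_size_def)
    next
      case 3
      note p = N.pair_cut_correct[OF E(1,2) 3(3)]
      show ?thesis using p pair[OF p] 3 nb by (simp add: dual_cut_def dual_size_def)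
    next
      case 4
      let ?B = "R.pair_cut (R.pair_sep e1 e2) (he e1) (he e2)"
      note p = R.pair_cut_correct[OF E(1,2) 4(4)]
      have B: "V - (V - ?B) = ?B" "V - ?B \<subseteq> V" "s \<in> V - ?B" "t \<notin> V - ?B"
        using p(1,2,3) N.s_V by auto
      have x: "N.cross (V - ?B) = R.cross ?B" "N.rcross F (V - ?B) = R.rcross F ?B"
        using cross_swap[OF B(2)] rcross_swap[OF B(2)] B(1) by simp_all
      have "card (N.cross (V - ?B) - {e1, e2}) \<le> lam - 1"
        by (rule pair[OF B(2-4), of "R.pair_sep e1 e2"]) (use p(4-6) x in simp_all)
      then show ?thesis using B 4 nb by (simp add: dual_cut_def dual_size_def)
    next
      case 5
      note c = cl_cut[OF N.s_V N.t_V not_reach_s_t]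
      have sub: "cl s \<subseteq> V" by (auto simp: cl_def)
      have "card (N.cross (cl s) - {e1, e2}) \<le> card (N.cross (cl s))"
        by (rule card_mono) (use finite_cross in auto)
      also have "\<dots> = lam" using card_cross[OF sub c(1,2)] c(3) by simp
      finally show ?thesis using sub c 5 nb by (simp add: dual_cut_def dual_size_def)
    qed
  qed
  then show "?A \<subseteq> V" "s \<in> ?A" "t \<notin> ?A" "card (N.cross ?A - {e1, e2}) \<le> dual_size e1 e2" by auto
qed

end

section \<open>Edge cuts and vertex cuts\<close>

lemma vertex_cut_is_cut:
  assumes "s \<in> A" "t \<notin> A"
  shows "is_cut G s t {e \<in> arcs G. tail G e \<in> A \<and> head G e \<notin> A}"
proof -
  define C where "C = {e \<in> arcs G. tail G e \<in> A \<and> head G e \<notin> A}"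
  have "v \<in> A" if "s \<rightarrow>\<^sup>*\<^bsub>del_arcs G C\<^esub> v" for v
    using that unfolding reachable_def
  proof (induction rule: rtrancl_on_induct)
    case base
    show ?case by (rule assms(1))
  next
    case (step x y)
    have "(x, y) \<in> arc_to_ends (del_arcs G C) ` arcs (del_arcs G C)"
      using step by (simp only: arcs_ends_def)
    then obtain e where "e \<in> arcs (del_arcs G C)" "(x, y) = arc_to_ends (del_arcs G C) e" by blast
    then have "e \<in> arcs G" "e \<notin> C" "tail G e = x" "head G e = y"
      by (simp_all add: del_arcs_def arc_to_ends_def)
    then show ?case using step.IH by (auto simp: C_def)
  qed
  then have "\<not> s \<rightarrow>\<^sup>*\<^bsub>del_arcs G C\<^esub> t" using assms(2) by blast
  moreover have "C \<subseteq> arcs G" by (auto simp: C_def)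
  ultimately have "is_cut G s t C" unfolding is_cut_def by blast
  then show ?thesis by (simp only: C_def)
qed

text \<open>Every edge that leaves the set still reachable from \<open>s\<close> must have been
  deleted.\<close>

lemma cut_contains_vertex_cut:
  assumes "wf_digraph G" "s \<in> verts G" "is_cut G s t C"
  obtains A where "A \<subseteq> verts G" "s \<in> A" "t \<notin> A" "{e \<in> arcs G. tail G e \<in> A \<and> head G e \<notin> A} \<subseteq> C"
proof -
  interpret wf_digraph G by fact
  let ?H = "del_arcs G C"
  interpret H: wf_digraph ?H by unfold_locales (auto simp: del_arcs_def)
  define A where "A = {v \<in> verts G. s \<rightarrow>\<^sup>*\<^bsub>?H\<^esub> v}"
  have "s \<in> A" using assms(2) H.reachable_refl[of s] by (simp add: A_def del_arcs_def)
  moreover have "t \<notin> A" using assms(3) by (auto simp: A_def is_cut_def)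
  moreover have "{e \<in> arcs G. tail G e \<in> A \<and> head G e \<notin> A} \<subseteq> C"
  proof
    fix e assume e: "e \<in> {e \<in> arcs G. tail G e \<in> A \<and> head G e \<notin> A}"
    show "e \<in> C"
    proof (rule ccontr)
      assume "e \<notin> C"
      then have "e \<in> arcs ?H" using e by (simp add: del_arcs_def)
      then have "tail ?H e \<rightarrow>\<^bsub>?H\<^esub> head ?H e" 
        by (auto simp: arcs_ends_def arc_to_ends_def)
      then have "tail G e \<rightarrow>\<^bsub>?H\<^esub> head G e" by (simp add: del_arcs_def)
      moreover have "s \<rightarrow>\<^sup>*\<^bsub>?H\<^esub> tail G e" using e by (simp add: A_def)
      ultimately have "s \<rightarrow>\<^sup>*\<^bsub>?H\<^esub> head G e" by (rule H.reachable_adj_trans[rotated])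
      then show False using e by (auto simp: A_def)
    qed
  qed
  ultimately show ?thesis using that[of A] by (auto simp: A_def)
qed

lemma min_vertex_cut:
  fixes G :: "('v, 'e) pre_digraph"
  assumes G: "fin_digraph G" "s \<in> verts G" "t \<in> verts G"
    and A: "A \<subseteq> verts G" "s \<in> A" "t \<notin> A"
    and min: "\<And>A'. A' \<subseteq> verts G \<Longrightarrow> s \<in> A' \<Longrightarrow> t \<notin> A' \<Longrightarrow>
      card {e \<in> arcs G. tail G e \<in> A \<and> head G e \<notin> A} \<le> card {e \<in> arcs G. tail G e \<in> A' \<and> head G e \<notin> A'}"
  shows "min_cut_size G s t = card {e \<in> arcs G. tail G e \<in> A \<and> head G e \<notin> A}"
    "is_min_cut_partition G s t A (verts G - A)"
proof -
  interpret fin_digraph G by fact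
  let ?C = "\<lambda>A. {e \<in> arcs G. tail G e \<in> A \<and> head G e \<notin> A}"
  have le: "card (?C A) \<le> card C" if C: "is_cut G s t C" for C
  proof -
    obtain A' where A': "A' \<subseteq> verts G" "s \<in> A'" "t \<notin> A'" "?C A' \<subseteq> C"
      using cut_contains_vertex_cut[OF wf_digraph_axioms G(2) C] by blast
    have "finite C" using C finite_subset[OF _ finite_arcs] by (auto simp: is_cut_def)
    then have "card (?C A') \<le> card C" using A'(4) by (rule card_mono)
    then show ?thesis using min[OF A'(1-3)] by linarith
  qed
  have cut: "is_cut G s t (?C A)" by (rule vertex_cut_is_cut[OF A(2,3)])
  show "min_cut_size G s t = card (?C A)"
    unfolding min_cut_size_def by (rule Least_equality) (use cut le in auto)
  have "{e \<in> arcs G. tail G e \<in> A \<and> head G e \<in> verts G - A} = ?C A" by auto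
  then show "is_min_cut_partition G s t A (verts G - A)"
    using A G cut le by (auto simp: is_min_cut_partition_def is_min_cut_def)
qed

section \<open>Correctness of the tables of one side\<close>

context residual
begin

definition vert :: "nat \<Rightarrow> 'v" where "vert q = the_inv_into V pre q"

lemma vert_pre: "v \<in> V \<Longrightarrow> vert (pre v) = v"
  unfolding vert_def using pre_props(1) by (simp add: bij_betw_def the_inv_into_f_f)

lemma vert_V: "q < card V \<Longrightarrow> vert q \<in> V" and pre_vert: "q < card V \<Longrightarrow> pre (vert q) = q"
proof -
  assume "q < card V"
  then have "q \<in> pre ` V" using pre_props(1) by (simp add: bij_betw_def)
  then obtain v where "v \<in> V" "q = pre v" by blast
  then show "vert q \<in> V" "pre (vert q) = q" using vert_pre by auto
qed

text \<open>An arc outside the flow breaks no path; the value \<open>lam\<close> is not the index of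
  a path.\<close>

definition brk :: "'e \<Rightarrow> nat" where "brk g = (if g \<in> F then pidx g else lam)"
definition brk_pos :: "'e \<Rightarrow> nat" where "brk_pos g = (if g \<in> F then Suc (ppos g) else 0)"

text \<open>Column \<open>lam + 1\<close> is reserved for the source in \<open>tt_tab\<close>, and empty in the other tables.\<close>

definition tt_tab :: "nat \<Rightarrow> nat \<Rightarrow> nat" where
  "tt_tab q c = (if c = lam + 1 then if reach {} s (vert q) then 0 else card V else minreach None (vert q) c)"

definition mn_tab :: "nat \<Rightarrow> nat \<Rightarrow> nat" where
  "mn_tab q c = minreach (lvl (vert q)) (vert q) c"

end

text \<open>\<open>S\<close> contains the edges with a record of their own. What is required for all
  of \<open>E\<close> must also be true of the default record.\<close>

locale side_tables = residual V E ta he s t F lam P pe len r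
  for V :: "'v set" and E :: "'e set" and ta he :: "'e \<Rightarrow> 'v" and s t :: 'v
    and F lam P pe len r +
  fixes A :: arrays and u :: nat and sl :: "'e \<Rightarrow> nat" and S :: "'e set"
  assumes scal_W: "scal A 1 = lam + 2" and scal_lam: "scal A 2 = lam"
    and keys: "e \<in> F \<Longrightarrow> e \<in> S" "e \<in> E \<Longrightarrow> top_sep e \<noteq> None \<Longrightarrow> e \<in> S" "e \<in> S \<Longrightarrow> e \<in> E"
    and PA: "e \<in> S \<Longrightarrow> PA A u (sl e) = pre (ta e)"
    and PB: "e \<in> S \<Longrightarrow> PB A u (sl e) = pre (he e)"
    and IP: "e \<in> S \<Longrightarrow> IP A u (sl e) = (if e \<in> F then pidx e else lam + 1)"
    and JJ: "e \<in> E \<Longrightarrow> JJ A u (sl e) = (if e \<in> F then Suc (ppos e) else 0)"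
    and LO: "e \<in> E \<Longrightarrow> LO A u (sl e) = (case top_sep e of None \<Rightarrow> 0 | Some g \<Rightarrow> lo g)"
    and HI: "e \<in> E \<Longrightarrow> HI A u (sl e) = (case top_sep e of None \<Rightarrow> 0 | Some g \<Rightarrow> hi g)"
    and ROW: "e \<in> S \<Longrightarrow> ROW A u (sl e) = row e"
    and GP: "e \<in> S \<Longrightarrow> top_sep e = Some g \<Longrightarrow> GP A u (sl e) = brk g"
    and GL: "e \<in> S \<Longrightarrow> top_sep e = Some g \<Longrightarrow> GL A u (sl e) = brk_pos g"
    and LLO: "q < card V \<Longrightarrow> LLO A u q = (case lvl (vert q) of None \<Rightarrow> 0 | Some y \<Rightarrow> lo y)"
    and LHI: "q < card V \<Longrightarrow> LHI A u q = (case lvl (vert q) of None \<Rightarrow> card V | Some y \<Rightarrow> hi y)"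
    and LP: "q < card V \<Longrightarrow> lvl (vert q) = Some y \<Longrightarrow> LP A u q = brk y"
    and LL: "q < card V \<Longrightarrow> lvl (vert q) = Some y \<Longrightarrow> LL A u q = brk_pos y"
    and TT: "q < card V \<Longrightarrow> c < lam + 2 \<Longrightarrow> TT A u (q * (lam + 2) + c) = tt_tab q c"
    and MN: "q < card V \<Longrightarrow> c < lam + 2 \<Longrightarrow> MN A u (q * (lam + 2) + c) = mn_tab q c"
    and MX: "\<rho> \<le> 2 * card V \<Longrightarrow> c < lam + 2 \<Longrightarrow> MX A u (\<rho> * (lam + 2) + c) = mm_tab \<rho> c"
begin

lemma col_less: "i < lam \<Longrightarrow> col zo i x < lam + 2"
  by (auto simp: col_def split: option.splits)

lemma colf_head:
  "e \<in> F \<Longrightarrow> colf A (brk g) (brk_pos g) (pidx e) (Suc (Suc x)) = col (Some g) (pidx e) (Suc x)"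
  using pos_props(1)[of e] by (auto simp: colf_def brk_def brk_pos_def col_def scal_lam)

lemma colf_tail:
  "e \<in> F \<Longrightarrow> colf A (brk g) (brk_pos g) (pidx e) (Suc (ppos e)) = col (Some g) (pidx e) (ppos e)"
  using pos_props(1)[of e] by (auto simp: colf_def brk_def brk_pos_def col_def scal_lam)

lemma hrf_correct:
  assumes "e \<in> S" "e' \<in> S" "top_sep e = Some g"
  shows "hrf A u (sl e) (sl e') \<longleftrightarrow> head_reached e e'"
proof -
  have E: "e \<in> E" "e' \<in> E" using assms keys by auto
  show ?thesis
  proof (cases "e' \<in> F")
    case True
    let ?c = "col (Some g) (pidx e') (Suc (ppos e'))"
    have c: "colf A (GP A u (sl e)) (GL A u (sl e)) (IP A u (sl e')) (JJ A u (sl e') + 1) = ?c"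
      using True colf_head[OF True, of g "ppos e'"] by (simp add: GP[OF assms(1,3)] GL[OF assms(1,3)] IP[OF assms(2)] JJ[OF E(2)])
    show ?thesis
      unfolding hrf_def c using MX[OF row_le[OF E(1)] col_less[OF pos_props(1)[OF True]]] True assms(3)
      by (simp only: ROW[OF assms(1)] scal_W JJ[OF E(2)] head_reached_def if_True simp_thms)
  next
    case False
    \<comment> \<open>Column \<open>lam + 1\<close> of this table is zero, so an edge outside the
      flow is never reported as reached.\<close>
    have c: "colf A (GP A u (sl e)) (GL A u (sl e)) (IP A u (sl e')) (JJ A u (sl e') + 1) = lam + 1"
      using False pos_props(1)[of g]
      by (auto simp: colf_def brk_def brk_pos_def scal_lam GP[OF assms(1,3)] GL[OF assms(1,3)] IP[OF assms(2)] JJ[OF E(2)])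
    have "lam + 1 < lam + 2" by simp
    from MX[OF row_le[OF E(1)] this] show ?thesis
      unfolding hrf_def c ROW[OF assms(1)] scal_W using False
      by (simp add: head_reached_def mm_tab_out)
  qed
qed

lemma dom_top:
  assumes "top_sep e = Some g"
  shows "dom g \<noteq> {}" "he e \<in> dom g"
  using top_sepD(1)[OF assms] by (auto simp: seps_def)

lemma pairf_correct:
  assumes "e1 \<in> E" "e2 \<in> E"
  shows "pairf A u (sl e1) (sl e2) \<longleftrightarrow> paired e1 e2"
proof (cases "top_sep e1 = None \<or> top_sep e2 = None")
  case True
  \<comment> \<open>Without a separator both ends of the stored interval are 0, so the interval is
    empty.\<close>
  then have "\<not> pairf A u (sl e1) (sl e2)" using LO HI assms by (auto simp: pairf_def)
  moreover have "\<not> paired e1 e2" using True by (auto simp: paired_def)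
  ultimately show ?thesis by simp
next
  case False
  then obtain g1 g2 where g: "top_sep e1 = Some g1" "top_sep e2 = Some g2" by auto
  then have S: "e1 \<in> S" "e2 \<in> S" using keys(2) assms by auto
  have "he e1 \<in> V" "he e2 \<in> V" using he_V assms by auto
  then show ?thesis
    unfolding pairf_def paired_iff[OF assms] PB[OF S(1)] PB[OF S(2)]
    using in_dom_iff[OF dom_top(1)[OF g(1)]] in_dom_iff[OF dom_top(1)[OF g(2)]]
      hrf_correct[OF S g(1)] hrf_correct[OF S(2,1) g(2)] g
    by (simp add: LO HI assms)
qed

lemma TT_correct:
  assumes "e \<in> E" "q < card V" "i = IP A u (sl e) \<or> e \<notin> F"
  shows "TT A u (q * scal A 1 + i) < JJ A u (sl e) \<longleftrightarrow> e \<in> F \<and> reach {} (ta e) (vert q)"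
proof (cases "e \<in> F")
  case True
  have i: "i = pidx e" using assms(3) True keys(1) IP by auto
  have p: "pidx e < lam" "ppos e \<le> len (pidx e)" using pos_props[OF True] by auto
  have "TT A u (q * scal A 1 + i) = minreach None (vert q) (pidx e)"
    unfolding scal_W i using TT[OF assms(2), of "pidx e"] p(1) by (simp add: tt_tab_def)
  then show ?thesis
    using minreach_iff[OF p, of None "vert q"] JJ[OF assms(1)] True pos_props(4)[OF True]
    by (simp add: less_Suc_eq_le col_def)
qed (use JJ[OF assms(1)] in simp)

lemma TT_source:
  assumes "q < card V"
  shows "TT A u (q * scal A 1 + (lam + 1)) < 1 \<longleftrightarrow> reach {} s (vert q)"
proof -
  have "lam + 1 < lam + 2" by simp
  from TT[OF assms this] have "TT A u (q * scal A 1 + (lam + 1)) = (if reach {} s (vert q) then 0 else card V)"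
    unfolding scal_W by (simp add: tt_tab_def)
  then show ?thesis using assms by auto
qed

lemma lo_less: "v \<in> dom y \<Longrightarrow> v \<noteq> dst y \<Longrightarrow> lo y < pre v"
  using in_dom_iff[of y v] pre_inj[of v "dst y"] dom_V dst_in_dom[of v y]
  by (fastforce simp: lo_def order_less_le)

text \<open>Induction on preorder numbers along \<open>reach_level\<close>: a tail inside the bridge
  set of the level is answered by the table, and any other question passes to the head of the level.
  At \<open>dst z\<close> the answer is no by \<open>head_unreached\<close>.\<close>

lemma stf_correct:
  assumes "e \<in> S" "z \<in> seps e" "v \<in> dom z"
  shows "stf A u (lo z) (PA A u (sl e)) (IP A u (sl e)) (JJ A u (sl e)) (pre v) \<longleftrightarrow> reach {z} (ta e) v"
  using assms(3)
proof (induction "pre v" arbitrary: v rule: less_induct)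
  case less
  have eE: "e \<in> E" using keys(3) assms(1) by blast
  have vV: "v \<in> V" using less.prems dom_V by blast
  have q: "pre v < card V" using pre_less[OF vV] .
  have taV: "ta e \<in> V" using ta_V eE by blast
  let ?st = "stf A u (lo z) (PA A u (sl e)) (IP A u (sl e)) (JJ A u (sl e))"
  show ?case
  proof (cases "v = dst z")
    case True
    then show ?thesis using head_unreached[OF assms(2)] by (subst stf.simps) (simp add: lo_def)
  next
    case False
    obtain y where y: "lvl v = Some y" using lvl_exists[OF less.prems False] by blast
    have yv: "v \<in> dom y" "v \<noteq> dst y" using lvl_inner[OF y] by (auto simp: inner_def)
    have ne: "dom y \<noteq> {}" using yv by auto
    note rl = reach_level[OF eE assms(2) less.prems y False]
    have y': "lvl (vert (pre v)) = Some y" using y vert_pre[OF vV] by simp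
    have L: "LLO A u (pre v) = lo y" "LHI A u (pre v) = hi y" "LP A u (pre v) = brk y" "LL A u (pre v) = brk_pos y"
      using LLO[OF q] LHI[OF q] LP[OF q y'] LL[OF q y'] y' by simp_all
    have inn: "LLO A u (pre v) \<le> PA A u (sl e) \<and> PA A u (sl e) < LHI A u (pre v) \<longleftrightarrow> ta e \<in> dom y"
      unfolding L PA[OF assms(1)] using in_dom_iff[OF ne taV] by simp
    have nl: "pre v \<noteq> lo z" using False pre_inj[OF vV, of "dst z"] dst_in_dom[OF less.prems] dom_V
      by (auto simp: lo_def)
    have less_y: "lo y < pre v" by (rule lo_less[OF yv])
    show ?thesis
    proof (cases "ta e \<in> dom y")
      case True
      have eF: "e \<in> F"
      proof (rule ccontr)
        assume "e \<notin> F"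
        then have "z = e" "src e = ta e" using seps_nonflow[OF eE] assms(2) by (auto simp: rsrc_def)
        then show False using True rl(1) src_notin_dom[of e] by auto
      qed
      let ?c = "col (Some y) (pidx e) (ppos e)"
      have p: "pidx e < lam" "ppos e \<le> len (pidx e)" using pos_props[OF eF] by auto
      have c: "colf A (LP A u (pre v)) (LL A u (pre v)) (IP A u (sl e)) (JJ A u (sl e)) = ?c"
        unfolding L using colf_tail[OF eF, of y] eF by (simp add: IP[OF assms(1)] JJ[OF eE])
      have "MN A u (pre v * scal A 1 + ?c) = minreach (Some y) v ?c"
        unfolding scal_W using MN[OF q col_less[OF p(1)]] y' vert_pre[OF vV] by (simp add: mn_tab_def)
      then have "?st (pre v) \<longleftrightarrow> minreach (Some y) v ?c < Suc (ppos e)"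
        using nl inn True c JJ[OF eE] eF by (subst stf.simps) simp
      also have "\<dots> \<longleftrightarrow> reach {y} (ta e) v"
        using minreach_iff[OF p, of "Some y" v] pos_props(4)[OF eF] by (simp add: less_Suc_eq_le)
      finally show ?thesis using rl(3) True by simp
    next
      case nin: False
      have "?st (pre v) \<longleftrightarrow> ?st (lo y)"
        using nl inn nin less_y L by (subst stf.simps) auto
      also have "\<dots> \<longleftrightarrow> reach {z} (ta e) (dst y)"
        using less.hyps[OF _ rl(2)] less_y by (simp add: lo_def)
      finally show ?thesis using rl(3) nin by simp
    qed
  qed
qed

lemma LLO_bound:
  assumes "q < card V"
  shows "LLO A u q < q \<or> (LLO A u q = 0 \<and> LHI A u q = card V)"
proof (cases "lvl (vert q)")
  case (Some y)
  then have "vert q \<in> dom y" "vert q \<noteq> dst y" using lvl_inner[OF Some] by (auto simp: inner_def)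
  then have "lo y < q" using lo_less pre_vert[OF assms] by fastforce
  then show ?thesis using Some LLO[OF assms] by simp
qed (use LLO[OF assms] LHI[OF assms] in simp)

lemma interval_mono:
  assumes "dom g \<subseteq> dom g'" "dom g \<noteq> {}"
  shows "lo g' \<le> lo g" "hi g \<le> hi g'"
proof -
  have "{lo g..<hi g} \<subseteq> {lo g'..<hi g'}"
    using pre_dom[OF assms(2)] pre_dom[of g'] assms by (metis image_mono subset_empty)
  moreover have "lo g < hi g"
    using assms(2) finite_dom[of g] by (simp add: lo_def hi_def card_gt_0_iff)
  ultimately show "lo g' \<le> lo g" "hi g \<le> hi g'"
    using atLeastLessThan_subset_iff by fastforce+
qed

lemma pair_bit:
  assumes E: "e1 \<in> E" "e2 \<in> E" "e1 \<noteq> e2" and p: "paired e1 e2" and v: "v \<in> V"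
  defines "l \<equiv> max (LO A u (sl e1)) (LO A u (sl e2))" and "h \<equiv> min (HI A u (sl e1)) (HI A u (sl e2))"
  shows "(if l \<le> pre v \<and> pre v < h
      then stf A u l (PA A u (sl e1)) (IP A u (sl e1)) (JJ A u (sl e1)) (pre v) \<or>
        stf A u l (PA A u (sl e2)) (IP A u (sl e2)) (JJ A u (sl e2)) (pre v)
      else TT A u (pre v * scal A 1 + IP A u (sl e1)) < JJ A u (sl e1) \<or>
        TT A u (pre v * scal A 1 + IP A u (sl e2)) < JJ A u (sl e2))
    \<longleftrightarrow> v \<in> pair_cut (pair_sep e1 e2) (ta e1) (ta e2)"
proof -
  obtain g1 g2 where g: "top_sep e1 = Some g1" "top_sep e2 = Some g2" "he e1 \<in> dom g2"
    using p by (auto simp: paired_def)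
  have S: "e1 \<in> S" "e2 \<in> S" using keys(2) E g by auto
  define z where "z = pair_sep e1 e2"
  note ps = pair_sep[OF E(1,2) p, folded z_def]
  have z: "z = (if dom g1 \<subseteq> dom g2 then g1 else g2)" by (simp add: z_def pair_sep_def g)
  have nest: "dom g1 \<subseteq> dom g2 \<or> dom g2 \<subseteq> dom g1" using dom_nested dom_top(2)[OF g(1)] g(3) by blast
  note ne = dom_top(1)[OF g(1)] dom_top(1)[OF g(2)]
  have lh: "l = lo z" "h = hi z"
    using nest interval_mono[of g1 g2] interval_mono[of g2 g1] ne
    by (auto simp: l_def h_def z LO HI E g max_def min_def)
  have hz: "he e1 \<in> dom z" "he e2 \<in> dom z" using ps(1,2) by (auto simp: seps_def)
  then have "dom z \<noteq> {}" by auto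
  then have inn: "l \<le> pre v \<and> pre v < h \<longleftrightarrow> v \<in> dom z" using in_dom_iff v lh by simp
  have q: "pre v < card V" by (rule pre_less[OF v])
  have c: "conn (ta e1) (ta e2)"
    using seps_conn[OF E(1) ps(1)] seps_conn[OF E(2) ps(2)] dom_conn[OF hz] conn_sym conn_trans by blast
  \<comment> \<open>Outside the flow an edge has no separator but itself, so two distinct edges with
    a common one are not both there. The tails are mutually reachable, hence one flow edge decides
    full reachability, while an edge outside the flow contributes nothing to the tables.\<close>
  have "e1 \<in> F \<or> e2 \<in> F"
    using seps_nonflow E ps(1,2) by blast
  then have "(e1 \<in> F \<and> reach {} (ta e1) v) \<or> (e2 \<in> F \<and> reach {} (ta e2) v) \<longleftrightarrow>
      reach {} (ta e1) v \<or> reach {} (ta e2) v"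
    using c by (auto simp: conn_def intro: reach_trans)
  then show ?thesis
    using v vert_pre[OF v]
    unfolding inn unfolding lh(1) TT_correct[OF E(1) q disjI1[OF refl]] TT_correct[OF E(2) q disjI1[OF refl]]
    by (cases "v \<in> dom z")
      (simp_all add: stf_correct[OF S(1) ps(1)] stf_correct[OF S(2) ps(2)] pair_cut_def flip: z_def)
qed

end

section \<open>Assembling the data structure\<close>

lemma reach_converse:
  assumes "Q' = Q\<inverse>"
  shows "arc_relation.reach E dst src Q' X u v \<longleftrightarrow> arc_relation.reach E src dst Q X v u"
proof -
  have "arc_relation.rel E dst src Q' X = (arc_relation.rel E src dst Q X)\<inverse>"
    using assms by (auto simp: arc_relation.rel_def)
  then show ?thesis by (simp add: arc_relation.reach_def rtrancl_converse)
qed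

lemma (in path_system) reversed:
  "path_system V E he ta t s F lam (\<lambda>i x. P i (len i - x)) (\<lambda>i x. pe i (len i - Suc x)) len"
proof -
  interpret R: network V E he ta t s
    using finite_V finite_E ta_V he_V s_V t_V s_neq_t by unfold_locales auto
  have sw: "R.rsrc F = rdst F" "R.rdst F = rsrc F"
    by (auto simp: R.rsrc_def R.rdst_def rsrc_def rdst_def fun_eq_iff)
  show ?thesis
  proof
    show "F \<subseteq> E" by (rule F_E)
    show "pe i (len i - Suc x) \<in> F" if "i < lam" "x < len i" for i x
      using pe_F[OF that(1), of "len i - Suc x"] that by simp
    show "he (pe i (len i - Suc x)) = P i (len i - x)" if "i < lam" "x < len i" for i x
      using he_pe[OF that(1), of "len i - Suc x"] that by (simp add: Suc_diff_Suc)
    show "ta (pe i (len i - Suc x)) = P i (len i - Suc x)" if "i < lam" "x < len i" for i x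
      using ta_pe[OF that(1), of "len i - Suc x"] that by simp
    show "P i (len i - x) \<in> V" if "i < lam" "x \<le> len i" for i x
      using P_V[OF that(1)] by simp
    show "\<exists>i<lam. \<exists>x<len i. e = pe i (len i - Suc x)" if e: "e \<in> F" for e
    proof -
      obtain i x where "i < lam" "x < len i" "e = pe i x" using F_pe[OF e] by blast
      then show ?thesis by (intro exI[of _ i] conjI exI[of _ "len i - Suc x"]) auto
    qed
    show "i = i' \<and> x = x'" if "i < lam" "i' < lam" "x < len i" "x' < len i'"
      "pe i (len i - Suc x) = pe i' (len i' - Suc x')" for i i' x x'
    proof -
      have "i = i' \<and> len i - Suc x = len i' - Suc x'"
        by (rule pe_inj) (use that in auto)
      then show ?thesis using that by auto
    qed
    show "len i < card V" if "i < lam" for i by (rule len_less[OF that])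
    show "\<not> arc_relation.reach E (R.rsrc F) (R.rdst F) {} {} t s"
    proof -
      have "arc_relation.reach E (rdst F) (rsrc F) {} {} t s \<longleftrightarrow> arc_relation.reach E (rsrc F) (rdst F) {} {} s t"
        by (rule reach_converse) simp
      then show ?thesis unfolding sw using no_augment by blast
    qed
  qed
qed

lemma ex_two_sided:
  assumes "network V E ta he s t"
  shows "\<exists>F lam P pe len r P' pe'. two_sided V E ta he s t F lam P pe len r P' pe'"
proof -
  interpret network V E ta he s t by fact
  obtain F lam P pe len where ps: "path_system V E ta he s t F lam P pe len" and fl: "is_flow F lam"
    using ex_path_system by blast
  interpret P: path_system V E ta he s t F lam P pe len by fact
  let ?Q = "{t} \<times> V \<union> V \<times> {s}"
  let ?Q' = "{s} \<times> V \<union> V \<times> {t}"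
  interpret A: arc_relation E "rsrc F" "rdst F" ?Q .
  interpret R: path_system V E he ta t s F lam "\<lambda>i x. P i (len i - x)" "\<lambda>i x. pe i (len i - Suc x)" len
    by (rule P.reversed)
  have sw: "R.rsrc F = rdst F" "R.rdst F = rsrc F"
    by (auto simp: R.rsrc_def R.rdst_def rsrc_def rdst_def fun_eq_iff)
  interpret B: arc_relation E "R.rsrc F" "R.rdst F" ?Q' .
  have conv: "B.reach X u v \<longleftrightarrow> A.reach X v u" for X u v
    unfolding sw by (rule reach_converse) auto
  \<comment> \<open>The choice depends only on the component, and reversal of all arcs preserves
    mutual reachability; so the same root is valid in both directions.\<close>
  define r where "r v = (SOME u. A.conn v u)" for v
  have refl: "A.conn v v" for v by (simp add: A.conn_def)
  have root: "A.conn v (r v)" for v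
    unfolding r_def by (rule someI[of _ v]) (rule refl)
  have eq: "r u = r v" if "A.conn u v" for u v
  proof -
    have "A.conn u = A.conn v" using that A.conn_trans A.conn_sym by blast
    then show ?thesis by (simp add: r_def)
  qed
  have N: "residual V E ta he s t F lam P pe len r"
    by (intro residual.intro ps rooted_arc_relation.intro root eq)
  have conn: "B.conn u v \<longleftrightarrow> A.conn u v" for u v
    by (auto simp: A.conn_def B.conn_def conv)
  have "residual V E he ta t s F lam (\<lambda>i x. P i (len i - x)) (\<lambda>i x. pe i (len i - Suc x)) len r"
    by (intro residual.intro P.reversed rooted_arc_relation.intro) (use root eq conn in auto)
  then have "two_sided V E ta he s t F lam P pe len r (\<lambda>i x. P i (len i - x)) (\<lambda>i x. pe i (len i - Suc x))"
    using N fl by (simp add: two_sided_def two_sided_axioms_def)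
  then show ?thesis by blast
qed

context residual
begin

definition edge_tab :: "nat \<Rightarrow> 'e \<Rightarrow> nat" where
  "edge_tab j e = (if j = 0 then pre (ta e) else if j = 1 then pre (he e)
     else if j = 2 then (if e \<in> F then pidx e else lam + 1)
     else if j = 3 then (if e \<in> F then Suc (ppos e) else 0)
     else if j = 4 then (case top_sep e of None \<Rightarrow> 0 | Some g \<Rightarrow> lo g)
     else if j = 5 then (case top_sep e of None \<Rightarrow> 0 | Some g \<Rightarrow> hi g)
     else if j = 6 then row e
     else if j = 7 then (case top_sep e of None \<Rightarrow> lam | Some g \<Rightarrow> brk g)
     else (case top_sep e of None \<Rightarrow> 0 | Some g \<Rightarrow> brk_pos g))"

text \<open>Column \<open>lam + 1\<close> and row \<open>2 * card V\<close> are neutral; the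
  thresholds and intervals are empty.\<close>

definition null_tab :: "nat \<Rightarrow> nat" where
  "null_tab j = (if j = 2 then lam + 1 else if j = 6 then 2 * card V else 0)"

definition vert_tab :: "nat \<Rightarrow> nat \<Rightarrow> nat" where
  "vert_tab j q = (if j = 9 then (case lvl (vert q) of None \<Rightarrow> 0 | Some y \<Rightarrow> lo y)
     else if j = 10 then (case lvl (vert q) of None \<Rightarrow> card V | Some y \<Rightarrow> hi y)
     else if j = 11 then (case lvl (vert q) of None \<Rightarrow> lam | Some y \<Rightarrow> brk y)
     else (case lvl (vert q) of None \<Rightarrow> 0 | Some y \<Rightarrow> brk_pos y))"

definition side_tab :: "(nat \<Rightarrow> 'e option) \<Rightarrow> nat \<Rightarrow> nat \<Rightarrow> nat" where
  "side_tab dec j i = (if j \<le> 8 then (case dec i of None \<Rightarrow> null_tab j | Some e \<Rightarrow> edge_tab j e)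
     else if j \<le> 12 then (if i < card V then vert_tab j i else 0)
     else if j = 13 then (if i div (lam + 2) < card V then tt_tab (i div (lam + 2)) (i mod (lam + 2)) else 0)
     else if j = 14 then mm_tab (i div (lam + 2)) (i mod (lam + 2))
     else if i div (lam + 2) < card V then mn_tab (i div (lam + 2)) (i mod (lam + 2)) else 0)"

lemma brk_le: "brk g \<le> lam" "brk_pos g \<le> card V"
  using pos_props(1,2)[of g] len_less[of "pidx g"] by (auto simp: brk_def brk_pos_def)

lemma lo_hi_le: "dom g \<noteq> {} \<Longrightarrow> lo g \<le> card V" "dom g \<noteq> {} \<Longrightarrow> hi g \<le> card V"
  using hi_le[of g] by (auto simp: lo_def hi_def)

lemma edge_tab_le:
  assumes "e \<in> E"
  shows "edge_tab j e \<le> 2 * card V + lam + 1"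
proof -
  define b where "b = 2 * card V + lam + 1"
  have "lo g \<le> b \<and> hi g \<le> b" if "top_sep e = Some g" for g
  proof -
    have "dom g \<noteq> {}" using top_sepD(1)[OF that] by (auto simp: seps_def)
    then show ?thesis using lo_hi_le[of g] unfolding b_def by linarith
  qed
  moreover have "pre (ta e) \<le> b" "pre (he e) \<le> b"
    using pre_less[OF ta_V[OF assms]] pre_less[OF he_V[OF assms]] unfolding b_def by linarith+
  moreover have "pidx e \<le> b \<and> Suc (ppos e) \<le> b" if "e \<in> F"
    using pos_props(1,2)[OF that] len_less[OF pos_props(1)[OF that]] unfolding b_def by linarith
  moreover have "row e \<le> b" using row_le[OF assms] unfolding b_def by linarith
  moreover have "brk g \<le> b" "brk_pos g \<le> b" for g using brk_le[of g] unfolding b_def by linarith+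
  moreover have "lam + 1 \<le> b" "lam \<le> b" unfolding b_def by linarith+
  ultimately have "edge_tab j e \<le> b" by (simp add: edge_tab_def split: option.split)
  then show ?thesis by (simp only: b_def)
qed

lemma vert_tab_le: "vert_tab j q \<le> 2 * card V + lam + 1"
proof -
  define b where "b = 2 * card V + lam + 1"
  have "lo g \<le> b \<and> hi g \<le> b" if "lvl (vert q) = Some g" for g
  proof -
    have "dom g \<noteq> {}" using lvl_inner[OF that] by (auto simp: inner_def)
    then show ?thesis using lo_hi_le[of g] unfolding b_def by linarith
  qed
  moreover have "brk g \<le> b" "brk_pos g \<le> b" for g using brk_le[of g] unfolding b_def by linarith+
  moreover have "card V \<le> b" "lam \<le> b" unfolding b_def by linarith+
  ultimately have "vert_tab j q \<le> b" by (simp add: vert_tab_def split: option.split)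
  then show ?thesis by (simp only: b_def)
qed

lemma side_tab_le:
  assumes "\<And>i e. dec i = Some e \<Longrightarrow> e \<in> E"
  shows "side_tab dec j i \<le> 2 * card V + lam + 1"
proof -
  have "minreach zo v c \<le> 2 * card V + lam + 1" for zo v c using minreach_le[of zo v c] by linarith
  moreover have "mm_tab \<rho> c \<le> 2 * card V + lam + 1" for \<rho> c using mm_tab_le[of \<rho> c] by linarith
  moreover have "null_tab j \<le> 2 * card V + lam + 1" by (simp add: null_tab_def)
  ultimately show ?thesis
    using edge_tab_le[OF assms] vert_tab_le
    by (auto simp: side_tab_def tt_tab_def mn_tab_def split: option.split)
qed

lemma card_flow: "card F \<le> lam * card V"
proof -
  have "F \<subseteq> (\<lambda>(i, x). pe i x) ` ({..<lam} \<times> {..<card V})"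
  proof
    fix e assume "e \<in> F"
    then obtain i x where "i < lam" "x < len i" "e = pe i x" using F_pe by blast
    then show "e \<in> (\<lambda>(i, x). pe i x) ` ({..<lam} \<times> {..<card V})"
      using len_less[of i] by (intro image_eqI[of _ _ "(i, x)"]) auto
  qed
  then have "card F \<le> card ((\<lambda>(i, x). pe i x) ` ({..<lam} \<times> {..<card V}))"
    by (intro card_mono) auto
  also have "\<dots> \<le> card ({..<lam} \<times> {..<card V})" by (intro card_image_le) auto
  finally show ?thesis by (simp add: card_cartesian_product)
qed

text \<open>Such an edge is its own outermost separator and therefore a bridge, and bridges have
  distinct heads.\<close>

lemma card_bridges: "card {e \<in> E - F. top_sep e \<noteq> None} \<le> card V"
proof -
  have "inj_on dst {e \<in> E - F. top_sep e \<noteq> None}"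
  proof (rule inj_onI)
    fix e e' assume e: "e \<in> {e \<in> E - F. top_sep e \<noteq> None}" "e' \<in> {e \<in> E - F. top_sep e \<noteq> None}"
      and eq: "dst e = dst e'"
    have "he e \<in> dom e" if b: "e \<in> E - F" "top_sep e \<noteq> None" for e
    proof -
      obtain g where g: "top_sep e = Some g" using b(2) by blast
      then have "g = e" using top_sep_nonflow b(1) by blast
      then show ?thesis using top_sepD(1)[OF g] by (simp add: seps_def)
    qed
    then show "e = e'" using dom_same_dst e eq by blast
  qed
  moreover have "dst ` {e \<in> E - F. top_sep e \<noteq> None} \<subseteq> V" using dst_V by auto
  ultimately show ?thesis using card_inj_on_le finite_V by blast
qed

end

context two_sided
begin

text \<open>Any other edge lies outside the flow and has no separator in either direction, which is
  what the default record says.\<close>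

definition keys :: "'e set" where
  "keys = F \<union> {e \<in> E - F. N.top_sep e \<noteq> None} \<union> {e \<in> E - F. R.top_sep e \<noteq> None}"

lemma card_keys: "card keys \<le> 3 * (max 1 lam * card V)"
proof -
  have "card keys \<le> card (F \<union> {e \<in> E - F. N.top_sep e \<noteq> None}) + card {e \<in> E - F. R.top_sep e \<noteq> None}"
    unfolding keys_def by (rule card_Un_le)
  also have "\<dots> \<le> (card F + card {e \<in> E - F. N.top_sep e \<noteq> None}) + card {e \<in> E - F. R.top_sep e \<noteq> None}"
    by (intro add_right_mono card_Un_le)
  also have "\<dots> \<le> lam * card V + card V + card V"
    using N.card_flow N.card_bridges R.card_bridges by linarith
  also have "\<dots> \<le> 3 * (max 1 lam * card V)"
  proof -
    have "lam * card V \<le> max 1 lam * card V" "1 * card V \<le> max 1 lam * card V"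
      by (intro mult_le_mono; simp)+
    then show ?thesis by linarith
  qed
  finally show ?thesis .
qed

lemma keys_E: "keys \<subseteq> E" using N.F_E by (auto simp: keys_def)

lemma lam_le: "lam \<le> card E" by (rule N.flow_value_le[OF flow])

end

lemma two_cases: "(u::nat) < 2 \<Longrightarrow> (u = 0 \<Longrightarrow> Q) \<Longrightarrow> (u = 1 \<Longrightarrow> Q) \<Longrightarrow> Q"
  by linarith

lemma div_mod_row:
  fixes c k q :: nat
  assumes "c < k"
  shows "(q * k + c) div k = q" "(q * k + c) mod k = c"
  using assms by simp_all

lemma (in residual) side_tab_bounds:
  assumes "\<And>i e. dec i = Some e \<Longrightarrow> e \<in> E"
  shows "side_tab dec 0 i < card V" "side_tab dec 1 i < card V" "side_tab dec 2 i < lam + 2"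
    "side_tab dec 6 i \<le> 2 * card V"
proof -
  have "0 < card V" using s_V finite_V card_gt_0_iff by blast
  moreover have "dec i = Some e \<Longrightarrow> pre (ta e) < card V \<and> pre (he e) < card V \<and> row e \<le> 2 * card V" for e
    using pre_less[OF ta_V[OF assms]] pre_less[OF he_V[OF assms]] row_le[OF assms] by blast
  moreover have "e \<in> F \<Longrightarrow> pidx e < lam + 2" for e using pos_props(1)[of e] by simp
  ultimately show "side_tab dec 0 i < card V" "side_tab dec 1 i < card V" "side_tab dec 2 i < lam + 2"
    "side_tab dec 6 i \<le> 2 * card V"
    by (auto simp: side_tab_def edge_tab_def null_tab_def split: option.split)
qed

locale query_structure = two_sided "{..<n}" "{..<m}" ta he s t F lam P pe len r P' pe'
  for n m :: nat and ta he :: "nat \<Rightarrow> nat" and s t :: nat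
    and F lam P pe len r P' pe' +
  fixes w N0 X a0 :: nat and ha hm off :: "nat \<Rightarrow> nat"
  assumes N0: "N0 = 3 * (max 1 lam * n)"
    and a0: "a0 < N0 * Suc m"
    and hash_ok: "i < N0 \<Longrightarrow> ha i < hm i * Suc m \<and> 0 < hm i \<and> hm i \<le> 4 * N0 * N0 + 1 \<and> off i + hm i \<le> 21 * N0"
    and hash_inj: "inj_on (\<lambda>x. off (hash (Suc m) N0 a0 x) +
      hash (Suc m) (hm (hash (Suc m) N0 a0 x)) (ha (hash (Suc m) N0 a0 x)) x) keys"
    and w_pos: "0 < w" and w_X: "w - 1 < X" and X_big: "100 * (X * X) \<le> 2 ^ (w - 1)"
    and X_ge: "(4 * N0 * N0 + 1) * Suc m < X" "3200 * (max 1 lam * n) < X" "2 * n + lam + 2 < X" "Suc m < X"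
begin

text \<open>There must be room for \<open>21 * N0 = 63 * (max 1 lam * n)\<close> hash cells after
  slot 0, and for \<open>2 * n + 1\<close> rows of \<open>lam + 2\<close> entries, which are at most
  \<open>9 * (max 1 lam * n)\<close>.\<close>

definition Z :: nat where "Z = 80 * (max 1 lam * n)"

definition place :: "nat \<Rightarrow> nat" where
  "place x = off (hash (Suc m) N0 a0 x) +
     hash (Suc m) (hm (hash (Suc m) N0 a0 x)) (ha (hash (Suc m) N0 a0 x)) x"

text \<open>The inverse of \<open>place\<close> on the keys. The default \<open>m\<close> is no edge
  number and marks an empty cell.\<close>

definition key :: "nat \<Rightarrow> nat" where
  "key c = (if \<exists>x\<in>keys. place x = c then SOME x. x \<in> keys \<and> place x = c else m)"

text \<open>Cell \<open>c\<close> belongs to slot \<open>c + 1\<close>, because slot 0 is taken by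
  the default record.\<close>

definition dec :: "nat \<Rightarrow> nat option" where
  "dec i = (if i \<noteq> 0 \<and> key (i - 1) < m then Some (key (i - 1)) else None)"

definition scalar :: "nat \<Rightarrow> nat" where
  "scalar j = (if j = 0 then n else if j = 1 then lam + 2 else if j = 2 then lam
     else if j = 3 then Suc m else if j = 4 then N0 * Suc m else if j = 5 then a0
     else if j = 6 then w - 1 else if j = 7 then 40 * Z else if j = 8 then lam - 1
     else if j = 9 then lam - 2 else 0)"

definition A :: arrays where
  "A a i = (if a = 0 then scalar i
     else if a = 1 then if i < N0 then off i else 0
     else if a = 2 then if i < N0 then ha i else 0
     else if a = 3 then if i < N0 then hm i * Suc m else 0
     else if a = 4 then key i
     else if a = 5 then (case dec i of None \<Rightarrow> 0 | Some e \<Rightarrow> of_bool (in_min_cut e))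
     else if a = 38 then if i < n then N.pre i else 0
     else if a = 39 then if i < n then R.pre i else 0
     else if even a then N.side_tab dec ((a - 6) div 2) i else R.side_tab dec ((a - 6) div 2) i)"

lemma n_pos: "1 \<le> n" using N.s_V by simp

lemma place_key: "x \<in> keys \<Longrightarrow> key (place x) = x"
proof -
  assume x: "x \<in> keys"
  then have ex: "\<exists>x'. x' \<in> keys \<and> place x' = place x" by blast
  have "key (place x) \<in> keys \<and> place (key (place x)) = place x"
    using someI_ex[OF ex] x by (auto simp: key_def)
  then show ?thesis using hash_inj x unfolding inj_on_def place_def[symmetric] by blast
qed

lemma key_cases: "key c \<in> keys \<or> key c = m"
proof (cases "\<exists>x\<in>keys. place x = c")
  case True
  then have "\<exists>x. x \<in> keys \<and> place x = c" by blast
  from someI_ex[OF this] show ?thesis using True by (simp add: key_def)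
qed (simp add: key_def)

lemma key_le: "key c \<le> m"
  using key_cases[of c] keys_E by auto

lemma dec_E: "dec i = Some e \<Longrightarrow> e \<in> {..<m}"
  by (auto simp: dec_def split: if_splits)

lemma dec_place: "x < m \<Longrightarrow> dec (if x \<in> keys then Suc (place x) else 0) = (if x \<in> keys then Some x else None)"
  by (simp add: dec_def place_key)

lemma N0_pos: "0 < N0" using n_pos by (simp add: N0)

lemma hash_N0: "hash (Suc m) N0 a0 x < N0"
  by (rule hash_less) (use N0_pos in auto)

lemma place_less: "place x < 21 * N0"
proof -
  let ?b = "hash (Suc m) N0 a0 x"
  have "hash (Suc m) (hm ?b) (ha ?b) x < hm ?b"
    by (rule hash_less) (use hash_ok[OF hash_N0] in auto)
  then show ?thesis using hash_ok[OF hash_N0, of x] by (simp add: place_def)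
qed

lemma cell_place: "cell A x = place x"
proof -
  have b: "scal A 5 * x mod scal A 4 div scal A 3 = hash (Suc m) N0 a0 x"
    by (simp add: A_def scalar_def hash_def)
  have s: "scal A 3 = Suc m" by (simp add: A_def scalar_def)
  have "A 1 i = off i" "A 2 i = ha i" "A 3 i = hm i * Suc m" if "i < N0" for i
    using that by (simp_all add: A_def)
  note this[OF hash_N0[of x]]
  then show ?thesis unfolding cell_def Let_def b unfolding s place_def by (simp only: hash_def)
qed

lemma slot_keys: "x < m \<Longrightarrow> slot A x = (if x \<in> keys then Suc (place x) else 0)"
proof -
  assume x: "x < m"
  have "A 4 c = key c" for c by (simp add: A_def)
  moreover have "x \<in> keys" if "key (place x) = x" using key_cases[of "place x"] that x by auto
  ultimately show ?thesis using place_key by (auto simp: slot_def cell_place)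
qed

lemma dec_slot: "x < m \<Longrightarrow> dec (slot A x) = (if x \<in> keys then Some x else None)"
  by (simp only: slot_keys dec_place)

lemma A_side: "j < 16 \<Longrightarrow> fld j A 0 i = N.side_tab dec j i" "j < 16 \<Longrightarrow> fld j A 1 i = R.side_tab dec j i"
  by (auto simp: fld_def A_def)

lemma A_less: "A a i < X"
proof -
  have "N.side_tab dec j i < X" "R.side_tab dec j i < X" for j
    using N.side_tab_le[of dec j i] R.side_tab_le[of dec j i] dec_E X_ge(3) by fastforce+
  moreover have "scalar i < X"
  proof -
    have "N0 * Suc m \<le> (4 * N0 * N0 + 1) * Suc m"
      by (rule mult_le_mono1) (use N0_pos in \<open>cases N0; simp\<close>)
    then have f1: "N0 * Suc m < X" using X_ge(1) by linarith
    have f2: "a0 < X" using a0 f1 by linarith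
    have f3: "40 * Z < X" using X_ge(2) by (simp add: Z_def)
    have f4: "n < X" "lam + 2 < X" "lam < X" "lam - 1 < X" "lam - 2 < X" "0 < X"
      using X_ge(3) by linarith+
    have if_less: "(if p then x else y) < X" if "x < X" "y < X" for p x y using that by simp
    show ?thesis unfolding scalar_def by (intro if_less f1 f2 f3 f4 X_ge(4) w_X)
  qed
  moreover have "off i < X \<and> ha i < X \<and> hm i * Suc m < X" if i: "i < N0"
  proof -
    have "hm i * Suc m \<le> (4 * N0 * N0 + 1) * Suc m" using hash_ok[OF i] by (intro mult_le_mono1) simp
    moreover have "off i \<le> 63 * (max 1 lam * n)" using hash_ok[OF i] N0 by linarith
    moreover have "63 * (max 1 lam * n) \<le> 3200 * (max 1 lam * n)" by (rule mult_le_mono1) simp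
    ultimately show ?thesis using hash_ok[OF i] X_ge(1,2) by linarith
  qed
  moreover have "key i < X" using key_le[of i] X_ge(4) by linarith
  moreover have "N.pre i < X" "R.pre i < X" if "i < n"
    using N.pre_less[of i] R.pre_less[of i] that X_ge(3) by auto
  moreover have "0 < X" "of_bool p < X" for p using X_ge(3) by (cases p; simp)+
  ultimately show ?thesis by (auto simp: A_def split: option.split)
qed

lemma keys_props: "e \<in> F \<Longrightarrow> e \<in> keys" "e < m \<Longrightarrow> N.top_sep e \<noteq> None \<Longrightarrow> e \<in> keys"
  "e < m \<Longrightarrow> R.top_sep e \<noteq> None \<Longrightarrow> e \<in> keys" "e \<in> keys \<Longrightarrow> e < m"
  using keys_E by (auto simp: keys_def)

end

sublocale query_structure \<subseteq> N: side_tables "{..<n}" "{..<m}" ta he s t F lam P pe len r A 0 "slot A" keys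
proof
  show "scal A 1 = lam + 2" "scal A 2 = lam" by (simp_all add: A_def scalar_def)
  show "e \<in> keys" if "e \<in> F" for e by (rule keys_props(1)[OF that])
  show "e \<in> keys" if "e \<in> {..<m}" "N.top_sep e \<noteq> None" for e using keys_props(2) that by simp
  show "e \<in> {..<m}" if "e \<in> keys" for e using keys_props(4) that by simp
  show "PA A 0 (slot A e) = N.pre (ta e)" "PB A 0 (slot A e) = N.pre (he e)"
    "IP A 0 (slot A e) = (if e \<in> F then N.pidx e else lam + 1)" "ROW A 0 (slot A e) = N.row e"
    if "e \<in> keys" for e
    using dec_slot[OF keys_props(4)[OF that]] that by (simp_all add: A_side N.side_tab_def N.edge_tab_def)
  show "JJ A 0 (slot A e) = (if e \<in> F then Suc (N.ppos e) else 0)"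
    "LO A 0 (slot A e) = (case N.top_sep e of None \<Rightarrow> 0 | Some g \<Rightarrow> N.lo g)"
    "HI A 0 (slot A e) = (case N.top_sep e of None \<Rightarrow> 0 | Some g \<Rightarrow> N.hi g)" if "e \<in> {..<m}" for e
    using dec_slot[of e] that keys_props(1,2)[of e]
    by (auto simp: A_side N.side_tab_def N.edge_tab_def N.null_tab_def split: option.split)
  show "GP A 0 (slot A e) = N.brk g" "GL A 0 (slot A e) = N.brk_pos g"
    if "e \<in> keys" "N.top_sep e = Some g" for e g
    using dec_slot[OF keys_props(4)[OF that(1)]] that by (simp_all add: A_side N.side_tab_def N.edge_tab_def)
  show "LLO A 0 q = (case N.lvl (N.vert q) of None \<Rightarrow> 0 | Some y \<Rightarrow> N.lo y)"
    "LHI A 0 q = (case N.lvl (N.vert q) of None \<Rightarrow> card {..<n} | Some y \<Rightarrow> N.hi y)" if "q < card {..<n}" for q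
    using that by (simp_all add: A_side N.side_tab_def N.vert_tab_def)
  show "LP A 0 q = N.brk y" "LL A 0 q = N.brk_pos y" if "q < card {..<n}" "N.lvl (N.vert q) = Some y" for q y
    using that by (simp_all add: A_side N.side_tab_def N.vert_tab_def)
  show "TT A 0 (q * (lam + 2) + c) = N.tt_tab q c" "MN A 0 (q * (lam + 2) + c) = N.mn_tab q c"
    if "q < card {..<n}" "c < lam + 2" for q c
    using that div_mod_row[OF that(2)] by (simp_all only: A_side N.side_tab_def) simp_all
  show "MX A 0 (\<rho> * (lam + 2) + c) = N.mm_tab \<rho> c" if "\<rho> \<le> 2 * card {..<n}" "c < lam + 2" for \<rho> c
    using that div_mod_row[OF that(2)] by (simp_all only: A_side N.side_tab_def) simp_all
qed

sublocale query_structure \<subseteq> R: side_tables "{..<n}" "{..<m}" he ta t s F lam P' pe' len r A 1 "slot A" keys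
proof
  show "scal A 1 = lam + 2" "scal A 2 = lam" by (simp_all add: A_def scalar_def)
  show "e \<in> keys" if "e \<in> F" for e by (rule keys_props(1)[OF that])
  show "e \<in> keys" if "e \<in> {..<m}" "R.top_sep e \<noteq> None" for e using keys_props(3) that by simp
  show "e \<in> {..<m}" if "e \<in> keys" for e using keys_props(4) that by simp
  show "PA A 1 (slot A e) = R.pre (he e)" "PB A 1 (slot A e) = R.pre (ta e)"
    "IP A 1 (slot A e) = (if e \<in> F then R.pidx e else lam + 1)" "ROW A 1 (slot A e) = R.row e"
    if "e \<in> keys" for e
    using dec_slot[OF keys_props(4)[OF that]] that
    by (simp_all only: A_side) (simp_all add: R.side_tab_def R.edge_tab_def)
  show "JJ A 1 (slot A e) = (if e \<in> F then Suc (R.ppos e) else 0)"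
    "LO A 1 (slot A e) = (case R.top_sep e of None \<Rightarrow> 0 | Some g \<Rightarrow> R.lo g)"
    "HI A 1 (slot A e) = (case R.top_sep e of None \<Rightarrow> 0 | Some g \<Rightarrow> R.hi g)" if "e \<in> {..<m}" for e
    using dec_slot[of e] that keys_props(1,3)[of e]
    by (auto simp: A_side[simplified] R.side_tab_def R.edge_tab_def R.null_tab_def split: option.split)
  show "GP A 1 (slot A e) = R.brk g" "GL A 1 (slot A e) = R.brk_pos g"
    if "e \<in> keys" "R.top_sep e = Some g" for e g
    using dec_slot[OF keys_props(4)[OF that(1)]] that
    by (simp_all add: A_side[simplified] R.side_tab_def R.edge_tab_def)
  show "LLO A 1 q = (case R.lvl (R.vert q) of None \<Rightarrow> 0 | Some y \<Rightarrow> R.lo y)"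
    "LHI A 1 q = (case R.lvl (R.vert q) of None \<Rightarrow> card {..<n} | Some y \<Rightarrow> R.hi y)" if "q < card {..<n}" for q
    using that by (simp_all add: A_side[simplified] R.side_tab_def R.vert_tab_def)
  show "LP A 1 q = R.brk y" "LL A 1 q = R.brk_pos y" if "q < card {..<n}" "R.lvl (R.vert q) = Some y" for q y
    using that by (simp_all add: A_side[simplified] R.side_tab_def R.vert_tab_def)
  show "TT A 1 (q * (lam + 2) + c) = R.tt_tab q c" "MN A 1 (q * (lam + 2) + c) = R.mn_tab q c"
    if "q < card {..<n}" "c < lam + 2" for q c
    using that div_mod_row[OF that(2)]
    by (simp_all only: A_side(2)[of 13 "q * (lam + 2) + c"] A_side(2)[of 15 "q * (lam + 2) + c"] R.side_tab_def) simp_all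
  show "MX A 1 (\<rho> * (lam + 2) + c) = R.mm_tab \<rho> c" if "\<rho> \<le> 2 * card {..<n}" "c < lam + 2" for \<rho> c
    using that div_mod_row[OF that(2)]
    by (simp_all only: A_side(2)[of 14 "\<rho> * (lam + 2) + c"] R.side_tab_def) simp_all
qed

context query_structure
begin

lemma Z_rows: "c < lam + 2 \<Longrightarrow> q \<le> 2 * n \<Longrightarrow> q * (lam + 2) + c < Z"
proof -
  assume c: "c < lam + 2" and q: "q \<le> 2 * n"
  have "q * (lam + 2) + c < (2 * n + 1) * (lam + 2)"
  proof -
    have "q * (lam + 2) \<le> 2 * n * (lam + 2)" by (rule mult_le_mono1[OF q])
    then show ?thesis using c by (simp only: distrib_right mult_1)
  qed
  also have "\<dots> \<le> (3 * n) * (3 * max 1 lam)"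
    by (rule mult_le_mono) (use n_pos in auto)
  also have "\<dots> = 9 * (max 1 lam * n)" by simp
  also have "\<dots> \<le> Z" by (simp add: Z_def)
  finally show ?thesis .
qed

lemma size_pos: "1 \<le> max 1 lam * n"
proof -
  have "1 * 1 \<le> max 1 lam * n" by (rule mult_le_mono) (use n_pos in auto)
  then show ?thesis by simp
qed

lemma n_le: "n \<le> max 1 lam * n"
proof -
  have "1 * n \<le> max 1 lam * n" by (rule mult_le_mono1) simp
  then show ?thesis by simp
qed

lemma field_bounds:
  assumes "u < 2"
  shows "PA A u i < n" "PB A u i < n" "IP A u i < lam + 2" "ROW A u i \<le> 2 * n"
proof -
  note N = N.side_tab_bounds[of dec i, OF dec_E] and R = R.side_tab_bounds[of dec i, OF dec_E]
  have "PA A u i < n \<and> PB A u i < n \<and> IP A u i < lam + 2 \<and> ROW A u i \<le> 2 * n"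
  proof (rule two_cases[OF assms])
    assume u: "u = 0"
    show ?thesis unfolding u
      using N A_side(1)[of 0 i] A_side(1)[of 1 i] A_side(1)[of 2 i] A_side(1)[of 6 i] by simp
  next
    assume u: "u = 1"
    show ?thesis unfolding u
      using R A_side(2)[of 0 i] A_side(2)[of 1 i] A_side(2)[of 2 i] A_side(2)[of 6 i] by simp
  qed
  then show "PA A u i < n" "PB A u i < n" "IP A u i < lam + 2" "ROW A u i \<le> 2 * n" by auto
qed

end

sublocale query_structure \<subseteq> query_arrays w Z X n m A
proof
  have W: "scal A 1 = lam + 2" by (simp add: A_def scalar_def)
  show "0 < w" "100 * (X * X) \<le> 2 ^ (w - 1)" by (rule w_pos X_big)+
  show "A a i < X" for a i by (rule A_less)
  show "10 \<le> Z" "n \<le> Z" using size_pos n_le by (simp_all add: Z_def)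
  show "1 \<le> n" by (rule n_pos)
  show "m \<le> X" using X_ge(4) by simp
  show "scal A 0 = n" "scal A 1 = scal A 2 + 2" "scal A 6 = w - 1" "scal A 7 = 40 * Z"
    by (simp_all add: A_def scalar_def)
  have N0Z: "21 * N0 < Z" using size_pos by (simp add: N0 Z_def)
  show "scal A 5 * x mod scal A 4 div scal A 3 < Z" for x
  proof -
    have "scal A 5 * x mod scal A 4 div scal A 3 = hash (Suc m) N0 a0 x"
      by (simp add: A_def scalar_def hash_def)
    then show ?thesis using hash_N0[of x] N0Z by linarith
  qed
  show "Suc (cell A x) < Z" for x using place_less[of x] N0Z by (simp add: cell_place)
  show "A 5 i \<le> 1" for i by (simp add: A_def split: option.split)
  show "PA A u i < n" "PB A u i < n" "IP A u i < scal A 1" if "u < 2" for u i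
    unfolding W using field_bounds[OF that] by auto
  show "ROW A u i * scal A 1 + c < Z" if "u < 2" "c < scal A 1" for u i c
    using Z_rows field_bounds(4)[OF that(1)] that(2) unfolding W by blast
  show "q * scal A 1 + c < Z" if "q < n" "c < scal A 1" for q c
    using Z_rows[of c q] that unfolding W by simp
  show "LLO A u q < q \<or> (LLO A u q = 0 \<and> LHI A u q = n)" if "u < 2" "q < n" for u q
    by (rule two_cases[OF that(1)]) (use N.LLO_bound[of q] R.LLO_bound[of q] that(2) in simp_all)
  show "PRE A u v < n" if "u < 2" "v < n" for u v
    by (rule two_cases[OF that(1)])
      (use N.pre_less[of v] R.pre_less[of v] that(2) in \<open>simp_all add: fld_def A_def\<close>)
qed

context query_structure
begin

lemma flag_iff: "e < m \<Longrightarrow> A 5 (slot A e) \<noteq> 0 \<longleftrightarrow> in_min_cut e"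
  using dec_slot[of e] keys_props(1)[of e] by (auto simp: A_def in_min_cut_def)

lemma pairf_iff:
  assumes "e1 < m" "e2 < m"
  shows "pairf A 0 (slot A e1) (slot A e2) \<longleftrightarrow> N.paired e1 e2"
    "pairf A 1 (slot A e1) (slot A e2) \<longleftrightarrow> R.paired e1 e2"
  using N.pairf_correct R.pairf_correct assms by auto

lemma TT_iff:
  assumes "e \<in> F" "v < n"
  shows "TT A 0 (N.pre v * scal A 1 + IP A 0 (slot A e)) < JJ A 0 (slot A e) \<longleftrightarrow> N.reach {} (ta e) v"
  using N.TT_correct[of e "N.pre v" "IP A 0 (slot A e)"] assms N.pre_less[of v] N.vert_pre[of v] N.F_E by auto

lemma dblf_iff:
  assumes "e1 < m" "e2 < m"
  shows "dblf A (slot A e1) (slot A e2) \<longleftrightarrow> both_in_min_cut e1 e2"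
proof (cases "in_min_cut e1 \<and> in_min_cut e2")
  case True
  then have F: "e1 \<in> F" "e2 \<in> F" by (auto simp: in_min_cut_def)
  have V: "he e1 < n" "he e2 < n" using N.he_V assms by auto
  have P: "PB A 0 (slot A e1) = N.pre (he e1)" "PB A 0 (slot A e2) = N.pre (he e2)"
    using N.PB keys_props(1) F by auto
  show ?thesis
    unfolding dblf_def P TT_iff[OF F(1) V(2)] TT_iff[OF F(2) V(1)] flag_iff[OF assms(1)] flag_iff[OF assms(2)]
    using True by (auto simp: both_in_min_cut_def)
next
  case False
  then show ?thesis using flag_iff assms by (auto simp: dblf_def both_in_min_cut_def)
qed

lemma sizef_correct:
  assumes "e1 < m" "e2 < m"
  shows "sizef A (slot A e1) (slot A e2) = dual_size e1 e2"
proof -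
  have "scal A 9 = lam - 2" "scal A 8 = lam - 1" "scal A 2 = lam" by (simp_all add: A_def scalar_def)
  then show ?thesis
    unfolding sizef_def dual_size_def dblf_iff[OF assms] flag_iff[OF assms(1)] flag_iff[OF assms(2)]
      pairf_iff[OF assms] by simp
qed

lemma bitf_correct:
  assumes e: "e1 < m" "e2 < m" "e1 \<noteq> e2" and v: "v < n"
  shows "bitf A (slot A e1) (slot A e2) v \<longleftrightarrow> v \<in> dual_cut e1 e2"
proof -
  let ?a = "slot A e1" and ?b = "slot A e2"
  have E: "e1 \<in> {..<m}" "e2 \<in> {..<m}" using e by auto
  have vV: "v \<in> {..<n}" using v by simp
  have fl: "A 5 ?a \<noteq> 0 \<longleftrightarrow> in_min_cut e1" "A 5 ?b \<noteq> 0 \<longleftrightarrow> in_min_cut e2" "A 5 ?b = 0 \<longleftrightarrow> \<not> in_min_cut e2"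
    "A 5 ?a = 0 \<longleftrightarrow> \<not> in_min_cut e1"
    using flag_iff[OF e(1)] flag_iff[OF e(2)] by auto
  have sideE: "side A ?a ?b = of_bool (\<not> in_min_cut e1 \<and> \<not> in_min_cut e2 \<and> \<not> N.paired e1 e2 \<and> R.paired e1 e2)"
    unfolding side_def pairf_iff[OF e(1,2)] fl by simp
  have actE: "actf A ?a ?b \<longleftrightarrow> \<not> in_min_cut e1 \<and> \<not> in_min_cut e2 \<and> (N.paired e1 e2 \<or> R.paired e1 e2)"
    unfolding actf_def pairf_iff[OF e(1,2)] fl by simp
  have defE: "deff A ?a ?b \<longleftrightarrow> \<not> in_min_cut e1 \<and> \<not> in_min_cut e2 \<and> \<not> N.paired e1 e2 \<and> \<not> R.paired e1 e2"
    unfolding deff_def pairf_iff[OF e(1,2)] fl by simp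
  have pre0: "PRE A 0 v = N.pre v" and pre1: "PRE A 1 v = R.pre v" using v by (simp_all add: fld_def A_def)
  have s2: "scal A 2 = lam" by (simp add: A_def scalar_def)
  note db = dblf_iff[OF e(1,2)]
  consider "in_min_cut e1 \<or> in_min_cut e2"
    | "\<not> in_min_cut e1" "\<not> in_min_cut e2" "N.paired e1 e2"
    | "\<not> in_min_cut e1" "\<not> in_min_cut e2" "\<not> N.paired e1 e2" "R.paired e1 e2"
    | "\<not> in_min_cut e1" "\<not> in_min_cut e2" "\<not> N.paired e1 e2" "\<not> R.paired e1 e2" by blast
  then show ?thesis
  proof cases
    case 1
    have u: "side A ?a ?b = 0" using 1 sideE by auto
    have nact: "\<not> actf A ?a ?b" "\<not> deff A ?a ?b" using 1 actE defE by auto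
    \<comment> \<open>Here the interval is empty, so only the tables of minimum cuts are
      read.\<close>
    have "bitf A ?a ?b v \<longleftrightarrow>
        TT A 0 (N.pre v * scal A 1 + IP A 0 ?a) < (if in_min_cut e1 then JJ A 0 ?a else 0) \<or>
        TT A 0 (N.pre v * scal A 1 + IP A 0 ?b) <
          (if both_in_min_cut e1 e2 \<or> in_min_cut e2 \<and> \<not> in_min_cut e1 then JJ A 0 ?b else 0)"
      unfolding bitf_def Let_def u pre0 i1f_def j1f_def j2f_def lof_def hif_def db fl
      using nact by simp
    moreover have "e1 \<in> F" if "in_min_cut e1" using that by (simp add: in_min_cut_def)
    moreover have "e2 \<in> F" if "in_min_cut e2" using that by (simp add: in_min_cut_def)
    moreover have "both_in_min_cut e1 e2 \<Longrightarrow> in_min_cut e1 \<and> in_min_cut e2" by (simp add: both_in_min_cut_def)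
    ultimately show ?thesis
      using 1 TT_iff[OF _ v] v by (auto simp: dual_cut_def cl_def split: if_splits)
  next
    case 2
    have u: "side A ?a ?b = 0" using 2 sideE by auto
    have act: "actf A ?a ?b" "\<not> deff A ?a ?b" using 2 actE defE by auto
    have nb: "\<not> both_in_min_cut e1 e2" using 2 by (simp add: both_in_min_cut_def)
    have rs: "i1f A ?a ?b = IP A 0 ?a" "j1f A ?a ?b = JJ A 0 ?a" "j2f A ?a ?b = JJ A 0 ?b"
      "lof A ?a ?b = max (LO A 0 ?a) (LO A 0 ?b)" "hif A ?a ?b = min (HI A 0 ?a) (HI A 0 ?b)"
      using act by (simp_all add: i1f_def j1f_def j2f_def lof_def hif_def u)
    show ?thesis
      unfolding bitf_def Let_def u pre0 rs N.pair_bit[OF E e(3) 2(3) vV]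
      using 2 nb by (simp add: dual_cut_def)
  next
    case 3
    have u: "side A ?a ?b = 1" using 3 sideE by auto
    have act: "actf A ?a ?b" "\<not> deff A ?a ?b" using 3 actE defE by auto
    have nb: "\<not> both_in_min_cut e1 e2" using 3 by (simp add: both_in_min_cut_def)
    have rs: "i1f A ?a ?b = IP A 1 ?a" "j1f A ?a ?b = JJ A 1 ?a" "j2f A ?a ?b = JJ A 1 ?b"
      "lof A ?a ?b = max (LO A 1 ?a) (LO A 1 ?b)" "hif A ?a ?b = min (HI A 1 ?a) (HI A 1 ?b)"
      using act by (simp_all add: i1f_def j1f_def j2f_def lof_def hif_def u)
    show ?thesis
      unfolding bitf_def Let_def u pre1 rs R.pair_bit[OF E e(3) 3(4) vV]
      using 3 nb v by (simp add: dual_cut_def)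
  next
    case 4
    have u: "side A ?a ?b = 0" using 4 sideE by auto
    have act: "\<not> actf A ?a ?b" "deff A ?a ?b" using 4 actE defE by auto
    have nb: "\<not> both_in_min_cut e1 e2" using 4 by (simp add: both_in_min_cut_def)
    have q: "N.pre v < card {..<n}" by (rule N.pre_less[OF vV])
    show ?thesis
      unfolding bitf_def Let_def u pre0 i1f_def j1f_def j2f_def lof_def hif_def s2
      using N.TT_source[OF q] act 4 nb v N.vert_pre[OF vV] fl db by (simp add: dual_cut_def cl_def)
  qed
qed

end

section \<open>Word length and final assembly\<close>

text \<open>Since \<open>100 * 4096 * 4096 < 2 ^ 31\<close>, the left side is at most
  \<open>Y ^ 41\<close>. Moreover \<open>2 * Y ^ 41 \<le> Y ^ 60 \<le> 2 ^ w\<close>, where the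
  factor 60 leaves some slack.\<close>

lemma word_bounds:
  fixes Y :: nat
  assumes "2 \<le> Y"
  defines "w \<equiv> 60 * ceillog2 Y" and "X \<equiv> 4096 * Y ^ 5"
  shows "0 < w" "w - 1 < X" "100 * (X * X) \<le> 2 ^ (w - 1)"
proof -
  have Y: "Y \<le> 2 ^ ceillog2 Y" by (rule le_two_power_ceillog2)
  then have c0: "0 < ceillog2 Y" using assms(1) by (cases "ceillog2 Y") auto
  then show w0: "0 < w" by (simp add: w_def)
  have "ceillog2 Y \<le> Y" using ceillog2_le_iff[of Y Y] assms(1) less_exp[of Y] by simp
  moreover have "Y \<le> Y ^ 5" using assms(1) by (simp add: self_le_power)
  ultimately show "w - 1 < X" using assms(1) unfolding w_def X_def by linarith
  have "100 * (X * X) = (100 * 4096 * 4096) * Y ^ 10"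
    by (simp add: X_def power_mult_distrib flip: power_add)
  also have "\<dots> \<le> 2 ^ 31 * Y ^ 10" by (rule mult_le_mono1) simp
  also have "\<dots> \<le> Y ^ 31 * Y ^ 10" by (intro mult_le_mono1 power_mono) (use assms(1) in auto)
  finally have 1: "100 * (X * X) \<le> Y ^ 41" by (simp flip: power_add)
  have "2 * Y ^ 41 \<le> Y * Y ^ 41" using assms(1) by (intro mult_le_mono1)
  also have "\<dots> = Y ^ 42" using power_Suc[of Y 41] by simp
  also have "\<dots> \<le> Y ^ 60" by (rule power_increasing) (use assms(1) in auto)
  also have "\<dots> \<le> (2 ^ ceillog2 Y) ^ 60" by (rule power_mono[OF Y]) simp
  also have "\<dots> = 2 ^ w" unfolding w_def by (simp only: power_mult[symmetric] mult.commute)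
  also have "\<dots> = 2 * 2 ^ (w - 1)" using w0 by (cases w) auto
  finally show "100 * (X * X) \<le> 2 ^ (w - 1)" using 1 by linarith
qed

text \<open>The exponent 5 comes from the moduli of the second hash level:
  \<open>N0 \<le> 3 * (Y * Y)\<close> makes them at most \<open>37 * Y ^ 5\<close>. The factor 4096
  covers the length 3200 of the data structure per unit of \<open>max 1 l * n\<close>.\<close>

lemma table_bounds:
  fixes n m l :: nat
  assumes "2 \<le> n" "l \<le> m"
  defines "Y \<equiv> n + m" and "N0 \<equiv> 3 * (max 1 l * n)"
  shows "(4 * N0 * N0 + 1) * Suc m < 4096 * Y ^ 5" "3200 * (max 1 l * n) < 4096 * Y ^ 5"
    "2 * n + l + 2 < 4096 * Y ^ 5" "Suc m < 4096 * Y ^ 5"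
proof -
  have Y2: "2 \<le> Y" using assms(1) by (simp add: Y_def)
  have p1: "Y \<le> Y ^ 5" "Y * Y \<le> Y ^ 5" "1 \<le> Y ^ 5" "1 \<le> Y ^ 4"
    using Y2 power_increasing[of 1 5 Y] power_increasing[of 2 5 Y] by (simp_all add: power2_eq_square)
  have ln: "max 1 l * n \<le> Y * Y"
    by (rule mult_le_mono) (use assms(1,2) in \<open>auto simp: Y_def\<close>)
  then have "N0 \<le> 3 * (Y * Y)" by (simp add: N0_def)
  then have "N0 * N0 \<le> 3 * (Y * Y) * (3 * (Y * Y))" by (intro mult_le_mono)
  also have "\<dots> = 9 * Y ^ 4" by (simp add: power4_eq_xxxx)
  finally have "4 * N0 * N0 + 1 \<le> 37 * Y ^ 4" using p1(4) by simp
  then have "(4 * N0 * N0 + 1) * Suc m \<le> 37 * Y ^ 4 * Y"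
    by (rule mult_le_mono) (use assms(1) in \<open>simp add: Y_def\<close>)
  also have "\<dots> = 37 * Y ^ 5" using power_Suc2[of Y 4] by simp
  finally show "(4 * N0 * N0 + 1) * Suc m < 4096 * Y ^ 5" using p1(3) by linarith
  show "3200 * (max 1 l * n) < 4096 * Y ^ 5" using ln p1 by linarith
  have "n \<le> Y" "l \<le> Y" "m \<le> Y" using assms(2) by (auto simp: Y_def)
  then show "2 * n + l + 2 < 4096 * Y ^ 5" "Suc m < 4096 * Y ^ 5" using p1 Y2 by linarith+
qed

context query_structure
begin

lemma oracle_correct:
  fixes G :: "(nat, nat) pre_digraph"
  assumes G: "fin_digraph G" "verts G = {..<n}" "arcs G = {..<m}" "tail G = ta" "head G = he"
    and T: "length (comp_prog 40 0 size_coms) \<le> T1" "length (comp_prog 40 0 cut_coms) * n \<le> T2"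
  shows "is_dual_ft_min_cut_oracle w (comp_prog 40 0 size_coms) T1 (comp_prog 40 0 cut_coms) T2 G s t D"
proof -
  have main: "min_cut_size (del_arcs G {e1, e2}) s t = dual_size e1 e2"
    "is_min_cut_partition (del_arcs G {e1, e2}) s t (dual_cut e1 e2) ({..<n} - dual_cut e1 e2)"
    if e: "e1 < m" "e2 < m" "e1 \<noteq> e2" for e1 e2
  proof -
    let ?H = "del_arcs G {e1, e2}"
    have E: "e1 \<in> {..<m}" "e2 \<in> {..<m}" using e by auto
    interpret fin_digraph G by (rule G(1))
    have H: "fin_digraph ?H" by unfold_locales (auto simp: del_arcs_def)
    \<comment> \<open>The vertex sets are the same before and after the failures, so optimality is
      compared set by set, with the failed edges removed from each cut.\<close>
    have C: "{e \<in> arcs ?H. tail ?H e \<in> A' \<and> head ?H e \<notin> A'} = N.cross A' - {e1, e2}" for A'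
      using G by (auto simp: del_arcs_def N.cross_def)
    have vH: "verts ?H = {..<n}" using G by (simp add: del_arcs_def)
    note d = dual_cut_correct[OF E e(3)]
    have min: "card (N.cross (dual_cut e1 e2) - {e1, e2}) \<le> card (N.cross A' - {e1, e2})"
      if "A' \<subseteq> {..<n}" "s \<in> A'" "t \<notin> A'" for A'
      using d(4) dual_size_le[OF E e(3) that] by linarith
    have eq: "card (N.cross (dual_cut e1 e2) - {e1, e2}) = dual_size e1 e2"
      using d(4) dual_size_le[OF E e(3) d(1-3)] by linarith
    note mv = min_vertex_cut[OF H, unfolded C vH, OF N.s_V N.t_V d(1-3) min]
    show "min_cut_size ?H s t = dual_size e1 e2" using mv(1) eq by simp
    show "is_min_cut_partition ?H s t (dual_cut e1 e2) ({..<n} - dual_cut e1 e2)" using mv(2) .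
  qed
  show ?thesis
    unfolding is_dual_ft_min_cut_oracle_def G(3)
  proof (intro conjI ballI impI)
    fix x assume "x \<in> set D"
    then show "x < 2 ^ w" by (rule D_bounds(2))
  next
    fix e1 e2 assume "e1 \<in> {..<m}" "e2 \<in> {..<m}" "e1 \<noteq> e2"
    then have e: "e1 < m" "e2 < m" "e1 \<noteq> e2" by auto
    show "query w (comp_prog 40 0 size_coms) D [e1, e2] T1
        (\<lambda>xs. xs = [min_cut_size (del_arcs G {e1, e2}) s t])"
      using size_query[OF e(1,2) T(1)] by (simp add: main(1)[OF e] sizef_correct[OF e(1,2)])
    have eq: "map (\<lambda>v. of_bool (bitf A (slot A e1) (slot A e2) v)) [0..<n] =
        map (\<lambda>v. if v \<in> dual_cut e1 e2 then 1 else (0::nat)) [0..<n]"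
      using bitf_correct[OF e] by auto
    have "\<exists>A B. is_min_cut_partition (del_arcs G {e1, e2}) s t A B \<and>
        xs = map (\<lambda>v. if v \<in> A then 1 else 0) [0..<n]"
      if xs: "xs = map (\<lambda>v. of_bool (bitf A (slot A e1) (slot A e2) v)) [0..<n]" for xs :: "nat list"
    proof (intro exI conjI)
      show "is_min_cut_partition (del_arcs G {e1, e2}) s t (dual_cut e1 e2) ({..<n} - dual_cut e1 e2)"
        by (rule main(2)[OF e])
      show "xs = map (\<lambda>v. if v \<in> dual_cut e1 e2 then 1 else 0) [0..<n]"
        using xs eq by (rule trans)
    qed
    then show "query w (comp_prog 40 0 cut_coms) D [e1, e2] T2
        (\<lambda>xs. \<exists>A B. is_min_cut_partition (del_arcs G {e1, e2}) s t A B \<and>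
                 xs = map (\<lambda>v. if v \<in> A then 1 else 0) [0..<card (verts G)])"
      using cut_query[OF e(1,2) T(2)] unfolding query_def Let_def G(2) card_lessThan by blast
  qed
qed

text \<open>The set reached from \<open>s\<close> has no leaving residual arc and therefore attains
  the value of the flow.\<close>

lemma min_cut_size_lam:
  fixes G :: "(nat, nat) pre_digraph"
  assumes G: "fin_digraph G" "verts G = {..<n}" "arcs G = {..<m}" "tail G = ta" "head G = he"
  shows "min_cut_size G s t = lam"
proof -
  note c = cl_cut[OF N.s_V N.t_V not_reach_s_t]
  have sub: "cl s \<subseteq> {..<n}" by (auto simp: cl_def)
  have C: "{e \<in> arcs G. tail G e \<in> A' \<and> head G e \<notin> A'} = N.cross A'" for A'
    using G by (auto simp: N.cross_def)
  have eq: "card (N.cross (cl s)) = lam" using card_cross[OF sub c(1,2)] c(3) by simp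
  have "card (N.cross (cl s)) \<le> card (N.cross A')" if "A' \<subseteq> {..<n}" "s \<in> A'" "t \<notin> A'" for A'
    using card_cross[OF that] eq by simp
  then show ?thesis
    using min_vertex_cut(1)[OF G(1), unfolded C G(2), OF N.s_V N.t_V sub c(1,2)] eq by simp
qed

end

theorem theorem3:
  shows "\<exists>(P_size :: program) (P_cut :: program) (k :: nat) (c :: nat). k \<ge> 1 \<and>
    (\<forall>(G :: (nat, nat) pre_digraph) n m s t l.
       fin_digraph G \<and> verts G = {..<n} \<and> arcs G = {..<m} \<and>
       s \<in> verts G \<and> t \<in> verts G \<and> s \<noteq> t \<and> l = min_cut_size G s t \<longrightarrow>
       (\<exists>D. length D \<le> c * (max 1 l * n) \<and>
            is_dual_ft_min_cut_oracle (word_length k G) P_size c P_cut (c * n) G s t D))"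
proof -
  let ?P = "comp_prog 40 0 size_coms"
  let ?P' = "comp_prog 40 0 cut_coms"
  \<comment> \<open>3200 is 40 arrays times the factor 80 of \<open>Z\<close>; the program lengths
    bound the running times.\<close>
  define c where "c = length ?P + length ?P' + 3200"
  have "\<exists>D. length D \<le> c * (max 1 l * n) \<and>
      is_dual_ft_min_cut_oracle (word_length 60 G) ?P c ?P' (c * n) G s t D"
    if G: "fin_digraph G" "verts G = {..<n}" "arcs G = {..<m}"
      and st: "s \<in> verts G" "t \<in> verts G" "s \<noteq> t" and l: "l = min_cut_size G s t"
    for G :: "(nat, nat) pre_digraph" and n m s t l
  proof -
    interpret fin_digraph G by (rule G(1))
    have nw: "network {..<n} {..<m} (tail G) (head G) s t"
      using st tail_in_verts head_in_verts G by unfold_locales auto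
    obtain F lam P pe len r P' pe' where
      "two_sided {..<n} {..<m} (tail G) (head G) s t F lam P pe len r P' pe'"
      using ex_two_sided[OF nw] by (elim exE) (rule that)
    then interpret two_sided "{..<n}" "{..<m}" "tail G" "head G" s t F lam P pe len r P' pe' .
    define N0 where "N0 = 3 * (max 1 lam * n)"
    have n2: "2 \<le> n" using st G(2) by auto
    have N0_pos: "0 < N0" using n2 by (simp add: N0_def)
    have "keys \<subseteq> {..<Suc m}" using keys_E by auto
    moreover have "card keys \<le> N0" using card_keys by (simp add: N0_def)
    ultimately obtain a0 ha hm off where h: "a0 < N0 * Suc m"
      "\<forall>i<N0. ha i < hm i * Suc m \<and> 0 < hm i \<and> hm i \<le> 4 * N0 * N0 + 1 \<and> off i + hm i \<le> 21 * N0"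
      "inj_on (\<lambda>x. off (hash (Suc m) N0 a0 x) + hash (Suc m) (hm (hash (Suc m) N0 a0 x)) (ha (hash (Suc m) N0 a0 x)) x) keys"
      using perfect_hash[of keys "Suc m" N0] N0_pos by blast
    define w where "w = 60 * ceillog2 (n + m)"
    define X where "X = 4096 * (n + m) ^ 5"
    have lm: "lam \<le> m" using lam_le by simp
    have nm: "2 \<le> n + m" using n2 by simp
    interpret query_structure n m "tail G" "head G" s t F lam P pe len r P' pe' w N0 X a0 ha hm off
      using h word_bounds[OF nm] table_bounds[OF n2 lm]
      by unfold_locales (simp_all add: N0_def w_def X_def)
    have "l = lam" using min_cut_size_lam[OF G refl refl] l by simp
    have "length D = 40 * Z" by (rule D_bounds(1))
    also have "\<dots> = 3200 * (max 1 lam * n)" by (simp add: Z_def)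
    also have "\<dots> \<le> c * (max 1 lam * n)" by (rule mult_le_mono1) (simp add: c_def)
    finally have "length D \<le> c * (max 1 l * n)" using \<open>l = lam\<close> by simp
    moreover have "word_length 60 G = w" using G by (simp add: word_length_def w_def)
    moreover have "is_dual_ft_min_cut_oracle w ?P c ?P' (c * n) G s t D"
      by (rule oracle_correct[OF G refl refl]) (auto simp: c_def)
    ultimately show ?thesis by auto
  qed
  then show ?thesis by (intro exI[of _ ?P] exI[of _ ?P'] exI[of _ 60] exI[of _ c]) auto
qed

end
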